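(* There is a polynomial-time 6-approximation algorithm for \textsc{min-max} RFTT on instances in which $G$ is a tree; i.e. it outputs a polynomial-size description of a feasible solution whose maximum tour length is at most $6\,OPT(G,\tau)$.
   Context: RFTT: an instance is $(G,\tau)$ with $G=(V\cup\{s\},E,c)$ a connected graph with depot $s$, nonnegative edge weights $c$, clients $V=\{v_1,\dots,v_n\}$ and turnover times $\tau\in\mathbb{N}^n$. A solution gives for each day $k\ge1$ a closed walk $T_k$ in $G$ from $s$ to $s$ and a set $J_k\subseteq V$ of clients on $T_k$ visited that day; it is feasible if for all $t\ge0$ and all $j$, $v_j\in\bigcup_{k=t+1}^{t+\tau_j}J_k$; solutions are periodic. \textsc{min-max} minimizes $\max_k c(T_k)$, where $c(T_k)$ is the total edge weight of $T_k$ with multiplicity; $OPT(G,\tau)$ is the optimal value. *)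

theory Defs
  imports Complex_Main "HOL-Computational_Algebra.Polynomial"
begin

section \<open>Model of computation\<close>

text \<open>
  Polynomial time is measured in first-order recursive programs over binary trees, i.e. first-order
  LISP without atoms other than \<open>Leaf\<close>, as in Jones, Computability and Complexity from a
  Programming Perspective (language F). Every evaluation step costs 1 and reading a variable
  additionally costs the size of the value read. Hence the running time bounds the size of every
  value that occurs (lemma \<open>size_le_time\<close>), no exponentially large value can be built by sharing,
  and programs and Turing machines simulate each other with polynomial overhead.
\<close>

datatype sexp = Leaf | Pair sexp sexp

datatype expr =
    EVar nat
  | ELeaf
  | EPair expr expr
  | EHd expr
  | ETl expr
  | EIf expr expr expr
  | ECall nat "expr list"

text \<open>A program is the finite list of the bodies of its functions; the first one is the main
  function. The variable \<open>EVar i\<close> is the \<open>i\<close>-th argument of the function.\<close>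

type_synonym prog = "expr list"

fun hd_sexp :: "sexp \<Rightarrow> sexp" where
  "hd_sexp Leaf = Leaf"
| "hd_sexp (Pair a b) = a"

fun tl_sexp :: "sexp \<Rightarrow> sexp" where
  "tl_sexp Leaf = Leaf"
| "tl_sexp (Pair a b) = b"

text \<open>\<open>evals P env e v t\<close>: in environment \<open>env\<close>, \<open>e\<close> evaluates to \<open>v\<close> in time \<open>t\<close>.\<close>

inductive evals :: "prog \<Rightarrow> sexp list \<Rightarrow> expr \<Rightarrow> sexp \<Rightarrow> nat \<Rightarrow> bool"
  and evals_list :: "prog \<Rightarrow> sexp list \<Rightarrow> expr list \<Rightarrow> sexp list \<Rightarrow> nat \<Rightarrow> bool"
  for P :: prog
where
  Var: "i < length env \<Longrightarrow> evals P env (EVar i) (env ! i) (1 + size (env ! i))"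
| LeafE: "evals P env ELeaf Leaf 1"
| PairE: "evals P env e1 v1 t1 \<Longrightarrow> evals P env e2 v2 t2 \<Longrightarrow>
    evals P env (EPair e1 e2) (Pair v1 v2) (1 + t1 + t2)"
| Hd: "evals P env e v t \<Longrightarrow> evals P env (EHd e) (hd_sexp v) (1 + t)"
| Tl: "evals P env e v t \<Longrightarrow> evals P env (ETl e) (tl_sexp v) (1 + t)"
| IfTrue: "evals P env e v0 t0 \<Longrightarrow> v0 \<noteq> Leaf \<Longrightarrow> evals P env e1 v t \<Longrightarrow>
    evals P env (EIf e e1 e2) v (1 + t0 + t)"
| IfFalse: "evals P env e Leaf t0 \<Longrightarrow> evals P env e2 v t \<Longrightarrow>
    evals P env (EIf e e1 e2) v (1 + t0 + t)"
| Call: "f < length P \<Longrightarrow> evals_list P env es vs t0 \<Longrightarrow> evals P vs (P ! f) v t \<Longrightarrow>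
    evals P env (ECall f es) v (1 + t0 + t)"
| NilE: "evals_list P env [] [] 0"
| ConsE: "evals P env e v t1 \<Longrightarrow> evals_list P env es vs t2 \<Longrightarrow>
    evals_list P env (e # es) (v # vs) (t1 + t2)"

text \<open>On input \<open>x\<close>, the program \<open>P\<close> halts after \<open>t\<close> time units with output \<open>y\<close>.\<close>

definition runs :: "prog \<Rightarrow> sexp \<Rightarrow> sexp \<Rightarrow> nat \<Rightarrow> bool" where
  "runs P x y t \<longleftrightarrow> P \<noteq> [] \<and> evals P [x] (P ! 0) y t"

lemma size_le_time_aux:
  "evals P env e v t \<Longrightarrow> size v \<le> t"
  "evals_list P env es vs t \<Longrightarrow> sum_list (map size vs) \<le> t"
proof (induction rule: evals_evals_list.inducts)
  case (Hd env e v t)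
  then show ?case by (cases v) auto
next
  case (Tl env e v t)
  then show ?case by (cases v) auto
qed auto

lemma size_le_time: "runs P x y t \<Longrightarrow> size y \<le> t"
  by (auto simp: runs_def dest: size_le_time_aux)

lemma evals_deterministic:
  "evals P env e v t \<Longrightarrow> evals P env e v' t' \<Longrightarrow> v = v' \<and> t = t'"
  "evals_list P env es vs t \<Longrightarrow> evals_list P env es vs' t' \<Longrightarrow> vs = vs' \<and> t = t'"
proof (induction arbitrary: v' t' and vs' t' rule: evals_evals_list.inducts)
  case (Var i env)
  then show ?case by (auto elim: evals.cases)
next
  case (LeafE env)
  then show ?case by (auto elim: evals.cases)
next
  case (PairE env e1 v1 t1 e2 v2 t2)
  from PairE.prems show ?case by cases (use PairE in \<open>blast+\<close>)
next
  case (Hd env e v t)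
  from Hd.prems show ?case by cases (use Hd in \<open>blast+\<close>)
next
  case (Tl env e v t)
  from Tl.prems show ?case by cases (use Tl in \<open>blast+\<close>)
next
  case (IfTrue env e v0 t0 e1 v t e2)
  from IfTrue.prems show ?case by cases (use IfTrue in \<open>blast+\<close>)
next
  case (IfFalse env e t0 e2 v t e1)
  from IfFalse.prems show ?case by cases (use IfFalse in \<open>blast+\<close>)
next
  case (Call f env es vs t0 v t)
  from Call.prems show ?case by cases (use Call in \<open>blast+\<close>)
next
  case (NilE env)
  then show ?case by (auto elim: evals_list.cases)
next
  case (ConsE env e v t1 es vs t2)
  from ConsE.prems show ?case by cases (use ConsE in \<open>blast+\<close>)
qed

lemma runs_deterministic: "runs P x y t \<Longrightarrow> runs P x y' t' \<Longrightarrow> y = y' \<and> t = t'"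
  by (auto simp: runs_def dest: evals_deterministic)


section \<open>Replenishment with fixed turnover times\<close>

text \<open>The depot is vertex 0 and the clients are the vertices \<open>1, \<dots>, n\<close>. Only the weights of
  edges and the turnover times of clients matter.\<close>

record rftt =
  num_clients :: nat
  edges :: "nat set set"
  weight :: "nat set \<Rightarrow> rat"
  turnover :: "nat \<Rightarrow> nat"

definition depot :: nat where "depot = 0"

definition clients :: "rftt \<Rightarrow> nat set" where
  "clients I = {1..num_clients I}"

definition verts :: "rftt \<Rightarrow> nat set" where
  "verts I = insert depot (clients I)"

text \<open>The graph is simple, so a walk is given by its nonempty sequence of vertices; \<open>[u]\<close> is the
  trivial walk.\<close>

definition is_walk :: "rftt \<Rightarrow> nat list \<Rightarrow> bool" where
  "is_walk I w \<longleftrightarrow> w \<noteq> [] \<and> set w \<subseteq> verts I \<and> successively (\<lambda>u v. {u, v} \<in> edges I) w"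

definition is_connected :: "rftt \<Rightarrow> bool" where
  "is_connected I \<longleftrightarrow>
     (\<forall>u\<in>verts I. \<forall>v\<in>verts I. \<exists>w. is_walk I w \<and> hd w = u \<and> last w = v)"

text \<open>A cycle is listed without repeating its first vertex at the end.\<close>

definition is_cycle :: "rftt \<Rightarrow> nat list \<Rightarrow> bool" where
  "is_cycle I w \<longleftrightarrow> is_walk I w \<and> distinct w \<and> length w \<ge> 3 \<and> {last w, hd w} \<in> edges I"

definition is_tree :: "rftt \<Rightarrow> bool" where
  "is_tree I \<longleftrightarrow> is_connected I \<and> (\<nexists>w. is_cycle I w)"

definition rftt_instance :: "rftt \<Rightarrow> bool" where
  "rftt_instance I \<longleftrightarrow>
     edges I \<subseteq> {{u, v} |u v. u \<in> verts I \<and> v \<in> verts I \<and> u \<noteq> v} \<and>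
     is_connected I \<and>
     (\<forall>e\<in>edges I. weight I e \<ge> 0) \<and>
     (\<forall>j\<in>clients I. turnover I j \<ge> 1)"

text \<open>Day \<open>k\<close> is mapped to the tour \<open>T\<^sub>k\<close> and the set \<open>J\<^sub>k\<close> of clients visited; day 0 is ignored.\<close>

type_synonym solution = "nat \<Rightarrow> nat list \<times> nat set"

abbreviation tour :: "solution \<Rightarrow> nat \<Rightarrow> nat list" where "tour S k \<equiv> fst (S k)"
abbreviation visited :: "solution \<Rightarrow> nat \<Rightarrow> nat set" where "visited S k \<equiv> snd (S k)"

definition periodic :: "solution \<Rightarrow> bool" where
  "periodic S \<longleftrightarrow> (\<exists>p\<ge>1. \<forall>k\<ge>1. S (k + p) = S k)"

definition is_solution :: "rftt \<Rightarrow> solution \<Rightarrow> bool" where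
  "is_solution I S \<longleftrightarrow> periodic S \<and>
     (\<forall>k\<ge>1. is_walk I (tour S k) \<and> hd (tour S k) = depot \<and> last (tour S k) = depot \<and>
            visited S k \<subseteq> clients I \<inter> set (tour S k))"

definition feasible :: "rftt \<Rightarrow> solution \<Rightarrow> bool" where
  "feasible I S \<longleftrightarrow> is_solution I S \<and>
     (\<forall>t. \<forall>j\<in>clients I. j \<in> (\<Union>k\<in>{t + 1..t + turnover I j}. visited S k))"

definition walk_length :: "rftt \<Rightarrow> nat list \<Rightarrow> real" where
  "walk_length I w = (\<Sum>(u, v) \<leftarrow> zip w (tl w). of_rat (weight I {u, v}))"

text \<open>By periodicity the maximum is over a finite set.\<close>

definition max_tour_length :: "rftt \<Rightarrow> solution \<Rightarrow> real" where
  "max_tour_length I S = Max ((\<lambda>k. walk_length I (tour S k)) ` {1..})"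

definition OPT :: "rftt \<Rightarrow> real" where
  "OPT I = Inf {max_tour_length I S |S. feasible I S}"


section \<open>Encodings\<close>

text \<open>Numbers are written in binary, least significant bit first.\<close>

definition enc_bit :: "bool \<Rightarrow> sexp" where
  "enc_bit b = (if b then Pair Leaf Leaf else Leaf)"

fun enc_nat :: "nat \<Rightarrow> sexp" where
  "enc_nat n = (if n = 0 then Leaf else Pair (enc_bit (odd n)) (enc_nat (n div 2)))"

declare enc_nat.simps [simp del]

fun enc_list :: "('a \<Rightarrow> sexp) \<Rightarrow> 'a list \<Rightarrow> sexp" where
  "enc_list f [] = Leaf"
| "enc_list f (a # as) = Pair (f a) (enc_list f as)"

text \<open>For nonnegative rationals only: numerator and denominator in lowest terms.\<close>

definition enc_rat :: "rat \<Rightarrow> sexp" where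
  "enc_rat r = (case quotient_of r of (a, b) \<Rightarrow> Pair (enc_nat (nat a)) (enc_nat (nat b)))"

text \<open>\<open>x\<close> encodes \<open>I\<close> if it consists of the list of weighted edges, in any order and each with its
  endpoints in any order, and of the list of turnover times of the clients \<open>1, \<dots>, n\<close>.\<close>

definition encodes :: "rftt \<Rightarrow> sexp \<Rightarrow> bool" where
  "encodes I x \<longleftrightarrow> (\<exists>es.
     distinct (map (\<lambda>(u, v). {u, v}) es) \<and> (\<lambda>(u, v). {u, v}) ` set es = edges I \<and>
     x = Pair
       (enc_list (\<lambda>(u, v). Pair (Pair (enc_nat u) (enc_nat v)) (enc_rat (weight I {u, v}))) es)
       (enc_list (\<lambda>j. enc_nat (turnover I j)) [1..<Suc (num_clients I)]))"

text \<open>The period of a solution may be exponential in the size of the instance, so a solution is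
  described implicitly: \<open>d\<close> describes \<open>S\<close> (for instance \<open>x\<close>) if the program \<open>D\<close>
  computes from \<open>x\<close>, \<open>d\<close> and the binary representation of any day \<open>k\<close> the tour and the set of
  visited clients of day \<open>k\<close>, in time polynomial (with bound \<open>q\<close>) in the size of these data.\<close>

definition describes :: "prog \<Rightarrow> nat poly \<Rightarrow> sexp \<Rightarrow> sexp \<Rightarrow> solution \<Rightarrow> bool" where
  "describes D q x d S \<longleftrightarrow> (\<forall>k\<ge>1. \<exists>js t.
     set js = visited S k \<and>
     runs D (Pair (Pair x d) (enc_nat k))
       (Pair (enc_list enc_nat (tour S k)) (enc_list enc_nat js)) t \<and>
     t \<le> poly q (size (Pair (Pair x d) (enc_nat k))))"

end

theory Submission
  imports Defs "HOL-Library.Sublist"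
begin

text \<open>
  Root the tree at the depot and let the class of an edge be the largest \<open>i\<close> such that \<open>2\<^sup>i\<close> is at most
  all turnover times below it; an edge of class \<open>i\<close> is to be used every \<open>2\<^sup>i\<close> days. The Euler tour
  passes every edge \<open>e\<close> of class \<open>i\<close> twice, and each passage gets the mass \<open>c e / 2\<^sup>i\<close>. Starting with the
  whole Euler tour, level \<open>i\<close> serves the remaining clients of class \<open>i\<close>, removes all items of this class,
  doubles the masses of the others and cuts the list into two halves of equal mass (cutting an item if
  necessary); the \<open>i\<close>-th binary digit of the day chooses the half that is passed on. The mass removed
  plus the mass passed on never exceeds the mass of the list, so the edges whose passages survive
  completely until their class is reached cost at most the total mass. Any other edge that is needed
  lies above all the items that remain at the end, so all of these edges lie on one path to the depot.
  A tour thus costs at most \<open>2 \<cdot> (2 \<cdot> OPT) + OPT\<close>, since rounding to powers of 2 loses at most a factor 2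
  in the lower bound by the average tour length. A single day can be computed directly from its
  binary digits, so the algorithm has nothing to precompute and its description is empty.
\<close>

section \<open>Polynomial-time functions\<close>

text \<open>Connectivity is the first obstacle: serving a client means buying every edge above it.
  Intervals of the Euler tour keep this under control. For a vertex above an item of an interval,
  either the interval reaches beyond one of its brackets, which then lies inside, or its span
  contains the interval; vertices of the second kind form a chain. Masses are frequencies: a passage
  of class \<open>i\<close> starts with cost / 2^i and is doubled by each of \<open>i\<close>
  halvings, so at its level it weighs its full cost. Classes do not decrease away from the depot;
  hence an edge comes due no later than any client below it, while that client is still among the
  items. The second obstacle is running time. Polynomial-time functions may be composed, but
  iterating one can produce values of exponential size. The loop over the levels is the exception:
  its growth depends on its own state, so it is bounded on encodings only, because the total mass
  never increases.\<close>

definition polyf :: "(nat \<Rightarrow> nat) \<Rightarrow> bool" where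
  "polyf T \<longleftrightarrow> (\<exists>q :: nat poly. T = poly q)"

lemma polyf_id: "polyf (\<lambda>n. n)"
  unfolding polyf_def by (rule exI[of _ "[:0, 1:]"]) auto

lemma polyf_const: "polyf (\<lambda>n. c)"
  unfolding polyf_def by (rule exI[of _ "[:c:]"]) auto

lemma polyf_add: "polyf f \<Longrightarrow> polyf g \<Longrightarrow> polyf (\<lambda>n. f n + g n)"
  unfolding polyf_def by (auto simp flip: poly_add)

lemma polyf_mult: "polyf f \<Longrightarrow> polyf g \<Longrightarrow> polyf (\<lambda>n. f n * g n)"
  unfolding polyf_def by (auto simp flip: poly_mult)

lemma polyf_comp: "polyf f \<Longrightarrow> polyf g \<Longrightarrow> polyf (\<lambda>n. f (g n))"
  unfolding polyf_def by (auto simp flip: poly_pcompose)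

lemma polyf_Suc: "polyf f \<Longrightarrow> polyf (\<lambda>n. Suc (f n))"
  using polyf_add[OF polyf_const[of 1]] by simp

lemmas polyf_intros = polyf_id polyf_const polyf_add polyf_mult polyf_Suc

text \<open>Coefficients are natural numbers, so nothing can decrease; this allows size estimates to
  be inserted into time bounds.\<close>

lemma polyf_mono: "polyf f \<Longrightarrow> a \<le> b \<Longrightarrow> f a \<le> f b"
proof -
  have "poly q a \<le> poly q b" if "a \<le> b" for q :: "nat poly"
    using that by (induction q) (auto intro!: add_mono mult_mono)
  then show "polyf f \<Longrightarrow> a \<le> b \<Longrightarrow> f a \<le> f b" by (auto simp: polyf_def)
qed

section \<open>Linking code, and closure of polynomial time under composition, pairing and
  branching\<close>

definition linked :: "prog \<Rightarrow> nat \<Rightarrow> prog \<Rightarrow> bool" where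
  "linked P n cs \<longleftrightarrow> n + length cs \<le> length P \<and> (\<forall>i<length cs. P ! (n + i) = cs ! i)"

lemma linked_Cons: "linked P n (e # cs) \<longleftrightarrow> n < length P \<and> P ! n = e \<and> linked P (Suc n) cs"
  by (auto simp: linked_def nth_Cons split: nat.splits)

lemma linked_append: "linked P n (xs @ ys) \<longleftrightarrow> linked P n xs \<and> linked P (n + length xs) ys"
proof
  assume l: "linked P n (xs @ ys)"
  then have "P ! (n + (length xs + i)) = ys ! i" if "i < length ys" for i
    using that by (auto simp: linked_def nth_append dest!: spec[of _ "length xs + i"])
  with l show "linked P n xs \<and> linked P (n + length xs) ys"
    by (auto simp: linked_def nth_append add.assoc)
next
  assume r: "linked P n xs \<and> linked P (n + length xs) ys"
  have "P ! (n + i) = (xs @ ys) ! i" if "i < length xs + length ys" for i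
  proof (cases "i < length xs")
    case True then show ?thesis using r by (auto simp: linked_def nth_append)
  next
    case False
    then have "i - length xs < length ys" using that by auto
    then have "P ! (n + length xs + (i - length xs)) = ys ! (i - length xs)"
      using r by (auto simp: linked_def)
    then show ?thesis using False by (simp add: nth_append)
  qed
  then show "linked P n (xs @ ys)" using r by (auto simp: linked_def)
qed

text \<open>Code is a function of the address at which it is loaded, so that programs can be linked
  without relocating calls.\<close>

definition ptime :: "sexp set \<Rightarrow> (sexp \<Rightarrow> sexp) \<Rightarrow> bool" where
  "ptime D f \<longleftrightarrow> (\<exists>code L T. polyf T \<and> (\<forall>n :: nat. length (code n) = L) \<and>
     (\<forall>P n. linked P n (code n) \<longrightarrow> n < length P \<and>
        (\<forall>x\<in>D. \<exists>t\<le>T (size x). evals P [x] (P ! n) (f x) t)))"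

lemma ptimeI:
  assumes "polyf T" "\<And>n. length (code n) = L" "\<And>P n. linked P n (code n) \<Longrightarrow> n < length P"
    "\<And>P n x. linked P n (code n) \<Longrightarrow> x \<in> D \<Longrightarrow> \<exists>t\<le>T (size x). evals P [x] (P ! n) (f x) t"
  shows "ptime D f"
  unfolding ptime_def using assms by blast

text \<open>The additional size bound comes from the cost model, where a value is at most as large
  as the time spent on it; the block itself, loaded at address 0, is a program that provides the
  run.\<close>

lemma ptimeE:
  assumes "ptime D f"
  obtains code L T where "polyf T" "\<And>n. length (code n) = L"
    "\<And>P n. linked P n (code n) \<Longrightarrow> n < length P"
    "\<And>P n x. linked P n (code n) \<Longrightarrow> x \<in> D \<Longrightarrow> \<exists>t\<le>T (size x). evals P [x] (P ! n) (f x) t"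
    "\<And>x. x \<in> D \<Longrightarrow> size (f x) \<le> T (size x)"
proof -
  from assms obtain code L T where *: "polyf T" "\<And>n. length (code n) = L"
    "\<And>P n. linked P n (code n) \<Longrightarrow> n < length P"
    "\<And>P n x. linked P n (code n) \<Longrightarrow> x \<in> D \<Longrightarrow> \<exists>t\<le>T (size x). evals P [x] (P ! n) (f x) t"
    unfolding ptime_def by metis
  have "size (f x) \<le> T (size x)" if "x \<in> D" for x
  proof -
    have "linked (code 0) 0 (code 0)" by (simp add: linked_def)
    from *(4)[OF this that] show ?thesis using size_le_time_aux(1) by fastforce
  qed
  with * that show ?thesis by blast
qed

lemma ptime_size:
  assumes "ptime UNIV f"
  obtains p where "polyf p" "\<And>x. size (f x) \<le> p (size x)"
  using assms by (rule ptimeE) auto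

lemma evals_call1:
  "n < length P \<Longrightarrow> evals P env e x t1 \<Longrightarrow> evals P [x] (P ! n) y t \<Longrightarrow>
   evals P env (ECall n [e]) y (Suc (t1 + t))"
  using evals_evals_list.Call[OF _ evals_evals_list.ConsE[OF _ evals_evals_list.NilE]] by fastforce

lemma evals_callx:
  "n < length P \<Longrightarrow> evals P [x] (P ! n) y t \<Longrightarrow>
   evals P [x] (ECall n [EVar 0]) y (Suc (Suc (size x + t)))"
  using evals_call1[OF _ evals_evals_list.Var[of 0 "[x]"]] by simp

lemma ptime_id: "ptime D (\<lambda>x. x)"
  unfolding ptime_def
proof (intro exI conjI)
  show "polyf (\<lambda>n. Suc n)" by (intro polyf_intros)
  show "\<forall>n::nat. length ((\<lambda>n. [EVar 0]) n) = 1" by simp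
  show "\<forall>P n. linked P n [EVar 0] \<longrightarrow> n < length P \<and>
     (\<forall>x\<in>D. \<exists>t\<le>Suc (size x). evals P [x] (P ! n) x t)"
    using evals_evals_list.Var[of 0 "[x]" for x] by (auto simp: linked_Cons)
qed

fun quote_sexp :: "sexp \<Rightarrow> expr" where
  "quote_sexp Leaf = ELeaf"
| "quote_sexp (Pair a b) = EPair (quote_sexp a) (quote_sexp b)"

fun quote_time :: "sexp \<Rightarrow> nat" where
  "quote_time Leaf = 1"
| "quote_time (Pair a b) = 1 + quote_time a + quote_time b"

lemma evals_quote: "evals P env (quote_sexp v) v (quote_time v)"
  by (induction v) (auto intro: evals_evals_list.intros simp del: One_nat_def)

lemma ptime_const: "ptime D (\<lambda>x. v)"
  unfolding ptime_def
proof (intro exI conjI)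
  show "polyf (\<lambda>n. quote_time v)" by (intro polyf_intros)
  show "\<forall>n::nat. length ((\<lambda>n. [quote_sexp v]) n) = 1" by simp
  show "\<forall>P n. linked P n [quote_sexp v] \<longrightarrow> n < length P \<and>
     (\<forall>x\<in>D. \<exists>t\<le>quote_time v. evals P [x] (P ! n) v t)"
    using evals_quote by (auto simp: linked_Cons)
qed

text \<open>The outer function has to be bounded on all trees, because nothing but the size is
  recorded about the values of \<open>a\<close>.\<close>

lemma ptime_comp:
  assumes "ptime UNIV F" "ptime D a"
  shows "ptime D (\<lambda>x. F (a x))"
proof -
  from assms(1) obtain c1 L1 T1 where 1: "polyf T1" "\<And>n. length (c1 n) = L1"
    "\<And>P n. linked P n (c1 n) \<Longrightarrow> n < length P"
    "\<And>P n x. linked P n (c1 n) \<Longrightarrow> \<exists>t\<le>T1 (size x). evals P [x] (P ! n) (F x) t"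
    by (rule ptimeE) auto
  from assms(2) obtain c2 L2 T2 where 2: "polyf T2" "\<And>n. length (c2 n) = L2"
    "\<And>P n. linked P n (c2 n) \<Longrightarrow> n < length P"
    "\<And>P n x. linked P n (c2 n) \<Longrightarrow> x \<in> D \<Longrightarrow> \<exists>t\<le>T2 (size x). evals P [x] (P ! n) (a x) t"
    "\<And>x. x \<in> D \<Longrightarrow> size (a x) \<le> T2 (size x)"
    by (rule ptimeE) auto
  define code where "code n = ECall (Suc n) [ECall (Suc n + L1) [EVar 0]] # c1 (Suc n) @ c2 (Suc n + L1)" for n
  define T where "T n = 3 + n + T2 n + T1 (T2 n)" for n
  show ?thesis
  proof (rule ptimeI[of T code])
    show "polyf T" unfolding T_def by (intro polyf_intros 2 polyf_comp[OF 1(1) 2(1)])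
    show "length (code n) = Suc (L1 + L2)" for n by (simp add: code_def 1 2)
  next
    fix P n assume "linked P n (code n)"
    then show "n < length P" by (simp add: code_def linked_Cons)
  next
    fix P n x assume "linked P n (code n)" and x: "x \<in> D"
    then have l: "n < length P" "P ! n = ECall (Suc n) [ECall (Suc n + L1) [EVar 0]]"
      "linked P (Suc n) (c1 (Suc n))" "linked P (Suc n + L1) (c2 (Suc n + L1))"
      by (auto simp: code_def linked_Cons linked_append 1 2)
    from 2(4)[OF l(4) x] obtain t2 where t2: "t2 \<le> T2 (size x)"
      "evals P [x] (P ! (Suc n + L1)) (a x) t2" by auto
    from 1(4)[OF l(3), of "a x"] obtain t1 where t1: "t1 \<le> T1 (size (a x))"
      "evals P [a x] (P ! Suc n) (F (a x)) t1" by auto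
    have "evals P [x] (P ! n) (F (a x)) (Suc (Suc (Suc (size x + t2)) + t1))"
      unfolding l(2) by (rule evals_call1[OF 1(3)[OF l(3)] evals_callx[OF 2(3)[OF l(4)] t2(2)] t1(2)])
    moreover have "T1 (size (a x)) \<le> T1 (T2 (size x))" using polyf_mono 1(1) 2(5) x by blast
    ultimately show "\<exists>t\<le>T (size x). evals P [x] (P ! n) (F (a x)) t"
      using t1(1) t2(1) by (intro exI conjI) (auto simp: T_def)
  qed
qed

lemma ptime_Pair:
  assumes "ptime D a" "ptime D b"
  shows "ptime D (\<lambda>x. Pair (a x) (b x))"
proof -
  from assms(1) obtain c1 L1 T1 where 1: "polyf T1" "\<And>n. length (c1 n) = L1"
    "\<And>P n. linked P n (c1 n) \<Longrightarrow> n < length P"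
    "\<And>P n x. linked P n (c1 n) \<Longrightarrow> x \<in> D \<Longrightarrow> \<exists>t\<le>T1 (size x). evals P [x] (P ! n) (a x) t"
    by (rule ptimeE) auto
  from assms(2) obtain c2 L2 T2 where 2: "polyf T2" "\<And>n. length (c2 n) = L2"
    "\<And>P n. linked P n (c2 n) \<Longrightarrow> n < length P"
    "\<And>P n x. linked P n (c2 n) \<Longrightarrow> x \<in> D \<Longrightarrow> \<exists>t\<le>T2 (size x). evals P [x] (P ! n) (b x) t"
    by (rule ptimeE) auto
  define code where "code n = EPair (ECall (Suc n) [EVar 0]) (ECall (Suc n + L1) [EVar 0])
    # c1 (Suc n) @ c2 (Suc n + L1)" for n
  define T where "T n = 5 + 2 * n + T2 n + T1 n" for n
  show ?thesis
  proof (rule ptimeI[of T code])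
    show "polyf T" unfolding T_def by (intro polyf_intros 1 2)
    show "length (code n) = Suc (L1 + L2)" for n by (simp add: code_def 1 2)
  next
    fix P n assume "linked P n (code n)"
    then show "n < length P" by (simp add: code_def linked_Cons)
  next
    fix P n x assume "linked P n (code n)" and x: "x \<in> D"
    then have l: "n < length P"
      "P ! n = EPair (ECall (Suc n) [EVar 0]) (ECall (Suc n + L1) [EVar 0])"
      "linked P (Suc n) (c1 (Suc n))" "linked P (Suc n + L1) (c2 (Suc n + L1))"
      by (auto simp: code_def linked_Cons linked_append 1 2)
    from 2(4)[OF l(4) x] obtain t2 where t2: "t2 \<le> T2 (size x)"
      "evals P [x] (P ! (Suc n + L1)) (b x) t2" by auto
    from 1(4)[OF l(3) x] obtain t1 where t1: "t1 \<le> T1 (size x)"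
      "evals P [x] (P ! Suc n) (a x) t1" by auto
    note evals_evals_list.PairE[OF evals_callx[OF 1(3)[OF l(3)] t1(2)]
        evals_callx[OF 2(3)[OF l(4)] t2(2)]]
    then show "\<exists>t\<le>T (size x). evals P [x] (P ! n) (Pair (a x) (b x)) t"
      unfolding l(2) using t1(1) t2(1) by (intro exI conjI) (auto simp: T_def)
  qed
qed

lemma ptime_If:
  assumes "ptime D c" "ptime D a" "ptime D b"
  shows "ptime D (\<lambda>x. if c x = Leaf then a x else b x)"
proof -
  from assms(1) obtain c0 L0 T0 where 0: "polyf T0" "\<And>n. length (c0 n) = L0"
    "\<And>P n. linked P n (c0 n) \<Longrightarrow> n < length P"
    "\<And>P n x. linked P n (c0 n) \<Longrightarrow> x \<in> D \<Longrightarrow> \<exists>t\<le>T0 (size x). evals P [x] (P ! n) (c x) t"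
    by (rule ptimeE) auto
  from assms(2) obtain c1 L1 T1 where 1: "polyf T1" "\<And>n. length (c1 n) = L1"
    "\<And>P n. linked P n (c1 n) \<Longrightarrow> n < length P"
    "\<And>P n x. linked P n (c1 n) \<Longrightarrow> x \<in> D \<Longrightarrow> \<exists>t\<le>T1 (size x). evals P [x] (P ! n) (a x) t"
    by (rule ptimeE) auto
  from assms(3) obtain c2 L2 T2 where 2: "polyf T2" "\<And>n. length (c2 n) = L2"
    "\<And>P n. linked P n (c2 n) \<Longrightarrow> n < length P"
    "\<And>P n x. linked P n (c2 n) \<Longrightarrow> x \<in> D \<Longrightarrow> \<exists>t\<le>T2 (size x). evals P [x] (P ! n) (b x) t"
    by (rule ptimeE) auto
  \<comment> \<open>\<open>EIf\<close> takes its first branch on values other than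
    \<open>Leaf\<close>, so the call of \<open>b\<close> precedes that of \<open>a\<close>.\<close>
  define e where "e n = EIf (ECall (Suc n) [EVar 0]) (ECall (Suc n + L0 + L1) [EVar 0])
    (ECall (Suc n + L0) [EVar 0])" for n
  define code where "code n = e n # c0 (Suc n) @ c1 (Suc n + L0) @ c2 (Suc n + L0 + L1)" for n
  define T where "T n = 5 + 2 * n + T0 n + T1 n + T2 n" for n
  show ?thesis
  proof (rule ptimeI[of T code])
    show "polyf T" unfolding T_def by (intro polyf_intros 0 1 2)
    show "length (code n) = Suc (L0 + L1 + L2)" for n by (simp add: code_def 0 1 2)
  next
    fix P n assume "linked P n (code n)"
    then show "n < length P" by (simp add: code_def linked_Cons)
  next
    fix P n x assume "linked P n (code n)" and x: "x \<in> D"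
    then have l: "n < length P" "P ! n = e n" "linked P (Suc n) (c0 (Suc n))"
      "linked P (Suc n + L0) (c1 (Suc n + L0))"
      "linked P (Suc n + L0 + L1) (c2 (Suc n + L0 + L1))"
      by (auto simp: code_def linked_Cons linked_append 0 1 2)
    from 0(4)[OF l(3) x] obtain t0 where t0: "t0 \<le> T0 (size x)"
      "evals P [x] (P ! Suc n) (c x) t0" by auto
    from 1(4)[OF l(4) x] obtain t1 where t1: "t1 \<le> T1 (size x)"
      "evals P [x] (P ! (Suc n + L0)) (a x) t1" by auto
    from 2(4)[OF l(5) x] obtain t2 where t2: "t2 \<le> T2 (size x)"
      "evals P [x] (P ! (Suc n + L0 + L1)) (b x) t2" by auto
    note e0 = evals_callx[OF 0(3)[OF l(3)] t0(2)]
    note e1 = evals_callx[OF 1(3)[OF l(4)] t1(2)]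
    note e2 = evals_callx[OF 2(3)[OF l(5)] t2(2)]
    show "\<exists>t\<le>T (size x). evals P [x] (P ! n) (if c x = Leaf then a x else b x) t"
    proof (cases "c x = Leaf")
      case True
      show ?thesis unfolding l(2)
        using evals_evals_list.IfFalse[OF e0[unfolded True] e1, of "ECall (Suc n + L0 + L1) [EVar 0]", folded e_def] True t0(1) t1(1)
        by (intro exI conjI) (auto simp: T_def)
    next
      case False
      show ?thesis unfolding l(2)
        using evals_evals_list.IfTrue[OF e0 False e2, of "ECall (Suc n + L0) [EVar 0]", folded e_def] False t0(1) t2(1)
        by (intro exI conjI) (auto simp: T_def)
    qed
  qed
qed

lemma ptime_hd_sexp: "ptime UNIV hd_sexp"
  unfolding ptime_def
proof (intro exI conjI)
  show "polyf (\<lambda>n. Suc (Suc n))" by (intro polyf_intros)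
  show "\<forall>n::nat. length ((\<lambda>n. [EHd (EVar 0)]) n) = 1" by simp
  show "\<forall>P n. linked P n [EHd (EVar 0)] \<longrightarrow> n < length P \<and>
     (\<forall>x\<in>UNIV. \<exists>t\<le>Suc (Suc (size x)). evals P [x] (P ! n) (hd_sexp x) t)"
    using evals_evals_list.Hd[OF evals_evals_list.Var[of 0 "[x]" for x]]
    by (auto simp: linked_Cons)
qed

lemma ptime_tl_sexp: "ptime UNIV tl_sexp"
  unfolding ptime_def
proof (intro exI conjI)
  show "polyf (\<lambda>n. Suc (Suc n))" by (intro polyf_intros)
  show "\<forall>n::nat. length ((\<lambda>n. [ETl (EVar 0)]) n) = 1" by simp
  show "\<forall>P n. linked P n [ETl (EVar 0)] \<longrightarrow> n < length P \<and>
     (\<forall>x\<in>UNIV. \<exists>t\<le>Suc (Suc (size x)). evals P [x] (P ! n) (tl_sexp x) t)"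
    using evals_evals_list.Tl[OF evals_evals_list.Var[of 0 "[x]" for x]]
    by (auto simp: linked_Cons)
qed

lemmas ptime_hd = ptime_comp[OF ptime_hd_sexp]
lemmas ptime_tl = ptime_comp[OF ptime_tl_sexp]

named_theorems ptime_intros
lemmas [ptime_intros] = ptime_id ptime_const ptime_Pair ptime_If ptime_hd ptime_tl

text \<open>Recursion along a list with a parameter \<open>c\<close> and a state \<open>s\<close> that is updated on the way
  down; it subsumes both left and right folds.\<close>

fun srec where
  "srec h g k c s Leaf = h c s"
| "srec h g k c s (Pair a r) = k c s a r (srec h g k c (g c s a r) r)"

text \<open>The bound is demanded at every call of the actual run: a bound on the initial state
  alone would not exclude that growth compounds.\<close>

fun srec_bounded :: "nat \<Rightarrow> (sexp \<Rightarrow> sexp \<Rightarrow> sexp) \<Rightarrow> (sexp \<Rightarrow> sexp \<Rightarrow> sexp \<Rightarrow> sexp \<Rightarrow> sexp) \<Rightarrow>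
    (sexp \<Rightarrow> sexp \<Rightarrow> sexp \<Rightarrow> sexp \<Rightarrow> sexp \<Rightarrow> sexp) \<Rightarrow> sexp \<Rightarrow> sexp \<Rightarrow> sexp \<Rightarrow> bool" where
  "srec_bounded B h g k c s Leaf \<longleftrightarrow> size s \<le> B \<and> size (srec h g k c s Leaf) \<le> B"
| "srec_bounded B h g k c s (Pair a r) \<longleftrightarrow> size s \<le> B \<and> size (srec h g k c s (Pair a r)) \<le> B \<and>
     srec_bounded B h g k c (g c s a r) r"

lemma srec_boundedD: "srec_bounded B h g k c s l \<Longrightarrow> size s \<le> B \<and> size (srec h g k c s l) \<le> B"
  by (cases l) auto

fun slen :: "sexp \<Rightarrow> nat" where
  "slen Leaf = 0" | "slen (Pair a r) = Suc (slen r)"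

lemma slen_le_size: "slen l \<le> size l"
  by (induction l) auto

text \<open>The block consists of the main function, the recursive function with arguments
  \<open>c\<close>, \<open>s\<close>, \<open>l\<close>, and the blocks of the six given functions.
  If \<open>B\<close> bounds all sizes along the run, a call costs at most \<open>U B\<close> apart
  from the recursive call inside it, and there are \<open>slen l + 1\<close> calls.\<close>

lemma ptime_srec_on:
  assumes h: "ptime UNIV (\<lambda>z. h (hd_sexp z) (tl_sexp z))"
    and g: "ptime UNIV (\<lambda>z. g (hd_sexp z) (hd_sexp (tl_sexp z)) (hd_sexp (tl_sexp (tl_sexp z)))
              (tl_sexp (tl_sexp (tl_sexp z))))"
    and k: "ptime UNIV (\<lambda>z. k (hd_sexp z) (hd_sexp (tl_sexp z)) (hd_sexp (tl_sexp (tl_sexp z)))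
              (hd_sexp (tl_sexp (tl_sexp (tl_sexp z)))) (tl_sexp (tl_sexp (tl_sexp (tl_sexp z)))))"
    and C: "ptime D C" and S: "ptime D S" and L: "ptime D L"
    and p: "polyf p" and bnd: "\<And>x. x \<in> D \<Longrightarrow> srec_bounded (p (size x)) h g k (C x) (S x) (L x)"
  shows "ptime D (\<lambda>x. srec h g k (C x) (S x) (L x))"
proof -
  let ?h = "\<lambda>z. h (hd_sexp z) (tl_sexp z)"
  let ?g = "\<lambda>z. g (hd_sexp z) (hd_sexp (tl_sexp z)) (hd_sexp (tl_sexp (tl_sexp z)))
              (tl_sexp (tl_sexp (tl_sexp z)))"
  let ?k = "\<lambda>z. k (hd_sexp z) (hd_sexp (tl_sexp z)) (hd_sexp (tl_sexp (tl_sexp z)))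
              (hd_sexp (tl_sexp (tl_sexp (tl_sexp z)))) (tl_sexp (tl_sexp (tl_sexp (tl_sexp z))))"
  from h obtain ch Lh Th where h: "polyf Th" "\<And>n. length (ch n) = Lh"
    "\<And>P n. linked P n (ch n) \<Longrightarrow> n < length P"
    "\<And>P n x. linked P n (ch n) \<Longrightarrow> \<exists>t\<le>Th (size x). evals P [x] (P ! n) (?h x) t"
    by (rule ptimeE) auto
  from g obtain cg Lg Tg where g: "polyf Tg" "\<And>n. length (cg n) = Lg"
    "\<And>P n. linked P n (cg n) \<Longrightarrow> n < length P"
    "\<And>P n x. linked P n (cg n) \<Longrightarrow> \<exists>t\<le>Tg (size x). evals P [x] (P ! n) (?g x) t"
    by (rule ptimeE) auto
  from k obtain ck Lk Tk where k: "polyf Tk" "\<And>n. length (ck n) = Lk"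
    "\<And>P n. linked P n (ck n) \<Longrightarrow> n < length P"
    "\<And>P n x. linked P n (ck n) \<Longrightarrow> \<exists>t\<le>Tk (size x). evals P [x] (P ! n) (?k x) t"
    by (rule ptimeE) auto
  from C obtain cC LC TC where C: "polyf TC" "\<And>n. length (cC n) = LC"
    "\<And>P n. linked P n (cC n) \<Longrightarrow> n < length P"
    "\<And>P n x. linked P n (cC n) \<Longrightarrow> x \<in> D \<Longrightarrow> \<exists>t\<le>TC (size x). evals P [x] (P ! n) (C x) t"
    "\<And>x. x \<in> D \<Longrightarrow> size (C x) \<le> TC (size x)"
    by (rule ptimeE) auto
  from S obtain cS LS TS where S: "polyf TS" "\<And>n. length (cS n) = LS"
    "\<And>P n. linked P n (cS n) \<Longrightarrow> n < length P"
    "\<And>P n x. linked P n (cS n) \<Longrightarrow> x \<in> D \<Longrightarrow> \<exists>t\<le>TS (size x). evals P [x] (P ! n) (S x) t"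
    by (rule ptimeE) auto
  from L obtain cL LL TL where L: "polyf TL" "\<And>n. length (cL n) = LL"
    "\<And>P n. linked P n (cL n) \<Longrightarrow> n < length P"
    "\<And>P n x. linked P n (cL n) \<Longrightarrow> x \<in> D \<Longrightarrow> \<exists>t\<le>TL (size x). evals P [x] (P ! n) (L x) t"
    "\<And>x. x \<in> D \<Longrightarrow> size (L x) \<le> TL (size x)"
    by (rule ptimeE) auto
  define aC where "aC n = Suc (Suc n)" for n
  define aS where "aS n = aC n + LC" for n
  define aL where "aL n = aS n + LS" for n
  define ah where "ah n = aL n + LL" for n
  define ag where "ag n = ah n + Lh" for n
  define ak where "ak n = ag n + Lg" for n
  define main where "main n = ECall (Suc n) [ECall (aC n) [EVar 0], ECall (aS n) [EVar 0], ECall (aL n) [EVar 0]]" for n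
  define eg where "eg n = ECall (ag n) [EPair (EVar 0) (EPair (EVar 1) (EPair (EHd (EVar 2)) (ETl (EVar 2))))]" for n
  define er where "er n = ECall (Suc n) [EVar 0, eg n, ETl (EVar 2)]" for n
  define ek where "ek n = ECall (ak n) [EPair (EVar 0) (EPair (EVar 1) (EPair (EHd (EVar 2)) (EPair (ETl (EVar 2)) (er n))))]" for n
  define eh where "eh n = ECall (ah n) [EPair (EVar 0) (EVar 1)]" for n
  define code where "code n = main n # EIf (EVar 2) (ek n) (eh n) # cC (aC n) @ cS (aS n) @ cL (aL n)
    @ ch (ah n) @ cg (ag n) @ ck (ak n)" for n
  \<comment> \<open>An argument tuple of \<open>g\<close> or \<open>k\<close> joins at most five
    components of size at most \<open>B\<close> by at most four pairs, hence 5 * B + 5.\<close>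
  define U where "U B = 40 + 20 * B + Th (5 * B + 5) + Tg (5 * B + 5) + Tk (5 * B + 5)" for B
  have rec: "\<exists>t\<le>Suc (slen l) * U B. evals P [c, s, l] (P ! Suc n) (srec h g k c s l) t"
    if ln: "linked P n (code n)" and b: "size c \<le> B" "size l \<le> B" "srec_bounded B h g k c s l"
    for P n c s l B
  proof -
    from ln have l1: "P ! Suc n = EIf (EVar 2) (ek n) (eh n)" "Suc n < length P"
      and lh: "linked P (ah n) (ch (ah n))" and lg: "linked P (ag n) (cg (ag n))"
      and lk: "linked P (ak n) (ck (ak n))"
      by (auto simp: code_def linked_Cons linked_append aC_def aS_def aL_def ah_def ag_def ak_def
          C S L h g k add.assoc)
    have V0: "evals P [c, s, l] (EVar 0) c (1 + size c)" for s l
      using evals_evals_list.Var[of 0 "[c, s, l]" P] by simp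
    have V1: "evals P [c, s, l] (EVar 1) s (1 + size s)" for s l
      using evals_evals_list.Var[of 1 "[c, s, l]" P] by simp
    have V2: "evals P [c, s, l] (EVar 2) l (1 + size l)" for s l
      using evals_evals_list.Var[of 2 "[c, s, l]" P] by simp
    show ?thesis using b
    proof (induction l arbitrary: s)
      case Leaf
      from h(4)[OF lh, of "Pair c s"] obtain th where th: "th \<le> Th (size (Pair c s))"
        "evals P [Pair c s] (P ! ah n) (h c s) th" by auto
      have 1: "evals P [c, s, Leaf] (EPair (EVar 0) (EVar 1)) (Pair c s) (1 + (1 + size c) + (1 + size s))"
        using evals_evals_list.PairE[OF V0 V1] .
      have 2: "evals P [c, s, Leaf] (EIf (EVar 2) (ek n) (eh n)) (h c s)
           (1 + (1 + 0) + Suc ((1 + (1 + size c) + (1 + size s)) + th))"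
        by (rule evals_evals_list.IfFalse)
          (use V2[where l=Leaf] evals_call1[OF h(3)[OF lh] 1 th(2)] in \<open>auto simp: eh_def\<close>)
      have "Th (size (Pair c s)) \<le> Th (5 * B + 5)"
        using Leaf by (intro polyf_mono[OF h(1)]) auto
      then show ?case unfolding l1 srec.simps using 2 th(1) Leaf
        by (intro exI[of _ "1 + (1 + 0) + Suc ((1 + (1 + size c) + (1 + size s)) + th)"] conjI)
          (auto simp: U_def)
    next
      case (Pair a r)
      let ?l = "Pair a r" and ?s = "g c s a r"
      let ?v = "srec h g k c ?s r"
      from Pair.prems have sz: "size c \<le> B" "size s \<le> B" "Suc (size a + size r) \<le> B"
         "size ?s \<le> B" "size ?v \<le> B"
        using srec_boundedD[of B h g k c ?s r] by auto
      from Pair.IH(2)[of ?s] Pair.prems sz obtain tr where tr: "tr \<le> Suc (slen r) * U B"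
        "evals P [c, ?s, r] (P ! Suc n) ?v tr" by auto
      from g(4)[OF lg, of "Pair c (Pair s (Pair a r))"] obtain tg where
        tg: "tg \<le> Tg (size (Pair c (Pair s (Pair a r))))"
        "evals P [Pair c (Pair s (Pair a r))] (P ! ag n) ?s tg" by auto
      from k(4)[OF lk, of "Pair c (Pair s (Pair a (Pair r ?v)))"] obtain tk where
        tk: "tk \<le> Tk (size (Pair c (Pair s (Pair a (Pair r ?v)))))"
        "evals P [Pair c (Pair s (Pair a (Pair r ?v)))] (P ! ak n) (k c s a r ?v) tk" by auto
      have v0: "evals P [c, s, ?l] (EVar 0) c (1 + size c)" by (rule V0)
      have v1: "evals P [c, s, ?l] (EVar 1) s (1 + size s)" by (rule V1)
      have v2: "evals P [c, s, ?l] (EVar 2) ?l (1 + size ?l)" by (rule V2)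
      have v3: "evals P [c, s, ?l] (EHd (EVar 2)) a (1 + (1 + size ?l))"
        using evals_evals_list.Hd[OF v2] by simp
      have v4: "evals P [c, s, ?l] (ETl (EVar 2)) r (1 + (1 + size ?l))"
        using evals_evals_list.Tl[OF v2] by simp
      note pg = evals_evals_list.PairE[OF v0 evals_evals_list.PairE[OF v1 evals_evals_list.PairE[OF v3 v4]]]
      note eg = evals_call1[OF g(3)[OF lg] pg tg(2), folded eg_def]
      note er = evals_evals_list.Call[OF l1(2) evals_evals_list.ConsE[OF v0
          evals_evals_list.ConsE[OF eg evals_evals_list.ConsE[OF v4 evals_evals_list.NilE]]] tr(2), folded er_def]
      note pk = evals_evals_list.PairE[OF v0 evals_evals_list.PairE[OF v1 evals_evals_list.PairE[OF v3
            evals_evals_list.PairE[OF v4 er]]]]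
      note ek = evals_call1[OF k(3)[OF lk] pk tk(2), folded ek_def]
      note all = evals_evals_list.IfTrue[OF v2 _ ek, of "eh n", folded l1(1)]
      have "Tg (size (Pair c (Pair s (Pair a r)))) \<le> Tg (5 * B + 5)"
        using sz by (intro polyf_mono[OF g(1)]) auto
      moreover have "Tk (size (Pair c (Pair s (Pair a (Pair r ?v))))) \<le> Tk (5 * B + 5)"
        using sz by (intro polyf_mono[OF k(1)]) auto
      ultimately show ?case unfolding srec.simps
        by (intro exI conjI, rule_tac[2] all) (use tr(1) tg(1) tk(1) sz in \<open>auto simp: U_def\<close>)
    qed
  qed
  define Bd where "Bd n = p n + TC n + TL n" for n
  define T where "T n = 10 + 5 * n + TC n + TS n + TL n + Suc (TL n) * U (Bd n)" for n
  have pB: "polyf Bd" unfolding Bd_def by (intro polyf_intros p C L)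
  show ?thesis
  proof (rule ptimeI[of T code])
    show "polyf T" unfolding T_def U_def
      by (intro polyf_intros C S L pB polyf_comp[OF h(1)] polyf_comp[OF g(1)] polyf_comp[OF k(1)])
    show "length (code n) = Suc (Suc (LC + LS + LL + Lh + Lg + Lk))" for n
      by (simp add: code_def C S L h g k)
  next
    fix P n assume ln: "linked P n (code n)"
    then show "n < length P" by (simp add: code_def linked_Cons)
  next
    fix P n x assume ln: "linked P n (code n)" and x: "x \<in> D"
    then have l0: "n < length P" "P ! n = main n" "Suc n < length P"
      and lC: "linked P (aC n) (cC (aC n))" and lS: "linked P (aS n) (cS (aS n))"
      and lL: "linked P (aL n) (cL (aL n))"
      by (auto simp: code_def linked_Cons linked_append aC_def aS_def aL_def ah_def ag_def ak_def
          C S L h g k add.assoc)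
    from C(4)[OF lC x] obtain tC where tC: "tC \<le> TC (size x)" "evals P [x] (P ! aC n) (C x) tC" by auto
    from S(4)[OF lS x] obtain tS where tS: "tS \<le> TS (size x)" "evals P [x] (P ! aS n) (S x) tS" by auto
    from L(4)[OF lL x] obtain tL where tL: "tL \<le> TL (size x)" "evals P [x] (P ! aL n) (L x) tL" by auto
    have mono: "srec_bounded B h g k c s l \<Longrightarrow> B \<le> B' \<Longrightarrow> srec_bounded B' h g k c s l" for B B' c s l
      by (induction l arbitrary: s) auto
    have "srec_bounded (Bd (size x)) h g k (C x) (S x) (L x)"
      by (rule mono[OF bnd[OF x]]) (simp add: Bd_def)
    moreover have "size (C x) \<le> Bd (size x)" "size (L x) \<le> Bd (size x)"
      using C(5)[OF x] L(5)[OF x] by (auto simp: Bd_def)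
    ultimately obtain t where t: "t \<le> Suc (slen (L x)) * U (Bd (size x))"
      "evals P [C x, S x, L x] (P ! Suc n) (srec h g k (C x) (S x) (L x)) t"
      using rec[OF ln] by blast
    have "Suc (slen (L x)) * U (Bd (size x)) \<le> Suc (TL (size x)) * U (Bd (size x))"
      using slen_le_size[of "L x"] L(5)[OF x] by (intro mult_right_mono) auto
    with t(1) have "t \<le> Suc (TL (size x)) * U (Bd (size x))" by (rule le_trans)
    moreover note evals_evals_list.Call[OF l0(3) evals_evals_list.ConsE[OF evals_callx[OF C(3)[OF lC] tC(2)]
        evals_evals_list.ConsE[OF evals_callx[OF S(3)[OF lS] tS(2)] evals_evals_list.ConsE[OF
        evals_callx[OF L(3)[OF lL] tL(2)] evals_evals_list.NilE]]] t(2), folded main_def, folded l0(2)]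
    ultimately show "\<exists>t\<le>T (size x). evals P [x] (P ! n) (srec h g k (C x) (S x) (L x)) t"
      using tC(1) tS(1) tL(1) by (intro exI conjI) (auto simp: T_def simp del: mult_Suc)
  qed
qed

text \<open>The size of states and of results may be measured by any functions that are polynomially
  related to it, since it need not itself grow additively.\<close>

lemma ptime_srec_measure:
  assumes h: "ptime UNIV (\<lambda>z. h (hd_sexp z) (tl_sexp z))"
    and g: "ptime UNIV (\<lambda>z. g (hd_sexp z) (hd_sexp (tl_sexp z)) (hd_sexp (tl_sexp (tl_sexp z)))
              (tl_sexp (tl_sexp (tl_sexp z))))"
    and k: "ptime UNIV (\<lambda>z. k (hd_sexp z) (hd_sexp (tl_sexp z)) (hd_sexp (tl_sexp (tl_sexp z)))
              (hd_sexp (tl_sexp (tl_sexp (tl_sexp z)))) (tl_sexp (tl_sexp (tl_sexp (tl_sexp z)))))"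
    and C: "ptime D C" and S: "ptime D S" and L: "ptime D L"
    and \<mu>: "polyf p\<mu>" "\<And>s. size s \<le> \<mu> s" "\<And>s. \<mu> s \<le> p\<mu> (size s)"
    and \<nu>: "polyf p\<nu>" "\<And>v. size v \<le> \<nu> v" "\<And>v. \<nu> v \<le> p\<nu> (size v)"
    and pg: "polyf pg" "\<And>c s a r. \<mu> (g c s a r) \<le> \<mu> s + pg (size c + size a + size r)"
    and pk: "polyf pk" "\<And>c s a r v. \<nu> (k c s a r v) \<le> \<nu> v + pk (size c + size s + size a + size r)"
  shows "ptime D (\<lambda>x. srec h g k (C x) (S x) (L x))"
proof -
  from h obtain ph' where ph': "polyf ph'" "\<And>z. size (h (hd_sexp z) (tl_sexp z)) \<le> ph' (size z)"
    by (rule ptime_size) auto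
  define ph where "ph n = p\<nu> (ph' n)" for n
  have ph: "polyf ph" unfolding ph_def by (rule polyf_comp[OF \<nu>(1) ph'(1)])
  have "size (h c s) \<le> ph' (Suc (size c + size s))" for c s
    using ph'(2)[of "Pair c s"] by simp
  then have "\<nu> (h c s) \<le> ph (Suc (size c + size s))" for c s
    unfolding ph_def using \<nu>(3)[of "h c s"] polyf_mono[OF \<nu>(1)] le_trans by blast
  then have ph': "\<nu> (h c s) \<le> ph (Suc (N + M))" if "size c \<le> N" "size s \<le> M" for c s N M
    using that polyf_mono[OF ph, of "Suc (size c + size s)" "Suc (N + M)"] le_trans by fastforce
  from C obtain TC where C': "polyf TC" "\<And>x. x \<in> D \<Longrightarrow> size (C x) \<le> TC (size x)" by (rule ptimeE) auto
  from S obtain TS' where S': "polyf TS'" "\<And>x. x \<in> D \<Longrightarrow> size (S x) \<le> TS' (size x)" by (rule ptimeE) auto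
  from L obtain TL where L': "polyf TL" "\<And>x. x \<in> D \<Longrightarrow> size (L x) \<le> TL (size x)" by (rule ptimeE) auto
  define TS where "TS n = p\<mu> (TS' n)" for n
  have pTS: "polyf TS" unfolding TS_def by (rule polyf_comp[OF \<mu>(1) S'(1)])
  have TS: "\<mu> (S x) \<le> TS (size x)" if "x \<in> D" for x
    unfolding TS_def using \<mu>(3)[of "S x"] polyf_mono[OF \<mu>(1) S'(2)[OF that]] by (rule le_trans)
  define N where "N n = TC n + TL n" for n
  \<comment> \<open>Bounds all states: the initial measure and one increment per list element. The
    increment does not involve the state, so it does not compound.\<close>
  define M where "M n = TS n + N n * pg (N n)" for n
  define p where "p n = M n + (ph (Suc (N n + M n)) + N n * pk (N n + M n))" for n
  have pN: "polyf N" unfolding N_def by (intro polyf_intros C' L')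
  have pM: "polyf M" unfolding M_def by (intro polyf_intros pTS pN polyf_comp[OF pg(1)])
  have pp: "polyf p" unfolding p_def
    by (intro polyf_intros pN pM polyf_comp[OF ph] polyf_comp[OF pk(1)])
  have main: "\<nu> (srec h g k c s l) \<le> ph (Suc (N + M)) + slen l * pk (N + M) \<and>
      srec_bounded (M + (ph (Suc (N + M)) + N * pk (N + M))) h g k c s l"
    if "size c + size l \<le> N" "slen l \<le> N" "\<mu> s + slen l * pg N \<le> M" for c s l N M
    using that
  proof (induction l arbitrary: s)
    case Leaf
    have 1: "\<nu> (h c s) \<le> ph (Suc (N + M))" using Leaf \<mu>(2)[of s] by (intro ph') auto
    with \<nu>(2)[of "h c s"] have "size (h c s) \<le> ph (Suc (N + M))" by linarith
    with 1 show ?case using Leaf \<mu>(2)[of s] by auto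
  next
    case (Pair a r)
    have s: "size s \<le> M" using \<mu>(2)[of s] Pair.prems(3) by linarith
    have "pg (size c + size a + size r) \<le> pg N" using Pair.prems by (intro polyf_mono[OF pg(1)]) auto
    then have 1: "\<mu> (g c s a r) \<le> \<mu> s + pg N" using pg(2)[of c s a r] by linarith
    have "pk (size c + size s + size a + size r) \<le> pk (N + M)"
      using Pair.prems s by (intro polyf_mono[OF pk(1)]) auto
    then have 2: "\<nu> (k c s a r v) \<le> \<nu> v + pk (N + M)" for v using pk(2)[of c s a r v] by linarith
    have IH: "\<nu> (srec h g k c (g c s a r) r) \<le> ph (Suc (N + M)) + slen r * pk (N + M)"
       "srec_bounded (M + (ph (Suc (N + M)) + N * pk (N + M))) h g k c (g c s a r) r"
      using Pair.IH(2)[of "g c s a r"] Pair.prems 1 by auto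
    have 3: "\<nu> (srec h g k c s (Pair a r)) \<le> ph (Suc (N + M)) + slen (Pair a r) * pk (N + M)"
      using IH(1) 2[of "srec h g k c (g c s a r) r"] by auto
    have "slen (Pair a r) * pk (N + M) \<le> N * pk (N + M)"
      using Pair.prems(2) by (rule mult_right_mono) simp
    with 3 \<nu>(2)[of "srec h g k c s (Pair a r)"]
    have "size (srec h g k c s (Pair a r)) \<le> M + (ph (Suc (N + M)) + N * pk (N + M))" by linarith
    then show ?case using 3 IH(2) s unfolding srec_bounded.simps by linarith
  qed
  show ?thesis
  proof (rule ptime_srec_on[OF h g k C S L pp])
    fix x assume x: "x \<in> D"
    have "size (C x) + size (L x) \<le> N (size x)" using C'(2)[OF x] L'(2)[OF x] by (simp add: N_def)
    moreover have "slen (L x) \<le> N (size x)" using slen_le_size[of "L x"] L'(2)[OF x] by (simp add: N_def)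
    moreover from this have "slen (L x) * pg (N (size x)) \<le> N (size x) * pg (N (size x))"
      by (rule mult_right_mono) simp
    then have "\<mu> (S x) + slen (L x) * pg (N (size x)) \<le> M (size x)"
      using TS[OF x] unfolding M_def by (rule add_mono[rotated])
    ultimately show "srec_bounded (p (size x)) h g k (C x) (S x) (L x)"
      unfolding p_def using main by blast
  qed
qed

lemmas ptime_srec = ptime_srec_measure[where \<mu>=size and \<nu>=size,
    OF _ _ _ _ _ _ polyf_id order_refl order_refl polyf_id order_refl order_refl]

section \<open>The program\<close>

abbreviation sT :: sexp where "sT \<equiv> Pair Leaf Leaf"

lemma size_hd_le: "size (hd_sexp s) \<le> size s" by (cases s) auto
lemma size_tl_le: "size (tl_sexp s) \<le> size s" by (cases s) auto
lemma size_hd_tl_le: "size (hd_sexp s) + size (tl_sexp s) \<le> size s" by (cases s) auto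

text \<open>In a tree that encodes no number, a digit may be any tree. Replacing it by a standard
  bit bounds the size by the number of digits.\<close>

definition snorm where
  "snorm b = srec (\<lambda>c s. Leaf) (\<lambda>c s a r. s) (\<lambda>c s a r v. Pair (if a = Leaf then Leaf else sT) v) Leaf Leaf b"

lemma ptime_snorm [ptime_intros]:
  assumes "ptime D a" shows "ptime D (\<lambda>x. snorm (a x))"
  unfolding snorm_def
  by (rule ptime_srec[where pg = "\<lambda>n. 0" and pk = "\<lambda>n. 2"])
    (intro ptime_intros assms polyf_intros | simp)+

lemma snorm_simps [simp]: "snorm Leaf = Leaf"
  "snorm (Pair a r) = Pair (if a = Leaf then Leaf else sT) (snorm r)"
  by (simp_all add: snorm_def)

lemma size_snorm: "size (snorm b) \<le> size b" "slen (snorm b) = slen b" "size (snorm b) \<le> 2 * slen b"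
proof -
  show "size (snorm b) \<le> size b"
  proof (induction b)
    case (Pair a b) then show ?case by (cases a) auto
  qed auto
qed (induction b; auto)+

text \<open>Suppresses leading zeros, so that numerals stay canonical. The conditionals are nested
  because the only available test is a comparison with \<open>Leaf\<close>.\<close>

definition scons where
  "scons b r = (if r = Leaf then (if b = Leaf then Leaf else Pair b r) else Pair b r)"

lemma ptime_scons [ptime_intros]:
  assumes "ptime D a" "ptime D b" shows "ptime D (\<lambda>x. scons (a x) (b x))"
  unfolding scons_def by (intro ptime_intros assms)

lemma size_scons: "size (scons b r) \<le> Suc (size b + size r)" "slen (scons b r) \<le> Suc (slen r)"
  by (auto simp: scons_def)

abbreviation "sdbl \<equiv> scons Leaf"

definition sxor where
  "sxor a b = (if a = Leaf then (if b = Leaf then Leaf else sT) else (if b = Leaf then sT else Leaf))"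

text \<open>The carry of a full adder.\<close>

definition smaj where
  "smaj a b c = (if a = Leaf then (if b = Leaf then Leaf else c) else (if b = Leaf then c else sT))"

text \<open>The borrow caused by the digit subtraction a - b - c.\<close>

definition sbor where
  "sbor a b c = (if a = Leaf then (if b = Leaf then c else sT) else (if b = Leaf then Leaf else c))"

lemma ptime_bits [ptime_intros]:
  assumes "ptime D a" "ptime D b"
  shows "ptime D (\<lambda>x. sxor (a x) (b x))"
    and "ptime D c \<Longrightarrow> ptime D (\<lambda>x. smaj (a x) (b x) (c x))"
    and "ptime D c \<Longrightarrow> ptime D (\<lambda>x. sbor (a x) (b x) (c x))"
  unfolding sxor_def smaj_def sbor_def by (intro ptime_intros assms | assumption)+

lemma size_bits: "size (sxor a b) \<le> 1" "size (smaj a b c) \<le> Suc (size c)" "size (sbor a b c) \<le> Suc (size c)"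
  by (auto simp: sxor_def smaj_def sbor_def)

definition sinc where
  "sinc b = srec (\<lambda>c s. Pair sT Leaf) (\<lambda>c s a r. s)
     (\<lambda>c s a r v. if a = Leaf then Pair sT r else Pair Leaf v) Leaf Leaf b"

lemma ptime_sinc [ptime_intros]:
  assumes "ptime D a" shows "ptime D (\<lambda>x. sinc (a x))"
  unfolding sinc_def
  by (rule ptime_srec[where pg = "\<lambda>n. 0" and pk = "\<lambda>n. n + 3"])
    (intro ptime_intros assms polyf_intros | simp)+

lemma sinc_simps [simp]: "sinc Leaf = Pair sT Leaf"
  "sinc (Pair a r) = (if a = Leaf then Pair sT r else Pair Leaf (sinc r))"
  by (simp_all add: sinc_def)

lemma size_sinc: "size (sinc b) \<le> size b + 2" "slen (sinc b) \<le> Suc (slen b)"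
proof -
  show "size (sinc b) \<le> size b + 2"
  proof (induction b)
    case (Pair a b) then show ?case by (cases a) auto
  qed auto
qed (induction b; auto)

text \<open>The state pairs the carry with the digits of the second summand that are still to come.
  Once the first summand is exhausted, the carry runs through these digits.\<close>

definition sadd_aux where
  "sadd_aux = srec (\<lambda>c s. snorm (if hd_sexp s = Leaf then tl_sexp s else sinc (tl_sexp s)))
     (\<lambda>c s a r. Pair (smaj a (hd_sexp (tl_sexp s)) (hd_sexp s)) (tl_sexp (tl_sexp s)))
     (\<lambda>c s a r v. Pair (sxor (sxor a (hd_sexp (tl_sexp s))) (hd_sexp s)) v) Leaf"

definition sadd where "sadd a b = sadd_aux (Pair Leaf b) a"

lemma ptime_sadd [ptime_intros]:
  assumes "ptime D a" "ptime D b" shows "ptime D (\<lambda>x. sadd (a x) (b x))"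
proof -
  have 1: "size (smaj a (hd_sexp (tl_sexp s)) (hd_sexp s)) + size (tl_sexp (tl_sexp s)) \<le> size s + 1" for a s
    using size_bits(2)[of a "hd_sexp (tl_sexp s)" "hd_sexp s"] size_hd_tl_le[of s] size_tl_le[of "tl_sexp s"]
    by linarith
  show ?thesis unfolding sadd_def sadd_aux_def
  proof (rule ptime_srec[where pg = "\<lambda>n. 2" and pk = "\<lambda>n. 2"], goal_cases)
    case (8 c s a r) then show ?case using 1[of a s] by simp
  next
    case (10 c s a r v)
    then show ?case using size_bits(1)[of "sxor a (hd_sexp (tl_sexp s))" "hd_sexp s"] by simp
  qed (intro ptime_intros assms polyf_intros)+
qed

text \<open>In the first estimate \<open>b\<close> has coefficient 1, as it is the accumulator in
  \<open>smul\<close> and \<open>smass\<close>; the other two count digits for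
  \<open>bsize_smul\<close>.\<close>

lemma size_sadd: "size (sadd a b) \<le> size b + 2 * size a + 2" "slen (sadd a b) \<le> Suc (max (slen a) (slen b))"
  "size (sadd a b) \<le> 2 * slen (sadd a b)"
proof -
  have 1: "size (snorm (sinc b)) \<le> size b + 2" "size (snorm b) \<le> size b + 2" for b
    using size_snorm(1)[of "sinc b"] size_sinc(1)[of b] size_snorm(1)[of b] by auto
  have "size (sadd_aux s a) \<le> size (tl_sexp s) + 2 * size a + 2" for s
  proof (induction a arbitrary: s)
    case Leaf show ?case using 1 by (auto simp: sadd_aux_def)
  next
    case (Pair a r)
    let ?s = "Pair (smaj a (hd_sexp (tl_sexp s)) (hd_sexp s)) (tl_sexp (tl_sexp s))"
    show ?case
      using Pair(2)[of ?s] size_bits(1)[of "sxor a (hd_sexp (tl_sexp s))" "hd_sexp s"] size_tl_le[of "tl_sexp s"]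
      by (auto simp: sadd_aux_def)
  qed
  from this[of "Pair Leaf b"] show "size (sadd a b) \<le> size b + 2 * size a + 2" by (simp add: sadd_def)
  have "slen (sadd_aux s a) \<le> Suc (max (slen a) (slen (tl_sexp s)))" for s
  proof (induction a arbitrary: s)
    case Leaf
    show ?case using size_sinc(2)[of "tl_sexp s"] by (auto simp: sadd_aux_def size_snorm)
  next
    case (Pair a r)
    let ?s = "Pair (smaj a (hd_sexp (tl_sexp s)) (hd_sexp s)) (tl_sexp (tl_sexp s))"
    show ?case
      using Pair(2)[of ?s]
      by (cases "tl_sexp s") (auto simp: sadd_aux_def)
  qed
  from this[of "Pair Leaf b"] show "slen (sadd a b) \<le> Suc (max (slen a) (slen b))" by (simp add: sadd_def)
  have "size (sadd_aux s a) \<le> 2 * slen (sadd_aux s a)" for s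
  proof (induction a arbitrary: s)
    case Leaf
    show ?case using size_snorm(2,3) by (simp add: sadd_aux_def)
  next
    case (Pair a r)
    let ?s = "Pair (smaj a (hd_sexp (tl_sexp s)) (hd_sexp s)) (tl_sexp (tl_sexp s))"
    show ?case
      using Pair(2)[of ?s] size_bits(1)[of "sxor a (hd_sexp (tl_sexp s))" "hd_sexp s"]
      by (auto simp: sadd_aux_def)
  qed
  then show "size (sadd a b) \<le> 2 * slen (sadd a b)" by (simp add: sadd_def)
qed

text \<open>The state pairs the borrow with the remaining digits of the subtrahend. In the base case
  \<open>sT\<close> is not a truth value but \<open>Pair d Leaf\<close> for the difference d = 0;
  \<open>scons\<close> removes leading zeros caused by cancellation.\<close>

definition ssub_aux where
  "ssub_aux = srec (\<lambda>c s. if hd_sexp s = Leaf then if tl_sexp s = Leaf then sT else Leaf else Leaf)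
     (\<lambda>c s a r. Pair (sbor a (hd_sexp (tl_sexp s)) (hd_sexp s)) (tl_sexp (tl_sexp s)))
     (\<lambda>c s a r v. if v = Leaf then Leaf
        else Pair (scons (sxor (sxor a (hd_sexp (tl_sexp s))) (hd_sexp s)) (hd_sexp v)) Leaf) Leaf"

text \<open>Subtraction of natural numbers as a partial function: \<open>Leaf\<close> stands for a negative result
  and \<open>Pair d Leaf\<close> for the result \<open>d\<close>.\<close>

definition ssub where "ssub a b = ssub_aux (Pair Leaf b) a"

lemma ptime_ssub [ptime_intros]:
  assumes "ptime D a" "ptime D b" shows "ptime D (\<lambda>x. ssub (a x) (b x))"
proof -
  have 1: "size (sbor a (hd_sexp (tl_sexp s)) (hd_sexp s)) + size (tl_sexp (tl_sexp s)) \<le> size s + 1" for a s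
    using size_bits(3)[of a "hd_sexp (tl_sexp s)" "hd_sexp s"] size_hd_tl_le[of s] size_tl_le[of "tl_sexp s"]
    by linarith
  have 2: "size (scons (sxor a b) (hd_sexp v)) \<le> size v + 2" for a b v
    using size_bits(1)[of a b] size_scons(1)[of "sxor a b" "hd_sexp v"] size_hd_le[of v] by linarith
  show ?thesis unfolding ssub_def ssub_aux_def
  proof (rule ptime_srec[where pg = "\<lambda>n. 2" and pk = "\<lambda>n. 3"], goal_cases)
    case (8 c s a r) then show ?case using 1[of a s] by simp
  next
    case (10 c s a r v)
    then show ?case using 2[of "sxor a (hd_sexp (tl_sexp s))" "hd_sexp s" v] by simp
  qed (intro ptime_intros assms polyf_intros)+
qed

lemma size_ssub: "slen (hd_sexp (ssub a b)) \<le> slen a" "size (hd_sexp (ssub a b)) \<le> 2 * slen (hd_sexp (ssub a b))"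
proof -
  have "slen (hd_sexp (ssub_aux s a)) \<le> slen a \<and> size (hd_sexp (ssub_aux s a)) \<le> 2 * slen (hd_sexp (ssub_aux s a))" for s
  proof (induction a arbitrary: s)
    case (Pair a r)
    let ?s = "Pair (sbor a (hd_sexp (tl_sexp s)) (hd_sexp s)) (tl_sexp (tl_sexp s))"
    show ?case
      using Pair(2)[of ?s] size_bits(1)[of "sxor a (hd_sexp (tl_sexp s))" "hd_sexp s"]
      by (auto simp: ssub_aux_def scons_def)
  qed (auto simp: ssub_aux_def)
  then show "slen (hd_sexp (ssub a b)) \<le> slen a" "size (hd_sexp (ssub a b)) \<le> 2 * slen (hd_sexp (ssub a b))"
    by (auto simp: ssub_def)
qed

text \<open>Testing the difference against \<open>Leaf\<close> is correct because
  \<open>ssub\<close> leaves no leading zeros.\<close>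

definition seq where
  "seq a b = (if ssub a b = Leaf then Leaf else if hd_sexp (ssub a b) = Leaf then sT else Leaf)"

lemma ptime_seq [ptime_intros]:
  assumes "ptime D a" "ptime D b" shows "ptime D (\<lambda>x. seq (a x) (b x))"
  unfolding seq_def by (intro ptime_intros assms)

text \<open>Horner's rule; the most significant digit comes first because the work is done on the
  way back.\<close>

definition smul where
  "smul a b = srec (\<lambda>c s. Leaf) (\<lambda>c s a r. s)
     (\<lambda>c s a r v. if a = Leaf then sdbl v else sadd c (sdbl v)) b Leaf a"

lemma ptime_smul [ptime_intros]:
  assumes "ptime D a" "ptime D b" shows "ptime D (\<lambda>x. smul (a x) (b x))"
proof -
  show ?thesis unfolding smul_def
  proof (rule ptime_srec[where pg = "\<lambda>n. 0" and pk = "\<lambda>n. 2 * n + 3"], goal_cases)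
    case (10 c s a r v)
    show ?case using size_sadd(1)[of c "sdbl v"] size_scons(1)[of Leaf v] by auto
  qed (intro ptime_intros assms polyf_intros | simp)+
qed

text \<open>A product may have more nonzero digits than its factors, so \<open>size\<close> does not
  grow additively: multiplying by 3 can turn many zeros into ones. Counting every digit as if it
  were nonzero repairs this.\<close>

definition bsize where "bsize v = max (size v) (2 * slen v)"

lemma bsize: "size v \<le> bsize v" "bsize v \<le> 2 * size v"
  using slen_le_size[of v] by (auto simp: bsize_def)

text \<open>Each digit of \<open>a\<close> lengthens the product by at most two digits. Growth is
  thus additive in the second factor, which holds the accumulated product when a whole list is
  multiplied.\<close>

lemma bsize_smul: "bsize (smul a b) \<le> bsize b + (4 * size a + 2)"
proof -
  have s: "smul Leaf b = Leaf" "smul (Pair x r) b = (if x = Leaf then sdbl (smul r b) else sadd b (sdbl (smul r b)))"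
    for x r by (simp_all add: smul_def)
  have "slen (smul a b) \<le> slen b + (2 * slen a + 1)"
  proof (induction a)
    case (Pair x r)
    show ?case
      using Pair(2) size_scons(2)[of Leaf "smul r b"] size_sadd(2)[of b "sdbl (smul r b)"] unfolding s
      by (auto split: if_splits)
  qed (simp add: s)
  moreover have "size (smul a b) \<le> 2 * slen (smul a b)"
  proof (induction a)
    case (Pair x r)
    show ?case
      using Pair(2) size_sadd(3)[of b "sdbl (smul r b)"] unfolding s
      by (auto simp: scons_def)
  qed (simp add: s)
  ultimately show ?thesis using slen_le_size[of a] by (auto simp: bsize_def)
qed

text \<open>An edge is \<open>Pair (Pair u v) (Pair num den)\<close>. Its weight is multiplied by the product of the
  denominators of all edges.\<close>

definition sscaled where
  "sscaled e es = srec (\<lambda>c s. Pair sT Leaf) (\<lambda>c s a r. s)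
     (\<lambda>c s a r v. smul (if seq (hd_sexp (hd_sexp c)) (hd_sexp (hd_sexp a)) = Leaf then tl_sexp (tl_sexp a)
        else if seq (tl_sexp (hd_sexp c)) (tl_sexp (hd_sexp a)) = Leaf then tl_sexp (tl_sexp a)
        else hd_sexp (tl_sexp a)) v) e Leaf es"

lemma ptime_sscaled [ptime_intros]:
  assumes "ptime D a" "ptime D b" shows "ptime D (\<lambda>x. sscaled (a x) (b x))"
proof -
  show ?thesis unfolding sscaled_def
  proof (rule ptime_srec_measure[where pg = "\<lambda>n. 0" and pk = "\<lambda>n. 4 * n + 2" and \<mu>=size and p\<mu> = "\<lambda>n. n"
        and \<nu>=bsize and p\<nu> = "\<lambda>n. 2 * n"], goal_cases)
    case (16 c s a r v)
    have "size (tl_sexp (tl_sexp a)) \<le> size a" "size (hd_sexp (tl_sexp a)) \<le> size a"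
      using size_tl_le[of a] size_tl_le[of "tl_sexp a"] size_hd_le[of "tl_sexp a"] by auto
    then show ?case
      using bsize_smul[of "tl_sexp (tl_sexp a)" v] bsize_smul[of "hd_sexp (tl_sexp a)" v] by auto
  qed (intro ptime_intros assms polyf_intros bsize order_refl | simp)+
qed

definition sscale_all where
  "sscale_all es = srec (\<lambda>c s. Leaf) (\<lambda>c s a r. s)
     (\<lambda>c s a r v. Pair (Pair (hd_sexp a) (sscaled a c)) v) es Leaf es"

lemma ptime_sscale_all [ptime_intros]:
  assumes "ptime D a" shows "ptime D (\<lambda>x. sscale_all (a x))"
proof -
  have "ptime UNIV (\<lambda>z. sscaled (hd_sexp z) (tl_sexp z))" by (intro ptime_intros)
  then obtain p where p: "polyf p" "\<And>z. size (sscaled (hd_sexp z) (tl_sexp z)) \<le> p (size z)" by (rule ptime_size) auto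
  show ?thesis unfolding sscale_all_def
  proof (rule ptime_srec[where pg = "\<lambda>n. 0" and pk = "\<lambda>n. n + p (Suc n) + 2"], goal_cases)
    case (10 c s a r v)
    have "p (size (Pair a c)) \<le> p (Suc (size c + size s + size a + size r))"
      by (rule polyf_mono[OF p(1)]) simp
    then show ?case using p(2)[of "Pair a c"] size_hd_le[of a] by auto
  qed (intro ptime_intros assms polyf_intros polyf_comp[OF p(1)] | simp)+
qed

section \<open>Building the rooted tree\<close>

definition smem where
  "smem v l = srec (\<lambda>c s. Leaf) (\<lambda>c s a r. s) (\<lambda>c s a r w. if seq c a = Leaf then w else sT) v Leaf l"

lemma ptime_smem [ptime_intros]:
  assumes "ptime D a" "ptime D b" shows "ptime D (\<lambda>x. smem (a x) (b x))"
  unfolding smem_def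
  by (rule ptime_srec[where pg = "\<lambda>n. 0" and pk = "\<lambda>n. 1"])
    (intro ptime_intros assms polyf_intros | simp)+

definition splaced where
  "splaced v E = srec (\<lambda>c s. Leaf) (\<lambda>c s a r. s)
     (\<lambda>c s a r w. if seq c (hd_sexp (tl_sexp a)) = Leaf then w else sT) v Leaf E"

lemma ptime_splaced [ptime_intros]:
  assumes "ptime D a" "ptime D b" shows "ptime D (\<lambda>x. splaced (a x) (b x))"
  unfolding splaced_def
  by (rule ptime_srec[where pg = "\<lambda>n. 0" and pk = "\<lambda>n. 1"])
    (intro ptime_intros assms polyf_intros | simp)+

text \<open>The tree found so far is a list of opening and closing brackets \<open>Pair tag (Pair v w)\<close>. A new leaf
  is inserted right behind the opening bracket of its parent.\<close>

definition sinsert where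
  "sinsert u vw E = (if u = Leaf then Pair (Pair sT vw) (Pair (Pair Leaf vw) E)
     else srec (\<lambda>c s. Leaf) (\<lambda>c s a r. s)
     (\<lambda>c s a r w. if hd_sexp a = Leaf then Pair a w else if seq (hd_sexp c) (hd_sexp (tl_sexp a)) = Leaf then Pair a w
        else Pair a (Pair (Pair sT (tl_sexp c)) (Pair (Pair Leaf (tl_sexp c)) r))) (Pair u vw) Leaf E)"

lemma ptime_sinsert [ptime_intros]:
  assumes "ptime D a" "ptime D b" "ptime D c" shows "ptime D (\<lambda>x. sinsert (a x) (b x) (c x))"
proof -
  show ?thesis unfolding sinsert_def
  proof (intro ptime_If assms, goal_cases)
    case 2
    show ?case
    proof (rule ptime_srec[where pg = "\<lambda>n. 0" and pk = "\<lambda>n. 2 * n + 7"], goal_cases)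
      case (10 c s a r v) show ?case using size_tl_le[of c] by auto
    qed (intro ptime_intros assms polyf_intros | simp)+
  qed (intro ptime_intros assms)+
qed

lemma size_sinsert: "size (sinsert u vw E) \<le> size E + 2 * size vw + 6"
proof -
  have "size (srec (\<lambda>c s. Leaf) (\<lambda>c s a r. s)
     (\<lambda>c s a r w. if hd_sexp a = Leaf then Pair a w else if seq (hd_sexp c) (hd_sexp (tl_sexp a)) = Leaf then Pair a w
        else Pair a (Pair (Pair sT (tl_sexp c)) (Pair (Pair Leaf (tl_sexp c)) r))) (Pair u vw) Leaf E)
     \<le> size E + 2 * size vw + 6"
    by (induction E) auto
  then show ?thesis by (auto simp: sinsert_def)
qed

text \<open>\<open>Leaf\<close> is the number of the depot, which is never inserted. If
  \<open>u\<close> is another vertex that is not placed yet, \<open>sinsert\<close> finds no bracket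
  and changes nothing.\<close>

definition sattach where
  "sattach u v w E = (if v = Leaf then E else if splaced v E = Leaf then sinsert u (Pair v w) E else E)"

text \<open>The endpoint closer to the depot is unknown, so both orientations are tried.\<close>

definition sedge where
  "sedge e E = sattach (tl_sexp (hd_sexp e)) (hd_sexp (hd_sexp e)) (tl_sexp e)
     (sattach (hd_sexp (hd_sexp e)) (tl_sexp (hd_sexp e)) (tl_sexp e) E)"

lemma ptime_sedge [ptime_intros]:
  assumes "ptime D a" "ptime D b" shows "ptime D (\<lambda>x. sedge (a x) (b x))"
  unfolding sedge_def sattach_def by (intro ptime_intros assms)

lemma size_sedge: "size (sedge e E) \<le> size E + (4 * size e + 16)"
proof -
  have 1: "size (sattach u v w E) \<le> size E + (2 * (size v + size w) + 8)" for u v w E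
    using size_sinsert[of u "Pair v w" E] by (auto simp: sattach_def)
  have "size (hd_sexp (hd_sexp e)) + size (tl_sexp (hd_sexp e)) + size (tl_sexp e) \<le> size e"
    using size_hd_tl_le[of e] size_hd_tl_le[of "hd_sexp e"] by linarith
  then show ?thesis
    using 1[of "hd_sexp (hd_sexp e)" "tl_sexp (hd_sexp e)" "tl_sexp e" E]
      1[of "tl_sexp (hd_sexp e)" "hd_sexp (hd_sexp e)" "tl_sexp e" "sattach (hd_sexp (hd_sexp e)) (tl_sexp (hd_sexp e)) (tl_sexp e) E"]
    unfolding sedge_def using size_tl_le[of e] by (simp add: algebra_simps)
qed

definition spass where
  "spass es E = srec (\<lambda>c s. s) (\<lambda>c s a r. s) (\<lambda>c s a r v. sedge a v) Leaf E es"

lemma ptime_spass [ptime_intros]: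
  assumes "ptime D a" "ptime D b" shows "ptime D (\<lambda>x. spass (a x) (b x))"
  unfolding spass_def
proof (rule ptime_srec[where pg = "\<lambda>n. 0" and pk = "\<lambda>n. 4 * n + 16"], goal_cases)
  case (10 c s a r v) show ?case using size_sedge[of a v] by simp
qed (intro ptime_intros assms polyf_intros | simp)+

text \<open>The increment does not involve \<open>E\<close>, so passes may be iterated.\<close>

lemma size_spass: "size (spass es E) \<le> size E + 16 * size es"
proof (induction es)
  case Leaf then show ?case by (simp add: spass_def)
next
  case (Pair e es)
  have "spass (Pair e es) E = sedge e (spass es E)" by (simp add: spass_def)
  then show ?case using Pair size_sedge[of e "spass es E"] by simp
qed

text \<open>The list of turnover times serves as a counter: one pass over the edges per client. In a
  connected graph each pass places a vertex while one is missing.\<close>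

definition sbuild where
  "sbuild es taus = srec (\<lambda>c s. Leaf) (\<lambda>c s a r. s) (\<lambda>c s a r v. spass c v) es Leaf taus"

lemma ptime_sbuild [ptime_intros]:
  assumes "ptime D a" "ptime D b" shows "ptime D (\<lambda>x. sbuild (a x) (b x))"
  unfolding sbuild_def
proof (rule ptime_srec[where pg = "\<lambda>n. 0" and pk = "\<lambda>n. 16 * n"], goal_cases)
  case (10 c s a r v) show ?case using size_spass[of c v] by simp
qed (intro ptime_intros assms polyf_intros | simp)+

text \<open>Every bracket is given the path from its vertex to the root, and a marker \<open>Pair sT Leaf\<close>
  for the visit of the vertex is added behind every opening bracket.\<close>

definition sann_aux where
  "sann_aux = srec (\<lambda>c s. Leaf) (\<lambda>c s a r. if hd_sexp a = Leaf then tl_sexp s else Pair (hd_sexp (tl_sexp a)) s)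
     (\<lambda>c s a r v. if hd_sexp a = Leaf then Pair (Pair Leaf (Pair (tl_sexp (tl_sexp a)) s)) v
        else Pair (Pair sT (Pair (tl_sexp (tl_sexp a)) (Pair (hd_sexp (tl_sexp a)) s)))
          (Pair (Pair (Pair sT Leaf) (Pair Leaf (Pair (hd_sexp (tl_sexp a)) s))) v)) Leaf"

definition sann where "sann E = sann_aux Leaf E"

lemma ptime_sann [ptime_intros]:
  assumes "ptime D a" shows "ptime D (\<lambda>x. sann (a x))"
proof -
  have 1: "size (hd_sexp (tl_sexp a)) \<le> size a" "size (tl_sexp (tl_sexp a)) \<le> size a" for a
    using size_tl_le[of a] size_tl_le[of "tl_sexp a"] size_hd_le[of "tl_sexp a"] by auto
  show ?thesis unfolding sann_def sann_aux_def
  proof (rule ptime_srec[where pg = "\<lambda>n. n + 1" and pk = "\<lambda>n. 3 * n + 20"], goal_cases)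
    case (8 c s a r) show ?case using 1[of a] size_tl_le[of s] by auto
  next
    case (10 c s a r v) show ?case using 1[of a] by auto
  qed (intro ptime_intros assms polyf_intros | simp)+
qed

section \<open>Unary numbers, classes and masses\<close>

definition sunary where
  "sunary l = srec (\<lambda>c s. Leaf) (\<lambda>c s a r. s) (\<lambda>c s a r v. Pair Leaf v) Leaf Leaf l"

lemma ptime_sunary [ptime_intros]:
  assumes "ptime D a" shows "ptime D (\<lambda>x. sunary (a x))"
  unfolding sunary_def
  by (rule ptime_srec[where pg = "\<lambda>n. 0" and pk = "\<lambda>n. 1"])
    (intro ptime_intros assms polyf_intros | simp)+

definition slookup where
  "slookup v taus = srec (\<lambda>c s. Leaf) (\<lambda>c s a r. sinc s)
     (\<lambda>c s a r w. if seq c s = Leaf then w else a) v (Pair sT Leaf) taus"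

lemma ptime_slookup [ptime_intros]:
  assumes "ptime D a" "ptime D b" shows "ptime D (\<lambda>x. slookup (a x) (b x))"
  unfolding slookup_def
proof (rule ptime_srec[where pg = "\<lambda>n. 2" and pk = "\<lambda>n. n"], goal_cases)
  case (8 c s a r) show ?case by (rule size_sinc)
qed (intro ptime_intros assms polyf_intros | simp)+

text \<open>A positive number has one binary digit more than the floor of its binary
  logarithm.\<close>

definition sclass where "sclass taus v = tl_sexp (sunary (slookup v taus))"

lemma ptime_sclass [ptime_intros]:
  assumes "ptime D a" "ptime D b" shows "ptime D (\<lambda>x. sclass (a x) (b x))"
  unfolding sclass_def by (intro ptime_intros assms)

definition smin_aux where
  "smin_aux = srec (\<lambda>c s. Leaf) (\<lambda>c s a r. tl_sexp s) (\<lambda>c s a r v. if s = Leaf then Leaf else Pair Leaf v) Leaf"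

definition smin where "smin a b = smin_aux b a"

lemma ptime_smin [ptime_intros]:
  assumes "ptime D a" "ptime D b" shows "ptime D (\<lambda>x. smin (a x) (b x))"
  unfolding smin_def smin_aux_def
proof (rule ptime_srec[where pg = "\<lambda>n. 0" and pk = "\<lambda>n. 1"], goal_cases)
  case (8 c s a r) show ?case using size_tl_le[of s] by simp
qed (intro ptime_intros assms polyf_intros | simp)+

lemma size_smin: "size (smin a b) \<le> size a"
proof -
  have "size (smin_aux b a) \<le> size a"
    unfolding smin_aux_def by (induction a arbitrary: b) (auto intro: trans_le_add2)
  then show ?thesis by (simp add: smin_def)
qed

text \<open>The paths that contain \<open>v\<close> belong to the vertices of the subtree of
  \<open>v\<close>; \<open>M\<close> is the start value of the minimum.\<close>

definition smin_class where
  "smin_class taus v M N = srec (\<lambda>c s. s) (\<lambda>c s a r. s)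
     (\<lambda>c s a r w. if smem (hd_sexp c) (tl_sexp (tl_sexp a)) = Leaf then w
        else smin (sclass (tl_sexp c) (hd_sexp (tl_sexp (tl_sexp a)))) w) (Pair v taus) M N"

lemma ptime_smin_class [ptime_intros]:
  assumes "ptime D a" "ptime D b" "ptime D c" "ptime D d"
  shows "ptime D (\<lambda>x. smin_class (a x) (b x) (c x) (d x))"
proof -
  have "ptime UNIV (\<lambda>z. sclass (tl_sexp (hd_sexp z)) (hd_sexp (tl_sexp (tl_sexp (tl_sexp z)))))"
    by (intro ptime_intros)
  then obtain p where p: "polyf p"
    "\<And>z. size (sclass (tl_sexp (hd_sexp z)) (hd_sexp (tl_sexp (tl_sexp (tl_sexp z))))) \<le> p (size z)"
    by (rule ptime_size) auto
  show ?thesis unfolding smin_class_def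
  proof (rule ptime_srec[where pg = "\<lambda>n. 0" and pk = "\<lambda>n. p (Suc n)"], goal_cases)
    case (10 c s a r w)
    have "p (size (Pair c a)) \<le> p (Suc (size c + size s + size a + size r))"
      by (rule polyf_mono[OF p(1)]) simp
    then show ?case
      using p(2)[of "Pair c a"] size_smin[of "sclass (tl_sexp c) (hd_sexp (tl_sexp (tl_sexp a)))" w] by auto
  qed (intro ptime_intros assms polyf_intros polyf_comp[OF p(1)] | simp)+
qed

definition sapp where
  "sapp a b = srec (\<lambda>c s. s) (\<lambda>c s a r. s) (\<lambda>c s a r v. Pair a v) Leaf b a"

lemma ptime_sapp [ptime_intros]:
  assumes "ptime D a" "ptime D b" shows "ptime D (\<lambda>x. sapp (a x) (b x))"
  unfolding sapp_def
  by (rule ptime_srec[where pg = "\<lambda>n. 0" and pk = "\<lambda>n. n + 1"])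
    (intro ptime_intros assms polyf_intros | simp)+

lemma sapp_simps [simp]: "sapp Leaf b = b" "sapp (Pair a r) b = Pair a (sapp r b)"
  by (simp_all add: sapp_def)

lemma size_sapp: "size (sapp a b) = size a + size b"
  by (induction a) auto

lemma size_sunary: "size (sunary a) \<le> size a"
  by (induction a) (auto simp: sunary_def)

text \<open>A crude common bound for all classes. It is unary in order to count levels, and masses
  are scaled by this power of 2 in order to stay integral.\<close>

definition stotal where
  "stotal taus = srec (\<lambda>c s. Leaf) (\<lambda>c s a r. s) (\<lambda>c s a r v. sapp (sunary a) v) Leaf Leaf taus"

lemma ptime_stotal [ptime_intros]:
  assumes "ptime D a" shows "ptime D (\<lambda>x. stotal (a x))"
  unfolding stotal_def
proof (rule ptime_srec[where pg = "\<lambda>n. 0" and pk = "\<lambda>n. n"], goal_cases)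
  case (10 c s a r v) show ?case using size_sunary[of a] by (simp add: size_sapp)
qed (intro ptime_intros assms polyf_intros | simp)+

definition sdrop_aux where
  "sdrop_aux = srec (\<lambda>c s. s) (\<lambda>c s a r. tl_sexp s) (\<lambda>c s a r v. v) Leaf"

definition sdrop where "sdrop n l = sdrop_aux l n"

lemma ptime_sdrop [ptime_intros]:
  assumes "ptime D a" "ptime D b" shows "ptime D (\<lambda>x. sdrop (a x) (b x))"
  unfolding sdrop_def sdrop_aux_def
proof (rule ptime_srec[where pg = "\<lambda>n. 0" and pk = "\<lambda>n. 0"], goal_cases)
  case (8 c s a r) show ?case using size_tl_le[of s] by simp
qed (intro ptime_intros assms polyf_intros | simp)+

definition sshift where
  "sshift w n = srec (\<lambda>c s. s) (\<lambda>c s a r. s) (\<lambda>c s a r v. sdbl v) Leaf w n"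

lemma ptime_sshift [ptime_intros]:
  assumes "ptime D a" "ptime D b" shows "ptime D (\<lambda>x. sshift (a x) (b x))"
  unfolding sshift_def
proof (rule ptime_srec[where pg = "\<lambda>n. 0" and pk = "\<lambda>n. 1"], goal_cases)
  case (10 c s a r v) show ?case using size_scons(1)[of Leaf v] by simp
qed (intro ptime_intros assms polyf_intros | simp)+

text \<open>An item \<open>Pair cl (Pair w p)\<close> has the class \<open>cl\<close> in unary, the scaled weight \<open>w\<close> and, if it is
  the marker of a visit, the path \<open>p\<close> to be served.\<close>

definition sitem where
  "sitem taus M N a = Pair (smin_class taus (hd_sexp (tl_sexp (tl_sexp a))) M N)
     (Pair (sshift (hd_sexp (tl_sexp a)) (sdrop (smin_class taus (hd_sexp (tl_sexp (tl_sexp a))) M N) M))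
       (if hd_sexp (hd_sexp a) = Leaf then Leaf else tl_sexp (tl_sexp a)))"

lemma ptime_sitem [ptime_intros]:
  assumes "ptime D a" "ptime D b" "ptime D c" "ptime D d"
  shows "ptime D (\<lambda>x. sitem (a x) (b x) (c x) (d x))"
  unfolding sitem_def by (intro ptime_intros assms)

definition sitems where
  "sitems taus M N = srec (\<lambda>c s. Leaf) (\<lambda>c s a r. s)
     (\<lambda>c s a r v. Pair (sitem (hd_sexp c) (hd_sexp (tl_sexp c)) (tl_sexp (tl_sexp c)) a) v)
     (Pair taus (Pair M N)) Leaf N"

lemma ptime_sitems [ptime_intros]:
  assumes "ptime D a" "ptime D b" "ptime D c"
  shows "ptime D (\<lambda>x. sitems (a x) (b x) (c x))"
proof -
  have "ptime UNIV (\<lambda>z. sitem (hd_sexp (hd_sexp z)) (hd_sexp (tl_sexp (hd_sexp z))) (tl_sexp (tl_sexp (hd_sexp z))) (tl_sexp z))"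
    by (intro ptime_intros)
  then obtain p where p: "polyf p"
    "\<And>z. size (sitem (hd_sexp (hd_sexp z)) (hd_sexp (tl_sexp (hd_sexp z))) (tl_sexp (tl_sexp (hd_sexp z))) (tl_sexp z)) \<le> p (size z)"
    by (rule ptime_size) auto
  show ?thesis unfolding sitems_def
  proof (rule ptime_srec[where pg = "\<lambda>n. 0" and pk = "\<lambda>n. p (Suc n) + 1"], goal_cases)
    case (10 c s a r w)
    have "p (size (Pair c a)) \<le> p (Suc (size c + size s + size a + size r))"
      by (rule polyf_mono[OF p(1)]) simp
    then show ?case
      using p(2)[of "Pair c a"] by auto
  qed (intro ptime_intros assms polyf_intros polyf_comp[OF p(1)] | simp)+
qed

section \<open>One level of the splitting, and the tour of a day\<close>

text \<open>Items other than visit markers carry the empty path and contribute nothing.\<close>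

definition sserved where
  "sserved R = srec (\<lambda>c s. Leaf) (\<lambda>c s a r. s)
     (\<lambda>c s a r v. if hd_sexp a = Leaf then sapp (tl_sexp (tl_sexp a)) v else v) Leaf Leaf R"

lemma ptime_sserved [ptime_intros]:
  assumes "ptime D a" shows "ptime D (\<lambda>x. sserved (a x))"
  unfolding sserved_def
proof (rule ptime_srec[where pg = "\<lambda>n. 0" and pk = "\<lambda>n. n"], goal_cases)
  case (10 c s a r v) show ?case
    using size_tl_le[of a] size_tl_le[of "tl_sexp a"] by (simp add: size_sapp)
qed (intro ptime_intros assms polyf_intros | simp)+

definition smass where
  "smass R = srec (\<lambda>c s. Leaf) (\<lambda>c s a r. s)
     (\<lambda>c s a r v. if hd_sexp a = Leaf then v else sadd (hd_sexp (tl_sexp a)) v) Leaf Leaf R"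

lemma ptime_smass [ptime_intros]:
  assumes "ptime D a" shows "ptime D (\<lambda>x. smass (a x))"
  unfolding smass_def
proof (rule ptime_srec[where pg = "\<lambda>n. 0" and pk = "\<lambda>n. 2 * n + 2"], goal_cases)
  case (10 c s a r v) show ?case
    using size_tl_le[of a] size_hd_le[of "tl_sexp a"] size_sadd(1)[of "hd_sexp (tl_sexp a)" v] by simp
qed (intro ptime_intros assms polyf_intros | simp)+

definition srest where
  "srest R = srec (\<lambda>c s. Leaf) (\<lambda>c s a r. s)
     (\<lambda>c s a r v. if hd_sexp a = Leaf then v
        else Pair (Pair (tl_sexp (hd_sexp a)) (Pair (sdbl (hd_sexp (tl_sexp a))) (tl_sexp (tl_sexp a)))) v) Leaf Leaf R"

lemma ptime_srest [ptime_intros]: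
  assumes "ptime D a" shows "ptime D (\<lambda>x. srest (a x))"
  unfolding srest_def
proof (rule ptime_srec[where pg = "\<lambda>n. 0" and pk = "\<lambda>n. n + 4"], goal_cases)
  case (10 c s a r v) show ?case
    using size_hd_tl_le[of a] size_tl_le[of "hd_sexp a"] size_hd_tl_le[of "tl_sexp a"]
      size_scons(1)[of Leaf "hd_sexp (tl_sexp a)"] by simp
qed (intro ptime_intros assms polyf_intros | simp)+

text \<open>The state is the mass that the left half can still take; a failing subtraction means
  that the current item must be cut.\<close>

definition sleft_aux where
  "sleft_aux = srec (\<lambda>c s. Leaf)
     (\<lambda>c s a r. if ssub s (hd_sexp (tl_sexp a)) = Leaf then s else hd_sexp (ssub s (hd_sexp (tl_sexp a))))
     (\<lambda>c s a r v. if ssub s (hd_sexp (tl_sexp a)) = Leaf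
        then Pair (Pair (hd_sexp a) (Pair s (tl_sexp (tl_sexp a)))) Leaf else Pair a v) Leaf"

definition sright_aux where
  "sright_aux = srec (\<lambda>c s. Leaf)
     (\<lambda>c s a r. if ssub s (hd_sexp (tl_sexp a)) = Leaf then s else hd_sexp (ssub s (hd_sexp (tl_sexp a))))
     (\<lambda>c s a r v. if ssub s (hd_sexp (tl_sexp a)) = Leaf
        then Pair (Pair (hd_sexp a) (Pair (hd_sexp (ssub (hd_sexp (tl_sexp a)) s)) (tl_sexp (tl_sexp a)))) r else v) Leaf"

text \<open>A difference has no more digits than the minuend but possibly more nonzero ones. Hence
  the state is measured by \<open>bsize\<close>, which does not increase.\<close>

lemma ptime_split_aux [ptime_intros]:
  assumes "ptime D a" "ptime D b"
  shows "ptime D (\<lambda>x. sleft_aux (a x) (b x))" and "ptime D (\<lambda>x. sright_aux (a x) (b x))"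
proof -
  have g: "bsize (if P then s else hd_sexp (ssub s w)) \<le> bsize s + 0" for P s w
    using size_ssub[of s w] by (auto simp: bsize_def)
  show "ptime D (\<lambda>x. sleft_aux (a x) (b x))" unfolding sleft_aux_def
  proof (rule ptime_srec_measure[where pg = "\<lambda>n. 0" and pk = "\<lambda>n. n + 4" and \<mu>=bsize and p\<mu> = "\<lambda>n. 2 * n"
        and \<nu>=size and p\<nu> = "\<lambda>n. n"], goal_cases)
    case (14 c s a r) show ?case by (rule g)
  next
    case (16 c s a r v)
    show ?case using size_hd_tl_le[of a] size_tl_le[of "tl_sexp a"] by simp
  qed (intro ptime_intros assms polyf_intros bsize order_refl | simp)+
  show "ptime D (\<lambda>x. sright_aux (a x) (b x))" unfolding sright_aux_def
  proof (rule ptime_srec_measure[where pg = "\<lambda>n. 0" and pk = "\<lambda>n. 2 * n + 4" and \<mu>=bsize and p\<mu> = "\<lambda>n. 2 * n"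
        and \<nu>=size and p\<nu> = "\<lambda>n. n"], goal_cases)
    case (14 c s a r) show ?case by (rule g)
  next
    case (16 c s a r v)
    have "size (hd_sexp (ssub (hd_sexp (tl_sexp a)) s)) \<le> 2 * size (hd_sexp (tl_sexp a))"
      using size_ssub[of "hd_sexp (tl_sexp a)" s] slen_le_size[of "hd_sexp (tl_sexp a)"] by linarith
    then show ?case using size_hd_tl_le[of a] size_hd_tl_le[of "tl_sexp a"] by simp
  qed (intro ptime_intros assms polyf_intros bsize order_refl | simp)+
qed

definition shalf where
  "shalf b R = (if b = Leaf then sleft_aux (smass R) (srest R) else sright_aux (smass R) (srest R))"

lemma ptime_shalf [ptime_intros]:
  assumes "ptime D a" "ptime D b" shows "ptime D (\<lambda>x. shalf (a x) (b x))"
  unfolding shalf_def by (intro ptime_intros assms)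

text \<open>Recursion along a unary counter; the state pairs the unread digits of the day with the
  current items. Its growth per round depends on the number of items in the state, so polynomial
  time is shown separately in \<open>ptime_sselect_aux\<close>.\<close>

definition sselect_aux where
  "sselect_aux = srec (\<lambda>c s. Leaf) (\<lambda>c s a r. Pair (tl_sexp (hd_sexp s)) (shalf (hd_sexp (hd_sexp s)) (tl_sexp s)))
     (\<lambda>c s a r v. sapp (sserved (tl_sexp s)) v) Leaf"

text \<open>An opening bracket is the step down to its vertex, a closing bracket the step back to
  the parent. At the top the remaining path is empty and its head \<open>Leaf\<close> is the
  depot.\<close>

definition swalk where
  "swalk X N = srec (\<lambda>c s. Leaf) (\<lambda>c s a r. s)
     (\<lambda>c s a r v. if hd_sexp (hd_sexp a) = Leaf then
          if smem (hd_sexp (tl_sexp (tl_sexp a))) c = Leaf then v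
          else Pair (if hd_sexp a = Leaf then hd_sexp (tl_sexp (tl_sexp (tl_sexp a))) else hd_sexp (tl_sexp (tl_sexp a))) v
        else v) X Leaf N"

lemma ptime_swalk [ptime_intros]:
  assumes "ptime D a" "ptime D b" shows "ptime D (\<lambda>x. swalk (a x) (b x))"
  unfolding swalk_def
proof (rule ptime_srec[where pg = "\<lambda>n. 0" and pk = "\<lambda>n. n + 1"], goal_cases)
  case (10 c s a r v)
  have "size (hd_sexp (tl_sexp (tl_sexp a))) \<le> size a" "size (hd_sexp (tl_sexp (tl_sexp (tl_sexp a)))) \<le> size a"
    using size_tl_le[of a] size_tl_le[of "tl_sexp a"] size_tl_le[of "tl_sexp (tl_sexp a)"]
      size_hd_le[of "tl_sexp (tl_sexp a)"] size_hd_le[of "tl_sexp (tl_sexp (tl_sexp a))"] by linarith+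
  then show ?case by simp
qed (intro ptime_intros assms polyf_intros | simp)+

section \<open>Splitting the Euler tour\<close>

text \<open>Position in the Euler tour, number of levels left until the class is reached, and
  current mass.\<close>

type_synonym item = "nat \<times> nat \<times> nat"

definition total :: "item list \<Rightarrow> nat" where
  "total R = (\<Sum>(n, c, w) \<leftarrow> R. w)"

definition mass :: "item list \<Rightarrow> nat" where
  "mass R = (\<Sum>(n, c, w) \<leftarrow> R. if c = 0 then 0 else w)"

definition paid :: "item list \<Rightarrow> nat" where
  "paid R = (\<Sum>(n, c, w) \<leftarrow> R. if c = 0 then w else 0)"

definition rest :: "item list \<Rightarrow> item list" where
  "rest R = map (\<lambda>(n, c, w). (n, c - 1, 2 * w)) (filter (\<lambda>(n, c, w). c \<noteq> 0) R)"

text \<open>The boundary item stays in both parts and only its mass is divided. An item of mass 0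
  always fits and is never cut.\<close>

fun lpart :: "nat \<Rightarrow> item list \<Rightarrow> item list" where
  "lpart s [] = []"
| "lpart s ((n, c, w) # xs) = (if w \<le> s then (n, c, w) # lpart (s - w) xs else [(n, c, s)])"

fun rpart :: "nat \<Rightarrow> item list \<Rightarrow> item list" where
  "rpart s [] = []"
| "rpart s ((n, c, w) # xs) = (if w \<le> s then rpart (s - w) xs else (n, c, w - s) # xs)"

definition half :: "bool \<Rightarrow> item list \<Rightarrow> item list" where
  "half b R = (if b then rpart (mass R) (rest R) else lpart (mass R) (rest R))"

text \<open>Digits are read from the least significant one, so level \<open>i\<close> depends only
  on the day modulo 2^i.\<close>

fun level :: "nat \<Rightarrow> item list \<Rightarrow> nat \<Rightarrow> item list" where
  "level k R 0 = R"
| "level k R (Suc i) = level (k div 2) (half (odd k) R) i"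

lemma level_Suc: "level k R (Suc i) = half (odd (k div 2 ^ i)) (level k R i)"
proof (induction i arbitrary: k R)
  case (Suc i)
  have "level k R (Suc (Suc i)) = level (k div 2) (half (odd k) R) (Suc i)" by (rule level.simps)
  also have "\<dots> = half (odd (k div 2 div 2 ^ i)) (level (k div 2) (half (odd k) R) i)" by (rule Suc)
  finally show ?case by (simp add: div_mult2_eq)
qed simp

lemma total_lpart: "total (lpart s xs) = min s (total xs)"
  by (induction s xs rule: lpart.induct) (auto simp: total_def)

lemma total_rpart: "total (rpart s xs) = total xs - s"
  by (induction s xs rule: rpart.induct) (auto simp: total_def)

lemma total_rest: "total (rest R) = 2 * mass R"
  by (induction R) (auto simp: total_def rest_def mass_def)

text \<open>After doubling, the mass is \<open>2 * mass R\<close>, so cutting at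
  \<open>mass R\<close> leaves the same mass for either digit.\<close>

lemma total_half: "total (half b R) = mass R"
  by (auto simp: half_def total_lpart total_rpart total_rest)

lemma total_eq: "total R = mass R + paid R"
  by (induction R) (auto simp: total_def mass_def paid_def)

text \<open>Each level passes on exactly what it does not pay, and the sum telescopes.\<close>

lemma paid_le: "(\<Sum>i<I. paid (level k R i)) + total (level k R I) = total R"
proof (induction I)
  case (Suc I) then show ?case
    using total_eq[of "level k R I"] by (simp add: level_Suc total_half del: level.simps(2))
qed simp

lemma part_cases:
  obtains "lpart s xs = xs" "rpart s xs = []"
  | ys n c w zs b where "xs = ys @ (n, c, w) # zs" "lpart s xs = ys @ [(n, c, b)]"
      "rpart s xs = (n, c, w - b) # zs" "b < w"
proof -
  have "(lpart s xs = xs \<and> rpart s xs = []) \<or> (\<exists>ys n c w zs b. xs = ys @ (n, c, w) # zs \<and>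
     lpart s xs = ys @ [(n, c, b)] \<and> rpart s xs = (n, c, w - b) # zs \<and> b < w)"
  proof (induction s xs rule: lpart.induct)
    case (2 s n c w xs)
    show ?case
    proof (cases "w \<le> s")
      case True
      with 2 consider "lpart (s - w) xs = xs" "rpart (s - w) xs = []"
        | ys n c w' zs b where "xs = ys @ (n, c, w') # zs" "lpart (s - w) xs = ys @ [(n, c, b)]"
          "rpart (s - w) xs = (n, c, w' - b) # zs" "b < w'" by blast
      then show ?thesis
      proof cases
        case 1 with True show ?thesis by simp
      next
        case (2 ys n' c' w' zs b)
        then have "(n, c, w) # xs = ((n, c, w) # ys) @ (n', c', w') # zs" 
          "lpart s ((n, c, w) # xs) = ((n, c, w) # ys) @ [(n', c', b)]"
          "rpart s ((n, c, w) # xs) = (n', c', w' - b) # zs" using True by auto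
        with 2(4) show ?thesis by blast
      qed
    next
      case False
      then have "(n, c, w) # xs = [] @ (n, c, w) # xs" "lpart s ((n, c, w) # xs) = [] @ [(n, c, s)]"
        "rpart s ((n, c, w) # xs) = (n, c, w - s) # xs" "s < w" by auto
      then show ?thesis by blast
    qed
  qed simp
  then show ?thesis using that by blast
qed

lemma weightless_in_part: "(n, c, 0) \<in> set xs \<Longrightarrow> (n, c, 0) \<in> set (lpart s xs) \<or> (n, c, 0) \<in> set (rpart s xs)"
  by (induction s xs rule: lpart.induct) auto

text \<open>An item of mass 0 survives uncut in one of the halves at each level; the
  \<open>c\<close> digits that lead to it form the residue \<open>r\<close>.\<close>

lemma weightless_served:
  "(n, c, 0) \<in> set R \<Longrightarrow> \<exists>r<2 ^ c. \<forall>k. k mod 2 ^ c = r \<longrightarrow> (n, 0, 0) \<in> set (level k R c)"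
proof (induction c arbitrary: R)
  case (Suc c)
  have "(n, c, 0) \<in> set (rest R)" using Suc.prems by (force simp: rest_def)
  then have "(n, c, 0) \<in> set (half False R) \<or> (n, c, 0) \<in> set (half True R)"
    using weightless_in_part[of n c "rest R" "mass R"] by (simp add: half_def)
  then obtain b where "(n, c, 0) \<in> set (half b R)" by blast
  from Suc.IH[OF this] obtain r where r: "r < 2 ^ c"
    "\<And>k. k mod 2 ^ c = r \<Longrightarrow> (n, 0, 0) \<in> set (level k (half b R) c)" by blast
  have "(n, 0, 0) \<in> set (level k R (Suc c))" if k: "k mod 2 ^ Suc c = 2 * r + of_bool b" for k
  proof -
    from k have e: "2 * (k div 2 mod 2 ^ c) + k mod 2 = 2 * r + of_bool b"
      using mod_mult2_eq[of k 2 "2 ^ c"] by simp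
    then have "even (2 * (k div 2 mod 2 ^ c) + k mod 2) \<longleftrightarrow> even (2 * r + of_bool b :: nat)" by simp
    then have o: "odd k = b" by (cases b) auto
    then have "k mod 2 = of_bool b" by (cases b) (auto simp: odd_iff_mod_2_eq_one)
    with e have "k div 2 mod 2 ^ c = r" by simp
    with r(2) o show ?thesis by simp
  qed
  moreover have "2 * r + of_bool b < 2 ^ Suc c" using r(1) by (cases b) auto
  ultimately show ?case by blast
qed simp

text \<open>The items of a level form an interval of the items of sufficiently high class, except that the
  first and the last one may have been cut.\<close>

definition level_inv :: "nat \<Rightarrow> (nat \<Rightarrow> nat) \<Rightarrow> (nat \<Rightarrow> nat) \<Rightarrow> nat \<Rightarrow> item list \<Rightarrow> bool" where
  "level_inv N cl F i R \<longleftrightarrow> (\<forall>(n, c, w)\<in>set R. n < N \<and> c + i = cl n \<and> w \<le> 2 ^ i * F n) \<and>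
     sorted_wrt (<) (map fst R) \<and>
     (\<forall>a\<in>fst ` set R. \<forall>b\<in>fst ` set R. \<forall>n. a < n \<and> n < b \<and> i \<le> cl n \<longrightarrow> (n, cl n - i, 2 ^ i * F n) \<in> set R)"

lemma level_invD:
  assumes "level_inv N cl F i R"
  shows "(n, c, w) \<in> set R \<Longrightarrow> n < N \<and> c + i = cl n \<and> w \<le> 2 ^ i * F n"
    and "sorted_wrt (<) (map fst R)"
    and "a \<in> fst ` set R \<Longrightarrow> b \<in> fst ` set R \<Longrightarrow> a < n \<Longrightarrow> n < b \<Longrightarrow> i \<le> cl n \<Longrightarrow> (n, cl n - i, 2 ^ i * F n) \<in> set R"
  using assms unfolding level_inv_def by blast+

lemma level_inv_init: "level_inv N cl F 0 (map (\<lambda>n. (n, cl n, F n)) [0..<N])"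
  by (auto simp: level_inv_def o_def image_iff)

lemma level_inv_rest:
  assumes "level_inv N cl F i R" shows "level_inv N cl F (Suc i) (rest R)"
  unfolding level_inv_def
proof (intro conjI ballI allI impI)
  fix x assume "x \<in> set (rest R)"
  then obtain n c w where "x = (n, c - 1, 2 * w)" "(n, c, w) \<in> set R" "c \<noteq> 0" by (auto simp: rest_def)
  with level_invD(1)[OF assms] show "case x of (n, c, w) \<Rightarrow> n < N \<and> c + Suc i = cl n \<and> w \<le> 2 ^ Suc i * F n"
    by fastforce
next
  have "map fst (rest R) = map fst (filter (\<lambda>(n, c, w). c \<noteq> 0) R)"
    by (auto simp: rest_def)
  then show "sorted_wrt (<) (map fst (rest R))"
    using level_invD(2)[OF assms] by (simp add: sorted_wrt_map sorted_wrt_filter)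
next
  fix a b n assume *: "a \<in> fst ` set (rest R)" "b \<in> fst ` set (rest R)" "a < n \<and> n < b \<and> Suc i \<le> cl n"
  then have "a \<in> fst ` set R" "b \<in> fst ` set R" by (force simp: rest_def)+
  with * level_invD(3)[OF assms] have "(n, cl n - i, 2 ^ i * F n) \<in> set R" by auto
  with * have "(n, cl n - i - 1, 2 * (2 ^ i * F n)) \<in> set (rest R)" unfolding rest_def by force
  then show "(n, cl n - Suc i, 2 ^ Suc i * F n) \<in> set (rest R)" by (simp add: mult.assoc)
qed

text \<open>The cut item becomes the last one on the left and the first one on the right, so it
  never lies strictly between two others.\<close>

lemma level_inv_part:
  assumes "level_inv N cl F i R" shows "level_inv N cl F i (lpart s R)" "level_inv N cl F i (rpart s R)"
proof -
  show "level_inv N cl F i (lpart s R)"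
  proof (cases rule: part_cases[of s R])
    case 1 with assms show ?thesis by simp
  next
    case (2 ys n c w zs b)
    have so: "sorted_wrt (<) (map fst ys @ n # map fst zs)" using level_invD(2)[OF assms] 2(1) by simp
    show ?thesis unfolding level_inv_def 2(2)
    proof (intro conjI ballI allI impI)
      fix x assume "x \<in> set (ys @ [(n, c, b)])"
      then show "case x of (n, c, w) \<Rightarrow> n < N \<and> c + i = cl n \<and> w \<le> 2 ^ i * F n"
        using level_invD(1)[OF assms] 2(1,4) by fastforce
    next
      show "sorted_wrt (<) (map fst (ys @ [(n, c, b)]))" using so by (auto simp: sorted_wrt_append)
    next
      fix a a' m assume *: "a \<in> fst ` set (ys @ [(n, c, b)])" "a' \<in> fst ` set (ys @ [(n, c, b)])" "a < m \<and> m < a' \<and> i \<le> cl m"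
      then have "a \<in> fst ` set R" "a' \<in> fst ` set R" using 2(1) by auto
      with * level_invD(3)[OF assms] have m: "(m, cl m - i, 2 ^ i * F m) \<in> set R" by blast
      have "a' \<le> n" using *(2) so by (force simp: sorted_wrt_append)
      with * have "m < n" by simp
      then have "(m, cl m - i, 2 ^ i * F m) \<notin> set ((n, c, w) # zs)" using so by (force simp: sorted_wrt_append)
      with m 2(1) show "(m, cl m - i, 2 ^ i * F m) \<in> set (ys @ [(n, c, b)])" by auto
    qed
  qed
  show "level_inv N cl F i (rpart s R)"
  proof (cases rule: part_cases[of s R])
    case 1 then show ?thesis by (simp add: level_inv_def)
  next
    case (2 ys n c w zs b)
    have so: "sorted_wrt (<) (map fst ys @ n # map fst zs)" using level_invD(2)[OF assms] 2(1) by simp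
    show ?thesis unfolding level_inv_def 2(3)
    proof (intro conjI ballI allI impI)
      fix x assume "x \<in> set ((n, c, w - b) # zs)"
      then show "case x of (n, c, w) \<Rightarrow> n < N \<and> c + i = cl n \<and> w \<le> 2 ^ i * F n"
        using level_invD(1)[OF assms] 2(1,4) by fastforce
    next
      show "sorted_wrt (<) (map fst ((n, c, w - b) # zs))" using so by (auto simp: sorted_wrt_append)
    next
      fix a a' m assume *: "a \<in> fst ` set ((n, c, w - b) # zs)" "a' \<in> fst ` set ((n, c, w - b) # zs)" "a < m \<and> m < a' \<and> i \<le> cl m"
      then have "a \<in> fst ` set R" "a' \<in> fst ` set R" using 2(1) by auto
      with * level_invD(3)[OF assms] have m: "(m, cl m - i, 2 ^ i * F m) \<in> set R" by blast
      have "n \<le> a" using *(1) so by (force simp: sorted_wrt_append)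
      with * have "n < m" by simp
      then have "(m, cl m - i, 2 ^ i * F m) \<notin> set (ys @ [(n, c, w)])" using so by (force simp: sorted_wrt_append)
      with m 2(1) show "(m, cl m - i, 2 ^ i * F m) \<in> set ((n, c, w - b) # zs)" by auto
    qed
  qed
qed

lemma level_inv_half: "level_inv N cl F i R \<Longrightarrow> level_inv N cl F (Suc i) (half b R)"
  unfolding half_def by (auto intro: level_inv_part level_inv_rest)

lemma level_inv_level:
  assumes "level_inv N cl F 0 R" shows "level_inv N cl F i (level k R i)"
proof (induction i)
  case (Suc i) then show ?case unfolding level_Suc by (rule level_inv_half)
qed (use assms in simp)

lemma half_ids: "fst ` set (half b R) \<subseteq> fst ` set R"
proof -
  have "fst ` set (lpart s xs) \<subseteq> fst ` set xs" "fst ` set (rpart s xs) \<subseteq> fst ` set xs" for s xs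
    by (cases rule: part_cases[of s xs]; auto)+
  then have "fst ` set (half b R) \<subseteq> fst ` set (rest R)" by (simp add: half_def)
  also have "\<dots> \<subseteq> fst ` set R" by (force simp: rest_def)
  finally show ?thesis .
qed

lemma level_ids: "i \<le> j \<Longrightarrow> fst ` set (level k R j) \<subseteq> fst ` set (level k R i)"
proof (induction j rule: dec_induct)
  case (step n) show ?case unfolding level_Suc by (rule subset_trans[OF half_ids step.IH])
qed simp

text \<open>An item that arrives uncut at the level of its class is paid there in full. Grouped by
  class, the items are covered by the payments of the levels, which \<open>paid_le\<close>
  bounds.\<close>

lemma fully_paid:
  assumes inv: "level_inv N cl F 0 R" and T: "finite T"
    "\<And>n. n \<in> T \<Longrightarrow> (n, 0, 2 ^ cl n * F n) \<in> set (level k R (cl n))"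
  shows "(\<Sum>n\<in>T. 2 ^ cl n * F n) \<le> total R"
proof -
  define I where "I = Suc (\<Sum>n\<in>T. cl n)"
  have I: "cl n < I" if "n \<in> T" for n using member_le_sum[of n T cl] that T(1) by (auto simp: I_def less_Suc_eq_le)
  have le: "(\<Sum>n\<in>{n \<in> T. cl n = i}. 2 ^ cl n * F n) \<le> paid (level k R i)" for i
  proof -
    let ?R = "level k R i" and ?T = "{n \<in> T. cl n = i}"
    have "distinct (map fst ?R)" using level_invD(2)[OF level_inv_level[OF inv, of i k]]
      by (simp add: strict_sorted_iff)
    then have d: "distinct ?R" by (simp add: distinct_map)
    have "(\<Sum>n\<in>?T. 2 ^ cl n * F n) = (\<Sum>(n, c, w)\<in>(\<lambda>n. (n, 0 :: nat, 2 ^ cl n * F n)) ` ?T. if c = 0 then w else 0)"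
      by (subst sum.reindex) (auto simp: inj_on_def)
    also have "\<dots> \<le> (\<Sum>(n, c, w)\<in>set ?R. if c = 0 then w else 0)"
      by (rule sum_mono2) (use T(2) in auto)
    also have "\<dots> = paid ?R" unfolding paid_def using d by (simp add: sum_list_distinct_conv_sum_set)
    finally show ?thesis .
  qed
  have "(\<Sum>n\<in>T. 2 ^ cl n * F n) = (\<Sum>i<I. \<Sum>n\<in>{n \<in> T. cl n = i}. 2 ^ cl n * F n)"
    using I T(1) by (subst sum.group) auto
  also have "\<dots> \<le> (\<Sum>i<I. paid (level k R i))" by (rule sum_mono) (rule le)
  also have "\<dots> \<le> total R" using paid_le[where I=I and k=k and R=R] by linarith
  finally show ?thesis .
qed

section \<open>Forests, paths and Euler tours\<close>

datatype tree = Tip | Br nat tree tree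

text \<open>\<open>Br v c s\<close> is the forest consisting of the tree with root \<open>v\<close> and the subtrees \<open>c\<close>, followed by the
  forest \<open>s\<close>. A vertex is identified with the path from it to the root.\<close>

fun paths :: "nat list \<Rightarrow> tree \<Rightarrow> nat list list" where
  "paths p Tip = []"
| "paths p (Br v c s) = (v # p) # paths (v # p) c @ paths p s"

datatype kind = Open | Visit | Close

fun euler :: "nat list \<Rightarrow> tree \<Rightarrow> (kind \<times> nat list) list" where
  "euler p Tip = []"
| "euler p (Br v c s) = (Open, v # p) # (Visit, v # p) # euler (v # p) c @ (Close, v # p) # euler p s"

fun names :: "tree \<Rightarrow> nat list" where
  "names Tip = []"
| "names (Br v c s) = v # names c @ names s"

lemma map_hd_paths: "map hd (paths p t) = names t"
  by (induction p t rule: paths.induct) auto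

lemma paths_extend: "q \<in> set (paths p t) \<Longrightarrow> \<exists>xs. q = xs @ p \<and> xs \<noteq> [] \<and> set xs \<subseteq> set (names t)"
proof (induction p t rule: paths.induct)
  case (2 p v c s)
  from 2(3) consider "q = v # p" | "q \<in> set (paths (v # p) c)" | "q \<in> set (paths p s)" by auto
  then show ?case
  proof cases
    case 1 then show ?thesis by (intro exI[of _ "[v]"]) auto
  next
    case 2
    from "2.IH"(1)[OF this] obtain xs where "q = xs @ v # p" "set xs \<subseteq> set (names c)" by auto
    then show ?thesis by (intro exI[of _ "xs @ [v]"]) auto
  next
    case 3
    from "2.IH"(2)[OF this] show ?thesis by auto
  qed
qed simp

lemma snd_euler: "snd ` set (euler p t) = set (paths p t)"
  by (induction p t rule: paths.induct) auto

lemma visit_in_euler: "q \<in> set (paths p t) \<Longrightarrow> (Visit, q) \<in> set (euler p t)"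
  by (induction p t rule: paths.induct) auto

text \<open>A path of the forest \<open>s\<close> continues \<open>p\<close> by a name of
  \<open>s\<close>, whereas a path below \<open>v # p\<close> continues it by
  \<open>v\<close>.\<close>

lemma not_below_sibling:
  assumes "v \<notin> set (names s)" "r \<in> set (paths p s)" shows "\<not> suffix (v # p) r"
proof
  assume "suffix (v # p) r"
  then obtain ys where "r = ys @ v # p" by (auto simp: suffix_def)
  moreover from paths_extend[OF assms(2)] obtain xs where "r = xs @ p" "set xs \<subseteq> set (names s)" by auto
  ultimately have "xs = ys @ [v]" by (metis append.assoc append_Cons append_Nil append_same_eq)
  with \<open>set xs \<subseteq> set (names s)\<close> assms(1) show False by auto
qed

text \<open>Brackets nest, so the subtree of \<open>q\<close> fills exactly the stretch between its
  brackets; distinct names prevent \<open>q\<close> from being a suffix of a path in another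
  branch.\<close>

lemma euler_span:
  assumes "distinct (names t)" "q \<in> set (paths p t)"
  shows "\<exists>A M C. euler p t = A @ (Open, q) # M @ (Close, q) # C \<and> (\<forall>x\<in>set M. suffix q (snd x)) \<and>
    (\<forall>x\<in>set A \<union> set C. \<not> suffix q (snd x))"
  using assms
proof (induction p t rule: paths.induct)
  case (2 p v c s)
  then consider "q = v # p" | "q \<in> set (paths (v # p) c)" | "q \<in> set (paths p s)" by auto
  then show ?case
  proof cases
    case 1
    have "suffix q (snd x)" if "x \<in> set (euler (v # p) c)" for x
      using that snd_euler[of "v # p" c] paths_extend[of "snd x" "v # p" c] 1 by (force simp: suffix_def)
    moreover have "\<not> suffix q (snd x)" if "x \<in> set (euler p s)" for x
      using not_below_sibling[of v s "snd x" p] snd_euler[of p s] imageI[OF that, of snd] 1 2 by auto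
    ultimately show ?thesis using 1
      by (intro exI[of _ "[]"] exI[of _ "(Visit, v # p) # euler (v # p) c"] exI[of _ "euler p s"]) auto
  next
    case q: 2
    from 2 obtain A M C where *: "euler (v # p) c = A @ (Open, q) # M @ (Close, q) # C"
      "\<forall>x\<in>set M. suffix q (snd x)" "\<forall>x\<in>set A \<union> set C. \<not> suffix q (snd x)" using q by auto
    from paths_extend[OF q] obtain xs where xs: "q = xs @ v # p" "xs \<noteq> []" by auto
    have "\<not> suffix q (v # p)" using xs by (auto dest: suffix_length_le)
    moreover have "\<not> suffix q (snd x)" if "x \<in> set (euler p s)" for x
    proof
      assume "suffix q (snd x)"
      then have "suffix (v # p) (snd x)" using xs(1) suffix_order.trans suffixI by blast
      then show False using not_below_sibling[of v s "snd x" p] snd_euler[of p s] imageI[OF that, of snd] 2 by auto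
    qed
    ultimately show ?thesis using *
      by (intro exI[of _ "(Open, v # p) # (Visit, v # p) # A"] exI[of _ M] exI[of _ "C @ (Close, v # p) # euler p s"]) auto
  next
    case q: 3
    from 2 obtain A M C where *: "euler p s = A @ (Open, q) # M @ (Close, q) # C"
      "\<forall>x\<in>set M. suffix q (snd x)" "\<forall>x\<in>set A \<union> set C. \<not> suffix q (snd x)" using q by auto
    from paths_extend[OF q] obtain xs where xs: "q = xs @ p" "xs \<noteq> []" "set xs \<subseteq> set (names s)" by auto
    \<comment> \<open>The ancestor of \<open>q\<close> directly below \<open>p\<close>; it is a name
      of \<open>s\<close> and therefore differs from \<open>v\<close>.\<close>
    define u where "u = last xs"
    have u: "q = butlast xs @ u # p" "u \<in> set (names s)" using xs by (auto simp: u_def)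
    have "\<not> suffix q (snd x)" if "snd x = v # p \<or> snd x \<in> set (paths (v # p) c)" for x :: "kind \<times> nat list"
    proof
      assume "suffix q (snd x)"
      then have "suffix (u # p) (snd x)" using u(1) suffix_order.trans suffixI by blast
      moreover have "suffix (v # p) (snd x)"
        using that paths_extend[of "snd x" "v # p" c] by (auto simp: suffix_def)
      ultimately have "u = v" by (auto simp: suffix_def)
      with 2 u(2) show False by auto
    qed
    note not_below = this
    have "\<not> suffix q (v # p)" using not_below[of "(Open, v # p)"] by simp
    moreover have "\<not> suffix q (snd x)" if "x \<in> set (euler (v # p) c)" for x
      using not_below[of x] snd_euler[of "v # p" c] imageI[OF that, of snd] by simp
    ultimately show ?thesis using *
      by (intro exI[of _ "(Open, v # p) # (Visit, v # p) # euler (v # p) c @ (Close, v # p) # A"] exI[of _ M] exI[of _ C]) auto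
  qed
qed simp

lemma euler_span_nth:
  assumes "distinct (names t)" "q \<in> set (paths p t)"
  obtains d u where "d < u" "u < length (euler p t)" "euler p t ! d = (Open, q)" "euler p t ! u = (Close, q)"
    "\<And>n. n < length (euler p t) \<Longrightarrow> suffix q (snd (euler p t ! n)) \<longleftrightarrow> d \<le> n \<and> n \<le> u"
proof -
  from euler_span[OF assms] obtain A M C where *: "euler p t = A @ (Open, q) # M @ (Close, q) # C"
    "\<And>x. x \<in> set M \<Longrightarrow> suffix q (snd x)" "\<And>x. x \<in> set A \<union> set C \<Longrightarrow> \<not> suffix q (snd x)" by blast
  let ?d = "length A" and ?u = "Suc (length A + length M)"
  have "suffix q (snd (euler p t ! n)) \<longleftrightarrow> ?d \<le> n \<and> n \<le> ?u" if n: "n < length (euler p t)" for n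
  proof -
    consider "n < ?d" | "n = ?d" | "?d < n" "n < ?u" | "n = ?u" | "?u < n" by linarith
    then show ?thesis
    proof cases
      case 1 then show ?thesis using *(3)[of "A ! n"] by (auto simp: *(1) nth_append)
    next
      case 3
      then have "n - Suc ?d < length M" by auto
      moreover from this 3 have "euler p t ! n = M ! (n - Suc ?d)"
        unfolding *(1) by (auto simp: nth_append nth_Cons')
      ultimately show ?thesis using 3 *(2)[of "M ! (n - Suc ?d)"] by auto
    next
      case 5
      then have "n - Suc ?u < length C" using n by (auto simp: *(1))
      moreover from this 5 have "euler p t ! n = C ! (n - Suc ?u)"
        unfolding *(1) by (auto simp: nth_append nth_Cons')
      ultimately show ?thesis using 5 *(3)[of "C ! (n - Suc ?u)"] by auto
    qed (auto simp: *(1) nth_append)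
  qed
  then show ?thesis by (intro that[of ?d ?u]) (auto simp: *(1) nth_append)
qed

lemma length_euler_sum: "(\<Sum>n<length (euler p t). f (euler p t ! n)) =
   (\<Sum>q\<leftarrow>paths p t. f (Open, q) + f (Visit, q) + f (Close, q) :: nat)"
proof -
  have "(\<Sum>n<length (euler p t). f (euler p t ! n)) = (\<Sum>x\<leftarrow>euler p t. f x)"
    by (simp add: sum_list_sum_nth atLeast0LessThan)
  also have "\<dots> = (\<Sum>q\<leftarrow>paths p t. f (Open, q) + f (Visit, q) + f (Close, q))"
    by (induction p t rule: paths.induct) auto
  finally show ?thesis .
qed

section \<open>The cost of the splitting scheme\<close>

text \<open>The power 2^(m - cl) stands for 2^(-cl) and keeps the masses natural numbers.\<close>

definition items :: "nat \<Rightarrow> (nat list \<Rightarrow> nat) \<Rightarrow> (nat list \<Rightarrow> nat) \<Rightarrow> (kind \<times> nat list) list \<Rightarrow> item list" where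
  "items m cl W B = map (\<lambda>n. (n, cl (snd (B ! n)),
     if fst (B ! n) = Visit then 0 else 2 ^ (m - cl (snd (B ! n))) * W (snd (B ! n)))) [0..<length B]"

definition served :: "nat \<Rightarrow> nat \<Rightarrow> item list \<Rightarrow> (kind \<times> nat list) list \<Rightarrow> nat list set" where
  "served k m R B = {r. \<exists>i\<le>m. \<exists>n w. (n, 0, w) \<in> set (level k R i) \<and> n < length B \<and> B ! n = (Visit, r)}"

text \<open>All ancestors are included, since the tour has to connect the served vertices with the
  depot.\<close>

definition toured :: "nat \<Rightarrow> nat \<Rightarrow> (nat list \<Rightarrow> nat) \<Rightarrow> (nat list \<Rightarrow> nat) \<Rightarrow> tree \<Rightarrow> nat list set" where
  "toured k m cl W t = {q \<in> set (paths [] t).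
     \<exists>r\<in>served k m (items m cl W (euler [] t)) (euler [] t). suffix q r}"

text \<open>If the items of the level at which \<open>q\<close> is visited reach beyond one end of the span of \<open>q\<close>, then they
  contain the bracket at this end uncut, and it pays for the edge above \<open>q\<close>. Otherwise the items of this
  and of all later levels lie within the span of \<open>q\<close>, and all such \<open>q\<close> lie on a single path.\<close>

theorem toured_cost:
  assumes dist: "distinct (names t)" and clm: "\<And>q. q \<in> set (paths [] t) \<Longrightarrow> cl q \<le> m"
    and mono: "\<And>q r. q \<in> set (paths [] t) \<Longrightarrow> r \<in> set (paths [] t) \<Longrightarrow> suffix q r \<Longrightarrow> cl q \<le> cl r"
  shows "\<exists>z. (z = [] \<or> z \<in> set (paths [] t)) \<and>
    2 ^ m * (\<Sum>q\<in>toured k m cl W t. W q) \<le>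
      (\<Sum>q\<leftarrow>paths [] t. 2 * 2 ^ (m - cl q) * W q) + 2 ^ m * (\<Sum>q\<in>{q \<in> set (paths [] t). suffix q z}. W q)"
proof -
  define B where "B = euler [] t"
  define P where "P = set (paths [] t)"
  define c where "c n = cl (snd (B ! n))" for n
  define F where "F n = (if fst (B ! n) = Visit then 0 else 2 ^ (m - c n) * W (snd (B ! n)))" for n
  define R where "R = items m cl W B"
  define X where "X = toured k m cl W t"
  have R: "R = map (\<lambda>n. (n, c n, F n)) [0..<length B]" by (simp add: R_def items_def c_def F_def)
  have inv0: "level_inv (length B) c F 0 R" unfolding R by (rule level_inv_init)
  note inv = level_inv_level[OF inv0]
  have "total R = (\<Sum>n<length B. F n)"
    by (simp add: total_def R o_def sum_list_sum_nth atLeast0LessThan)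
  also have "\<dots> = (\<Sum>q\<leftarrow>paths [] t. 2 * 2 ^ (m - cl q) * W q)"
    using length_euler_sum[of "\<lambda>x. if fst x = Visit then 0 else 2 ^ (m - cl (snd x)) * W (snd x)" "[]" t]
    by (simp add: F_def c_def B_def mult_2 algebra_simps cong: if_cong)
  finally have totR: "total R = (\<Sum>q\<leftarrow>paths [] t. 2 * 2 ^ (m - cl q) * W q)" .
  have "\<forall>q\<in>P. \<exists>du. fst du < snd du \<and> snd du < length B \<and> B ! fst du = (Open, q) \<and> B ! snd du = (Close, q) \<and>
    (\<forall>n<length B. suffix q (snd (B ! n)) \<longleftrightarrow> fst du \<le> n \<and> n \<le> snd du)"
  proof
    fix q assume "q \<in> P"
    then obtain d u where "d < u" "u < length B" "B ! d = (Open, q)" "B ! u = (Close, q)"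
    "\<And>n. n < length B \<Longrightarrow> suffix q (snd (B ! n)) \<longleftrightarrow> d \<le> n \<and> n \<le> u"
      using euler_span_nth[OF dist, of q "[]"] unfolding B_def P_def by blast
    then show "\<exists>du. fst du < snd du \<and> snd du < length B \<and> B ! fst du = (Open, q) \<and> B ! snd du = (Close, q) \<and>
      (\<forall>n<length B. suffix q (snd (B ! n)) \<longleftrightarrow> fst du \<le> n \<and> n \<le> snd du)"
      by (intro exI[of _ "(d, u)"]) auto
  qed
  from bchoice[OF this] obtain du where du: "\<And>q. q \<in> P \<Longrightarrow> fst (du q) < snd (du q)"
    "\<And>q. q \<in> P \<Longrightarrow> snd (du q) < length B" "\<And>q. q \<in> P \<Longrightarrow> B ! fst (du q) = (Open, q)"
    "\<And>q. q \<in> P \<Longrightarrow> B ! snd (du q) = (Close, q)"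
    "\<And>q n. q \<in> P \<Longrightarrow> n < length B \<Longrightarrow> suffix q (snd (B ! n)) \<longleftrightarrow> fst (du q) \<le> n \<and> n \<le> snd (du q)"
    by blast
  define d where "d q = fst (du q)" for q
  define u where "u q = snd (du q)" for q
  note du = du[folded d_def u_def]
  define ids where "ids i = fst ` set (level k R i)" for i
  have XP: "X \<subseteq> P" by (auto simp: X_def toured_def P_def)
  have finX: "finite X" using XP P_def finite_subset by blast
  \<comment> \<open>The marker that brings \<open>q\<close> into the tour. Classes do not decrease
    downwards, so it is present at the level of \<open>q\<close> already, strictly inside the span
    of \<open>q\<close>.\<close>
  have wit: "\<exists>s r. s \<in> ids (cl q) \<and> d q < s \<and> s < u q \<and> suffix q r \<and> snd (B ! s) = r \<and> s < length B \<and>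
       (\<forall>j\<le>cl r. s \<in> ids j) \<and> r \<in> P" if "q \<in> X" for q
  proof -
    from that obtain r i s w where *: "suffix q r" "(s, 0, w) \<in> set (level k R i)" "s < length B" "B ! s = (Visit, r)"
      by (auto simp: X_def toured_def served_def B_def R_def)
    have q: "q \<in> P" using that XP by auto
    have "c s = i" using level_invD(1)[OF inv *(2)] by simp
    then have i: "i = cl r" using * by (simp add: c_def)
    have "snd (B ! s) \<in> snd ` set (euler [] t)" unfolding B_def[symmetric] using *(3) by simp
    then have r: "r \<in> P" unfolding P_def using snd_euler *(4) by simp
    have "cl q \<le> i" unfolding i using mono q r * by (simp add: P_def)
    moreover have "s \<in> ids i" using *(2) unfolding ids_def by force
    ultimately have ids: "\<forall>j\<le>i. s \<in> ids j" using level_ids[of _ i k R] unfolding ids_def by blast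
    have "d q \<le> s" "s \<le> u q" using du(5)[OF q *(3)] * by auto
    moreover have "s \<noteq> d q" "s \<noteq> u q" using du(3,4)[OF q] * by auto
    ultimately show ?thesis using ids * r i \<open>cl q \<le> i\<close> by auto
  qed
  define X1 where "X1 = {q \<in> X. \<exists>a\<in>ids (cl q). a < d q}"
  define X2 where "X2 = {q \<in> X. \<not> (\<exists>a\<in>ids (cl q). a < d q) \<and> (\<exists>a\<in>ids (cl q). u q < a)}"
  define X3 where "X3 = {q \<in> X. \<forall>a\<in>ids (cl q). d q \<le> a \<and> a \<le> u q}"
  have Xeq: "X = X1 \<union> X2 \<union> X3" by (auto simp: X1_def X2_def X3_def not_less)
  \<comment> \<open>At the level of its class a bracket has the mass 2^cl * 2^(m - cl) * W = 2^m *
    W.\<close>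
  have cd: "c (d q) = cl q" "2 ^ c (d q) * F (d q) = 2 ^ m * W q"
    and cu: "c (u q) = cl q" "2 ^ c (u q) * F (u q) = 2 ^ m * W q" if "q \<in> P" for q
    using du(3,4)[OF that] clm[of q] that by (auto simp: c_def F_def P_def mult.assoc[symmetric] power_add[symmetric])
  \<comment> \<open>The opening bracket lies strictly between \<open>a\<close> and the marker, so
    \<open>level_inv\<close> yields it uncut; likewise for the closing bracket in
    \<open>p2\<close>.\<close>
  have p1: "(d q, 0, 2 ^ c (d q) * F (d q)) \<in> set (level k R (c (d q)))" if "q \<in> X1" for q
  proof -
    have q: "q \<in> P" using that XP by (auto simp: X1_def)
    from that obtain a where "a \<in> ids (cl q)" "a < d q" by (auto simp: X1_def)
    moreover from that wit[of q] obtain s where "s \<in> ids (cl q)" "d q < s" by (auto simp: X1_def)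
    ultimately have "(d q, c (d q) - cl q, 2 ^ cl q * F (d q)) \<in> set (level k R (cl q))"
      using level_invD(3)[OF inv, of a k "cl q" s "d q"] cd(1)[OF q] by (auto simp: ids_def)
    then show ?thesis by (simp add: cd(1)[OF q])
  qed
  have p2: "(u q, 0, 2 ^ c (u q) * F (u q)) \<in> set (level k R (c (u q)))" if "q \<in> X2" for q
  proof -
    have q: "q \<in> P" using that XP by (auto simp: X2_def)
    from that obtain a where "a \<in> ids (cl q)" "u q < a" by (auto simp: X2_def)
    moreover from that wit[of q] obtain s where "s \<in> ids (cl q)" "s < u q" by (auto simp: X2_def)
    ultimately have "(u q, c (u q) - cl q, 2 ^ cl q * F (u q)) \<in> set (level k R (cl q))"
      using level_invD(3)[OF inv, of s k "cl q" a "u q"] cu(1)[OF q] by (auto simp: ids_def)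
    then show ?thesis by (simp add: cu(1)[OF q])
  qed
  have fin: "finite X1" "finite X2" "finite X3" using finX by (auto simp: X1_def X2_def X3_def)
  have sub: "X1 \<subseteq> P" "X2 \<subseteq> P" "X3 \<subseteq> P" using XP by (auto simp: X1_def X2_def X3_def)
  \<comment> \<open>No bracket pays for two vertices.\<close>
  have inj: "inj_on d X1" "inj_on u X2"
    using du(3,4) sub by (auto simp: inj_on_def) (metis prod.inject subsetD)+
  have disj: "d ` X1 \<inter> u ` X2 = {}"
    using du(3,4) sub by (auto) (metis kind.distinct(3) prod.inject subsetD)
  have "2 ^ m * (\<Sum>q\<in>X1 \<union> X2. W q) = (\<Sum>q\<in>X1. 2 ^ c (d q) * F (d q)) + (\<Sum>q\<in>X2. 2 ^ c (u q) * F (u q))"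
  proof -
    have "X1 \<inter> X2 = {}" by (auto simp: X1_def X2_def)
    then have "2 ^ m * (\<Sum>q\<in>X1 \<union> X2. W q) = (\<Sum>q\<in>X1. 2 ^ m * W q) + (\<Sum>q\<in>X2. 2 ^ m * W q)"
      using fin by (simp add: sum.union_disjoint sum_distrib_left distrib_left)
    also have "\<dots> = (\<Sum>q\<in>X1. 2 ^ c (d q) * F (d q)) + (\<Sum>q\<in>X2. 2 ^ c (u q) * F (u q))"
      using cd(2) cu(2) sub by (intro arg_cong2[of _ _ _ _ "(+)"] sum.cong) auto
    finally show ?thesis .
  qed
  also have "\<dots> = (\<Sum>n\<in>d ` X1 \<union> u ` X2. 2 ^ c n * F n)"
    using fin disj inj by (simp add: sum.union_disjoint sum.reindex)
  also have "\<dots> \<le> total R"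
    by (rule fully_paid[OF inv0]) (use fin p1 p2 in auto)
  finally have 1: "2 ^ m * (\<Sum>q\<in>X1 \<union> X2. W q) \<le> total R" .
  \<comment> \<open>The marker below \<open>q'\<close> is also present at the level of
    \<open>q\<close>, which is not later, and there all items lie in the span of \<open>q\<close>.
    So \<open>q\<close> and \<open>q'\<close> are ancestors of the same vertex.\<close>
  have comp: "suffix q q' \<or> suffix q' q" if qq: "q \<in> X3" "q' \<in> X3" "cl q \<le> cl q'" for q q'
  proof -
    from qq wit[of q'] obtain s r where *: "s \<in> ids (cl q')" "suffix q' r" "snd (B ! s) = r" "s < length B"
      "\<forall>j\<le>cl r. s \<in> ids j" "r \<in> P" by (auto simp: X3_def)
    have "cl q' \<le> cl r" using mono qq(2) sub * by (auto simp: P_def)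
    then have "s \<in> ids (cl q)" using * qq(3) by auto
    then have "suffix q r" using du(5)[of q s] qq(1) sub * by (auto simp: X3_def)
    with * show ?thesis using suffix_same_cases by blast
  qed
  have "\<exists>z. (z = [] \<or> z \<in> P) \<and> X3 \<subseteq> {q \<in> P. suffix q z}"
  proof (cases "X3 = {}")
    case False
    have "Max (length ` X3) \<in> length ` X3" using fin(3) False by (intro Max_in) auto
    then obtain z where z: "z \<in> X3" "length z = Max (length ` X3)" by auto
    have "suffix q z" if "q \<in> X3" for q
    proof -
      have "length q \<le> length z" using fin(3) that z(2) by simp
      moreover have "suffix q z \<or> suffix z q" using comp[OF that z(1)] comp[OF z(1) that] by linarith
      ultimately show ?thesis by (auto simp: suffix_def)
    qed
    with z sub show ?thesis by (intro exI[of _ z]) auto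
  qed auto
  then obtain z where z: "z = [] \<or> z \<in> P" "X3 \<subseteq> {q \<in> P. suffix q z}" by blast
  have "(\<Sum>q\<in>X. W q) \<le> (\<Sum>q\<in>X1 \<union> X2. W q) + (\<Sum>q\<in>X3. W q)"
    unfolding Xeq using fin by (subst sum_Un_nat) auto
  also have "(\<Sum>q\<in>X3. W q) \<le> (\<Sum>q\<in>{q \<in> P. suffix q z}. W q)"
    by (rule sum_mono2) (use z in \<open>auto simp: P_def\<close>)
  finally have "2 ^ m * (\<Sum>q\<in>X. W q) \<le> 2 ^ m * ((\<Sum>q\<in>X1 \<union> X2. W q) + (\<Sum>q\<in>{q \<in> P. suffix q z}. W q))"
    by simp
  also have "\<dots> \<le> total R + 2 ^ m * (\<Sum>q\<in>{q \<in> P. suffix q z}. W q)"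
    using 1 by (simp add: distrib_left)
  finally show ?thesis using z(1) unfolding totR X_def P_def by blast
qed

text \<open>The marker of \<open>q\<close> has mass 0 and class \<open>cl q\<close>, so
  \<open>weightless_served\<close> applies to it.\<close>

lemma visited_regularly:
  assumes "q \<in> set (paths [] t)" "cl q \<le> m"
  shows "\<exists>r<2 ^ cl q. \<forall>k. k mod 2 ^ cl q = r \<longrightarrow> q \<in> toured k m cl W t"
proof -
  let ?B = "euler [] t" and ?R = "items m cl W (euler [] t)"
  from visit_in_euler[OF assms(1)] obtain n where n: "n < length ?B" "?B ! n = (Visit, q)"
    by (auto simp: in_set_conv_nth)
  then have "(n, cl q, 0) \<in> set ?R" by (auto simp: items_def image_iff)
  from weightless_served[OF this] obtain r where r: "r < 2 ^ cl q"
    "\<And>k. k mod 2 ^ cl q = r \<Longrightarrow> (n, 0, 0) \<in> set (level k ?R (cl q))" by blast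
  have "q \<in> toured k m cl W t" if "k mod 2 ^ cl q = r" for k
  proof -
    from r(2)[OF that] have "q \<in> served k m ?R ?B" using n assms(2) unfolding served_def by blast
    then show ?thesis using assms(1) by (auto simp: toured_def)
  qed
  with r(1) show ?thesis by blast
qed

text \<open>The levels up to \<open>m\<close> read only the \<open>m\<close> lowest digits of the
  day.\<close>

lemma toured_periodic: "toured (k + 2 ^ m) m cl W t = toured k m cl W t"
proof -
  have "level (k + 2 ^ m) R i = level k R i" if "i \<le> m" for R i and m k :: nat
    using that
  proof (induction i arbitrary: m k R)
    case (Suc i)
    then obtain m' where m: "m = Suc m'" by (cases m) auto
    then have "(k + 2 ^ m) div 2 = k div 2 + 2 ^ m'" "odd (k + 2 ^ m) = odd k" by auto
    then show ?case using Suc.IH[of m' "k div 2" "half (odd k) R"] Suc.prems m by (simp del: power_Suc)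
  qed simp
  then have "served (k + 2 ^ m) m R B = served k m R B" for R B
    unfolding served_def by (intro Collect_cong ex_cong1 conj_cong refl) simp
  then show ?thesis by (simp add: toured_def)
qed

section \<open>Trees and tours\<close>

text \<open>The default 0 is the depot, the parent of every vertex whose path has length
  one.\<close>

definition up :: "nat list \<Rightarrow> nat" where "up q = hd (tl q @ [0])"

definition pedge :: "nat list \<Rightarrow> nat set" where "pedge q = {hd q, up q}"

lemma up_Cons [simp]: "up (v # p) = hd (p @ [0])" by (simp add: up_def)

definition span_tour :: "nat list set \<Rightarrow> (kind \<times> nat list) list \<Rightarrow> nat list" where
  "span_tour X B = concat (map (\<lambda>(k, q). if k = Visit \<or> q \<notin> X then [] else [if k = Open then hd q else up q]) B)"

lemma span_tour_simps [simp]: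
  "span_tour X [] = []"
  "span_tour X ((Visit, q) # B) = span_tour X B"
  "span_tour X ((Open, q) # B) = (if q \<in> X then hd q # span_tour X B else span_tour X B)"
  "span_tour X ((Close, q) # B) = (if q \<in> X then up q # span_tour X B else span_tour X B)"
  "span_tour X (B @ C) = span_tour X B @ span_tour X C"
  by (auto simp: span_tour_def)

lemma walk_length_single [simp]: "walk_length I [u] = 0"
  by (simp add: walk_length_def)

lemma walk_length_Cons [simp]: "walk_length I (u # v # w) = of_rat (weight I {u, v}) + walk_length I (v # w)"
  by (simp add: walk_length_def)

lemma walk_length_append:
  "w \<noteq> [] \<Longrightarrow> walk_length I (w @ v # w') = walk_length I w + of_rat (weight I {last w, v}) + walk_length I (v # w')"
proof (induction w rule: induct_list012)
  case (3 x y zs)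
  then show ?case by (cases zs) auto
qed auto

text \<open>A depth-first walk uses the edge above each vertex of \<open>X\<close> once downwards
  and once upwards. Closure under ancestors guarantees that nothing of \<open>X\<close> lies below a
  skipped vertex, so the walk never jumps.\<close>

lemma span_tour_props:
  fixes I :: rftt
  assumes "\<And>q. q \<in> set (paths p t) \<Longrightarrow> pedge q \<in> edges I"
    and "\<And>q r. q \<in> set (paths p t) \<Longrightarrow> r \<in> set (paths p t) \<Longrightarrow> r \<in> X \<Longrightarrow> suffix q r \<Longrightarrow> q \<in> X"
  defines "a \<equiv> hd (p @ [0])" and "L \<equiv> span_tour X (euler p t)"
  shows "last (a # L) = a \<and> successively (\<lambda>u v. {u, v} \<in> edges I) (a # L) \<and>
    walk_length I (a # L) = (\<Sum>q\<leftarrow>paths p t. if q \<in> X then 2 * of_rat (weight I (pedge q)) else 0) \<and>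
    set L \<subseteq> insert a (set (names t)) \<and> hd ` (X \<inter> set (paths p t)) \<subseteq> set L"
  using assms(1,2) unfolding a_def L_def
proof (induction p t rule: paths.induct)
  case (2 p v c s)
  let ?a = "hd (p @ [0])" and ?Lc = "span_tour X (euler (v # p) c)" and ?Ls = "span_tour X (euler p s)"
  have es: "pedge q \<in> edges I" if "q \<in> set (paths p s)" for q using 2(3) that by simp
  have ec: "pedge q \<in> edges I" if "q \<in> set (paths (v # p) c)" for q using 2(3) that by simp
  have cs: "q \<in> X" if "q \<in> set (paths p s)" "r \<in> set (paths p s)" "r \<in> X" "suffix q r" for q r
    using 2(4)[of q r] that by simp
  have cc: "q \<in> X" if "q \<in> set (paths (v # p) c)" "r \<in> set (paths (v # p) c)" "r \<in> X" "suffix q r" for q r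
    using 2(4)[of q r] that by simp
  have "last (?a # ?Ls) = ?a \<and> successively (\<lambda>u v. {u, v} \<in> edges I) (?a # ?Ls) \<and>
    walk_length I (?a # ?Ls) = (\<Sum>q\<leftarrow>paths p s. if q \<in> X then 2 * of_rat (weight I (pedge q)) else 0) \<and>
    set ?Ls \<subseteq> insert ?a (set (names s)) \<and> hd ` (X \<inter> set (paths p s)) \<subseteq> set ?Ls"
    by (rule "2.IH"(2)) (fact es, fact cs)
  note Is = conjunct1[OF this] conjunct1[OF conjunct2[OF this]] conjunct1[OF conjunct2[OF conjunct2[OF this]]]
    conjunct1[OF conjunct2[OF conjunct2[OF conjunct2[OF this]]]] conjunct2[OF conjunct2[OF conjunct2[OF conjunct2[OF this]]]]
  have "last (v # ?Lc) = v \<and> successively (\<lambda>u v. {u, v} \<in> edges I) (v # ?Lc) \<and>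
    walk_length I (v # ?Lc) = (\<Sum>q\<leftarrow>paths (v # p) c. if q \<in> X then 2 * of_rat (weight I (pedge q)) else 0) \<and>
    set ?Lc \<subseteq> insert v (set (names c)) \<and> hd ` (X \<inter> set (paths (v # p) c)) \<subseteq> set ?Lc"
    using "2.IH"(1)[unfolded append_Cons list.sel(1)] ec cc by blast
  note Ic = conjunct1[OF this] conjunct1[OF conjunct2[OF this]] conjunct1[OF conjunct2[OF conjunct2[OF this]]]
    conjunct1[OF conjunct2[OF conjunct2[OF conjunct2[OF this]]]] conjunct2[OF conjunct2[OF conjunct2[OF conjunct2[OF this]]]]
  have e: "{?a, v} \<in> edges I" "pedge (v # p) = {?a, v}" using 2(3)[of "v # p"] by (auto simp: pedge_def insert_commute)
  show ?case
  proof (cases "v # p \<in> X")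
    case True
    have "?a # span_tour X (euler p (Br v c s)) = ?a # (v # ?Lc) @ ?a # ?Ls" using True by simp
    moreover have "walk_length I (?a # (v # ?Lc) @ ?a # ?Ls) =
      of_rat (weight I {?a, v}) + walk_length I (v # ?Lc) + of_rat (weight I {v, ?a}) + walk_length I (?a # ?Ls)"
      using walk_length_append[of "v # ?Lc" I ?a ?Ls] Ic(1) by simp
    moreover have "successively (\<lambda>u v. {u, v} \<in> edges I) ((v # ?Lc) @ ?a # ?Ls)"
      unfolding successively_append_iff using Ic(1,2) Is(2) e(1) by (simp add: insert_commute)
    then have "successively (\<lambda>u v. {u, v} \<in> edges I) (?a # (v # ?Lc) @ ?a # ?Ls)" using e(1) by simp
    ultimately show ?thesis
      using Is(1,3,4,5) Ic(3,4,5) True e(2) by (auto simp: insert_commute)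
  next
    case False
    have no: "q \<notin> X" if "q \<in> set (paths (v # p) c)" for q
      using 2(4)[of "v # p" q] False that paths_extend[OF that] by (auto simp: suffix_def)
    have "span_tour X E = []" if "snd ` set E \<inter> X = {}" for E
      using that by (force simp: span_tour_def)
    then have "?Lc = []" using no snd_euler[of "v # p" c] by auto
    moreover have "(\<Sum>q\<leftarrow>paths (v # p) c. if q \<in> X then 2 * of_rat (weight I (pedge q)) else 0) = (0 :: real)"
      using no by (simp add: map_idI cong: map_cong)
    ultimately show ?thesis using Is False no by auto
  qed
qed auto

section \<open>Tree paths, and lower bounds for feasible solutions\<close>

lemma paths_nonempty: "q \<in> set (paths p t) \<Longrightarrow> q \<noteq> []"
  using paths_extend by fastforce

lemma tl_path: "q \<in> set (paths p t) \<Longrightarrow> tl q = p \<or> tl q \<in> set (paths p t)"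
  by (induction p t rule: paths.induct) auto

lemma distinct_paths: "distinct (names t) \<Longrightarrow> distinct (paths p t)"
  by (metis map_hd_paths distinct_map)

lemma hd_path_inj: "distinct (names t) \<Longrightarrow> q \<in> set (paths p t) \<Longrightarrow> r \<in> set (paths p t) \<Longrightarrow> hd q = hd r \<Longrightarrow> q = r"
  by (metis map_hd_paths distinct_map inj_onD)

lemma suffix_path: "r \<in> set (paths [] t) \<Longrightarrow> suffix q r \<Longrightarrow> q \<noteq> [] \<Longrightarrow> q \<in> set (paths [] t)"
proof (induction r)
  case (Cons v r)
  show ?case
  proof (cases "q = v # r")
    case False
    then have s: "suffix q r" using Cons.prems(2) by (simp add: suffix_Cons)
    with Cons.prems(3) have "r \<noteq> []" by auto
    then show ?thesis using Cons.IH[OF _ s] tl_path[OF Cons.prems(1)] Cons.prems(3) by auto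
  qed (use Cons in simp)
qed simp

lemma enters:
  "w \<noteq> [] \<Longrightarrow> hd w \<notin> D \<Longrightarrow> x \<in> set w \<Longrightarrow> x \<in> D \<Longrightarrow> \<exists>u v. (u, v) \<in> set (zip w (tl w)) \<and> u \<notin> D \<and> v \<in> D"
proof (induction w rule: induct_list012)
  case (3 y z zs)
  then show ?case by (cases "z \<in> D") auto
qed auto

lemma leaves:
  "w \<noteq> [] \<Longrightarrow> last w \<notin> D \<Longrightarrow> x \<in> set w \<Longrightarrow> x \<in> D \<Longrightarrow> \<exists>u v. (u, v) \<in> set (zip w (tl w)) \<and> u \<in> D \<and> v \<notin> D"
proof (induction w arbitrary: x rule: induct_list012)
  case (3 y z zs)
  show ?case
  proof (cases "x = y \<and> z \<notin> D")
    case True with 3 show ?thesis by auto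
  next
    case False
    with 3 obtain x' where "x' \<in> set (z # zs)" "x' \<in> D" by auto
    with 3(2)[of x'] 3(4) obtain u v where "(u, v) \<in> set (zip (z # zs) (tl (z # zs)))" "u \<in> D" "v \<notin> D" by auto
    then show ?thesis by (intro exI[of _ u] exI[of _ v]) auto
  qed
qed auto

lemma successively_zip: "successively R w \<Longrightarrow> (u, v) \<in> set (zip w (tl w)) \<Longrightarrow> R u v"
  by (induction w rule: induct_list012) auto

definition spanning :: "rftt \<Rightarrow> tree \<Rightarrow> bool" where
  "spanning I t \<longleftrightarrow> distinct (names t) \<and> set (names t) = clients I \<and> edges I = pedge ` set (paths [] t)"

definition below :: "tree \<Rightarrow> nat list \<Rightarrow> nat set" where
  "below t q = hd ` {r \<in> set (paths [] t). suffix q r}"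

lemma zero_not_client: "0 \<notin> clients I" by (simp add: clients_def)

lemma hd_path_client: "spanning I t \<Longrightarrow> q \<in> set (paths [] t) \<Longrightarrow> hd q \<in> clients I"
  by (metis spanning_def map_hd_paths image_eqI list.set_map)

lemma below_client: "spanning I t \<Longrightarrow> below t q \<subseteq> clients I"
  using hd_path_client by (auto simp: below_def)

lemma up_cases: "q \<in> set (paths [] t) \<Longrightarrow> (tl q = [] \<and> up q = 0) \<or> (tl q \<in> set (paths [] t) \<and> up q = hd (tl q))"
  using tl_path[of q "[]" t] by (cases "tl q") (auto simp: up_def)

text \<open>If two vertices shared the edge above them, each would be the parent of the other, and
  each path shorter than the other.\<close>

lemma pedge_inj:
  assumes sp: "spanning I t" and q: "q \<in> set (paths [] t)" and r: "r \<in> set (paths [] t)" and e: "pedge q = pedge r"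
  shows "q = r"
proof -
  have d: "distinct (names t)" using sp by (simp add: spanning_def)
  have "hd q = hd r"
  proof (rule ccontr)
    assume "hd q \<noteq> hd r"
    then have "hd q = up r" "hd r = up q" using e unfolding pedge_def by (metis doubleton_eq_iff)+
    moreover have "hd q \<noteq> 0" "hd r \<noteq> 0" using hd_path_client[OF sp] q r zero_not_client by metis+
    ultimately have "tl r \<in> set (paths [] t)" "hd q = hd (tl r)" "tl q \<in> set (paths [] t)" "hd r = hd (tl q)"
      using up_cases[OF q] up_cases[OF r] by auto
    then have "q = tl r" "r = tl q" using hd_path_inj[OF d] q r by blast+
    then have "length q \<le> length r - 1" "length r \<le> length q - 1" by (metis length_tl order_refl)+
    then show False using paths_nonempty[OF q] paths_nonempty[OF r] by (cases q; cases r) auto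
  qed
  then show ?thesis using hd_path_inj[OF d q r] by blast
qed

text \<open>The edge lies above some \<open>r\<close>. If \<open>r\<close> were a proper descendant
  of \<open>q\<close>, or the parent of \<open>r\<close> below \<open>q\<close>, both ends would be
  below \<open>q\<close>; so \<open>r = q\<close>.\<close>

lemma crossing_edge:
  assumes sp: "spanning I t" and q: "q \<in> set (paths [] t)" and e: "{u, v} \<in> edges I"
    and uv: "u \<in> below t q" "v \<notin> below t q"
  shows "pedge q = {u, v}"
proof -
  have d: "distinct (names t)" using sp by (simp add: spanning_def)
  from e sp obtain r where r: "r \<in> set (paths [] t)" "pedge r = {u, v}" unfolding spanning_def by auto
  have below: "suffix q r'" if "r' \<in> set (paths [] t)" "hd r' \<in> below t q" for r'
    using that hd_path_inj[OF d] unfolding below_def by blast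
  have qne: "q \<noteq> []" by (rule paths_nonempty[OF q])
  consider "hd r = u" "up r = v" | "hd r = v" "up r = u" using r(2) unfolding pedge_def by (metis doubleton_eq_iff)
  then show ?thesis
  proof cases
    case 1
    then have s: "suffix q r" using below[OF r(1)] uv by simp
    have "r = q"
    proof (rule ccontr)
      assume "r \<noteq> q"
      with s have s': "suffix q (tl r)" by (cases r) (auto simp: suffix_Cons)
      with qne have "tl r \<noteq> []" by auto
      with up_cases[OF r(1)] have "tl r \<in> set (paths [] t)" "up r = hd (tl r)" by auto
      with s' have "v \<in> below t q" using 1 by (auto simp: below_def)
      with uv show False by simp
    qed
    with r show ?thesis by simp
  next
    case 2
    have "u \<noteq> 0" using subsetD[OF below_client[OF sp] uv(1)] by (auto simp: clients_def)
    with 2 up_cases[OF r(1)] have *: "tl r \<in> set (paths [] t)" "hd (tl r) = u" by auto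
    then have "suffix q (tl r)" using below uv by simp
    then have "suffix q r" using paths_nonempty[OF r(1)] by (cases r) (auto simp: suffix_Cons)
    then have "v \<in> below t q" using r(1) 2 by (auto simp: below_def)
    with uv show ?thesis by simp
  qed
qed

text \<open>A closed walk through the depot crosses the edge above a vertex below which it visits a client
  at least once in each direction.\<close>

lemma closed_walk_length:
  assumes sp: "spanning I t" and inst: "rftt_instance I"
    and w: "is_walk I w" "hd w = 0" "last w = 0"
  shows "(\<Sum>q\<in>{q \<in> set (paths [] t). set w \<inter> below t q \<noteq> {}}. 2 * of_rat (weight I (pedge q))) \<le> walk_length I w"
proof -
  define P where "P = set (paths [] t)"
  define Z where "Z = zip w (tl w)"
  define c where "c q = (of_rat (weight I (pedge q)) :: real)" for q
  define cnt where "cnt q = length (filter (\<lambda>(u, v). pedge q = {u, v}) Z)" for q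
  have fin: "finite P" by (simp add: P_def)
  have wne: "w \<noteq> []" and suc: "successively (\<lambda>u v. {u, v} \<in> edges I) w" using w by (auto simp: is_walk_def)
  have edge: "{u, v} \<in> edges I" if "(u, v) \<in> set Z" for u v
    using successively_zip[OF suc] that by (simp add: Z_def)
  have c0: "c q \<ge> 0" if "q \<in> P" for q
  proof -
    have "pedge q \<in> edges I" using sp that by (auto simp: spanning_def P_def)
    then show ?thesis using inst by (auto simp: c_def rftt_instance_def)
  qed
  \<comment> \<open>Every step of the walk is charged to the unique tree edge that it uses.\<close>
  have one: "(of_rat (weight I {u, v}) :: real) = (\<Sum>q\<in>P. if pedge q = {u, v} then c q else 0)"
    if "(u, v) \<in> set Z" for u v
  proof -
    from edge[OF that] sp obtain r where r: "r \<in> P" "pedge r = {u, v}" by (auto simp: spanning_def P_def)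
    have "(\<Sum>q\<in>P. if pedge q = {u, v} then c q else 0) = (\<Sum>q\<in>P. if q = r then c q else 0)"
      using r pedge_inj[OF sp] by (intro sum.cong) (auto simp: P_def)
    also have "\<dots> = of_rat (weight I {u, v})" using r fin by (simp add: c_def)
    finally show ?thesis by simp
  qed
  have "walk_length I w = (\<Sum>(u, v)\<leftarrow>Z. \<Sum>q\<in>P. if pedge q = {u, v} then c q else 0)"
    unfolding walk_length_def Z_def[symmetric] using one by (intro arg_cong[of _ _ sum_list] map_cong) auto
  also have "\<dots> = (\<Sum>q\<in>P. \<Sum>(u, v)\<leftarrow>Z. if pedge q = {u, v} then c q else 0)"
    by (induction Z) (auto simp: sum.distrib)
  also have "\<dots> = (\<Sum>q\<in>P. c q * real (cnt q))"
  proof (rule sum.cong)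
    fix q
    show "(\<Sum>(u, v)\<leftarrow>Z. if pedge q = {u, v} then c q else 0) = c q * real (cnt q)"
      unfolding cnt_def by (induction Z) (auto simp: algebra_simps split: if_splits)
  qed simp
  finally have wl: "walk_length I w = (\<Sum>q\<in>P. c q * real (cnt q))" .
  have two: "2 \<le> cnt q" if q: "q \<in> P" and hit: "set w \<inter> below t q \<noteq> {}" for q
  proof -
    have q': "q \<in> set (paths [] t)" using q by (simp add: P_def)
    have z: "0 \<notin> below t q" using below_client[OF sp] zero_not_client by blast
    from hit obtain x where x: "x \<in> set w" "x \<in> below t q" by blast
    from enters[OF wne _ x] w(2) z obtain u v where 1: "(u, v) \<in> set Z" "u \<notin> below t q" "v \<in> below t q"
      by (auto simp: Z_def)
    from leaves[OF wne _ x] w(3) z obtain u' v' where 2: "(u', v') \<in> set Z" "u' \<in> below t q" "v' \<notin> below t q"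
      by (auto simp: Z_def)
    have "pedge q = {v, u}" using crossing_edge[OF sp q' _ 1(3,2)] edge[OF 1(1)] by (simp add: insert_commute)
    moreover have "pedge q = {u', v'}" using crossing_edge[OF sp q' _ 2(2,3)] edge[OF 2(1)] by simp
    \<comment> \<open>Entering and leaving are different ordered pairs, so the steps along this edge
      form a set with at least two elements.\<close>
    ultimately have "{(u, v), (u', v')} \<subseteq> set (filter (\<lambda>(u, v). pedge q = {u, v}) Z)"
      using 1 2 by (auto simp: insert_commute)
    then have "card {(u, v), (u', v')} \<le> card (set (filter (\<lambda>(u, v). pedge q = {u, v}) Z))"
      by (intro card_mono) auto
    also have "\<dots> \<le> cnt q" unfolding cnt_def by (rule card_length)
    finally have "card {(u, v), (u', v')} \<le> cnt q" .
    moreover have "(u, v) \<noteq> (u', v')" using 1 2 by auto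
    ultimately show ?thesis by simp
  qed
  have "(\<Sum>q\<in>{q \<in> P. set w \<inter> below t q \<noteq> {}}. 2 * c q) \<le> (\<Sum>q\<in>{q \<in> P. set w \<inter> below t q \<noteq> {}}. c q * real (cnt q))"
  proof (rule sum_mono)
    fix q assume "q \<in> {q \<in> P. set w \<inter> below t q \<noteq> {}}"
    then have "2 \<le> real (cnt q)" "0 \<le> c q" using two c0 by force+
    then show "2 * c q \<le> c q * real (cnt q)" using mult_left_mono[of 2 "real (cnt q)" "c q"] by simp
  qed
  also have "\<dots> \<le> (\<Sum>q\<in>P. c q * real (cnt q))" by (rule sum_mono2) (use fin c0 in auto)
  finally show ?thesis unfolding wl by (simp add: P_def c_def)
qed

lemma periodic_finite:
  assumes "periodic S" shows "finite (S ` {1..})"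
proof -
  from assms obtain p where p: "p \<ge> 1" "\<And>k. k \<ge> 1 \<Longrightarrow> S (k + p) = S k" by (auto simp: periodic_def)
  have "S k \<in> S ` {1..p}" if "k \<ge> 1" for k
    using that
  proof (induction k rule: less_induct)
    case (less k)
    show ?case
    proof (cases "k \<le> p")
      case False
      then have "S k = S (k - p)" using p(2)[of "k - p"] by simp
      with less.IH[of "k - p"] False p(1) show ?thesis by simp
    qed (use less in simp)
  qed
  then have "S ` {1..} \<subseteq> S ` {1..p}" by auto
  then show ?thesis by (rule finite_subset) simp
qed

text \<open>Needed for \<open>Max\<close> in \<open>max_tour_length\<close> to be a genuine
  maximum.\<close>

lemma finite_tour_lengths:
  assumes "feasible I S" shows "finite ((\<lambda>k. walk_length I (tour S k)) ` {1..})"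
proof -
  have "periodic S" using assms by (simp add: feasible_def is_solution_def)
  then have "finite (S ` {1..})" by (rule periodic_finite)
  then have "finite ((\<lambda>x. walk_length I (fst x)) ` S ` {1..})" by (rule finite_imageI)
  then show ?thesis by (simp add: image_image)
qed

lemma tour_le_max: "feasible I S \<Longrightarrow> k \<ge> 1 \<Longrightarrow> walk_length I (tour S k) \<le> max_tour_length I S"
  unfolding max_tour_length_def by (rule Max_ge[OF finite_tour_lengths]) auto

lemma tour_closed_walk:
  assumes "feasible I S" "k \<ge> 1"
  shows "is_walk I (tour S k)" "hd (tour S k) = 0" "last (tour S k) = 0" "visited S k \<subseteq> set (tour S k)"
  using assms by (auto simp: feasible_def is_solution_def depot_def)

text \<open>On some day the client at the end of \<open>z\<close> is visited, and that walk uses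
  every edge on its path twice. For \<open>z = []\<close> only nonnegativity is claimed.\<close>

lemma depth_le_max_tour:
  assumes sp: "spanning I t" and inst: "rftt_instance I" and S: "feasible I S"
    and z: "z = [] \<or> z \<in> set (paths [] t)"
  shows "(\<Sum>q\<in>{q \<in> set (paths [] t). suffix q z}. 2 * of_rat (weight I (pedge q))) \<le> max_tour_length I S"
proof (cases "z = []")
  case True
  then have "{q \<in> set (paths [] t). suffix q z} = {}" using paths_nonempty by auto
  moreover have "0 \<le> walk_length I (tour S 1)"
    using closed_walk_length[OF sp inst tour_closed_walk(1,2,3)[OF S, of 1]] 
    by (rule order_trans[rotated]) (use inst sp in \<open>auto intro!: sum_nonneg simp: rftt_instance_def spanning_def\<close>)
  ultimately show ?thesis using tour_le_max[OF S order_refl] by (simp only: sum.empty)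
next
  case False
  with z have z: "z \<in> set (paths [] t)" by simp
  then have "hd z \<in> (\<Union>k\<in>{0 + 1..0 + turnover I (hd z)}. visited S k)"
    using S hd_path_client[OF sp] unfolding feasible_def by blast
  then obtain k where k: "k \<ge> 1" "hd z \<in> visited S k" by auto
  have "hd z \<in> set (tour S k)" using tour_closed_walk(4)[OF S k(1)] k(2) by blast
  then have "{q \<in> set (paths [] t). suffix q z} \<subseteq> {q \<in> set (paths [] t). set (tour S k) \<inter> below t q \<noteq> {}}"
    using z by (auto simp: below_def)
  then have "(\<Sum>q\<in>{q \<in> set (paths [] t). suffix q z}. 2 * of_rat (weight I (pedge q)) :: real)
    \<le> (\<Sum>q\<in>{q \<in> set (paths [] t). set (tour S k) \<inter> below t q \<noteq> {}}. 2 * of_rat (weight I (pedge q)))"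
    by (intro sum_mono2) (use inst sp in \<open>auto simp: rftt_instance_def spanning_def\<close>)
  also have "\<dots> \<le> walk_length I (tour S k)"
    by (rule closed_walk_length[OF sp inst tour_closed_walk(1,2,3)[OF S k(1)]])
  also have "\<dots> \<le> max_tour_length I S" by (rule tour_le_max[OF S k(1)])
  finally show ?thesis .
qed

lemma count_blocks:
  assumes "\<And>t. \<exists>k\<in>{t + 1..t + d}. Q k"
  shows "n \<le> card {k \<in> {1..n * d}. Q k}"
proof (induction n)
  case (Suc n)
  from assms[of "n * d"] obtain k where k: "k \<in> {n * d + 1..n * d + d}" "Q k" by blast
  have "Suc n \<le> card (insert k {k \<in> {1..n * d}. Q k})" using Suc k by simp
  also have "\<dots> \<le> card {k \<in> {1..Suc n * d}. Q k}" by (rule card_mono) (use k in auto)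
  finally show ?case .
qed simp

text \<open>The client \<open>hd (g q)\<close> below the edge forces two passages in every window as
  long as its turnover time. The average is taken over \<open>H\<close> days, where the product
  \<open>H\<close> is a multiple of all these turnover times, and cannot exceed the maximum.\<close>

lemma average_le_max_tour:
  assumes sp: "spanning I t" and inst: "rftt_instance I" and S: "feasible I S"
    and g: "\<And>q. q \<in> set (paths [] t) \<Longrightarrow> g q \<in> set (paths [] t) \<and> suffix q (g q)"
  shows "(\<Sum>q\<in>set (paths [] t). 2 * of_rat (weight I (pedge q)) / turnover I (hd (g q))) \<le> max_tour_length I S"
proof -
  define P where "P = set (paths [] t)"
  define c where "c q = (of_rat (weight I (pedge q)) :: real)" for q
  define \<tau> where "\<tau> q = turnover I (hd (g q))" for q
  define H where "H = (\<Prod>q\<in>P. \<tau> q)"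
  define hit where "hit q k \<longleftrightarrow> set (tour S k) \<inter> below t q \<noteq> {}" for q k
  have fin: "finite P" by (simp add: P_def)
  have client: "hd (g q) \<in> clients I" if "q \<in> P" for q using g that hd_path_client[OF sp] by (auto simp: P_def)
  have \<tau>1: "\<tau> q \<ge> 1" if "q \<in> P" for q using client[OF that] inst by (auto simp: \<tau>_def rftt_instance_def)
  have H: "H > 0" using \<tau>1 by (fastforce simp: H_def intro: prod_pos)
  have c0: "c q \<ge> 0" if "q \<in> P" for q
  proof -
    have "pedge q \<in> edges I" using sp that by (auto simp: spanning_def P_def)
    then show ?thesis using inst by (auto simp: c_def rftt_instance_def)
  qed
  have days: "real H / \<tau> q \<le> card {k \<in> {1..H}. hit q k}" if q: "q \<in> P" for q
  proof -
    have "\<exists>k\<in>{s + 1..s + \<tau> q}. hit q k" for s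
    proof -
      from S client[OF q] obtain k where k: "k \<in> {s + 1..s + \<tau> q}" "hd (g q) \<in> visited S k"
        unfolding feasible_def \<tau>_def by blast
      then have "hd (g q) \<in> set (tour S k)" using tour_closed_walk(4)[OF S, of k] by auto
      moreover have "hd (g q) \<in> below t q" using g q by (auto simp: below_def P_def)
      ultimately show ?thesis using k(1) unfolding hit_def by blast
    qed
    from count_blocks[OF this, of "H div \<tau> q"] have "H div \<tau> q \<le> card {k \<in> {1..H div \<tau> q * \<tau> q}. hit q k}" .
    moreover have dvd: "\<tau> q dvd H" unfolding H_def using fin q by (rule dvd_prodI)
    ultimately have "H div \<tau> q \<le> card {k \<in> {1..H}. hit q k}" by simp
    then show ?thesis using dvd by (metis of_nat_le_iff real_of_nat_div)
  qed
  have "real H * (\<Sum>q\<in>P. 2 * c q / \<tau> q) = (\<Sum>q\<in>P. 2 * c q * (real H / \<tau> q))"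
    by (simp add: sum_distrib_left field_simps)
  also have "\<dots> \<le> (\<Sum>q\<in>P. 2 * c q * card {k \<in> {1..H}. hit q k})"
    by (intro sum_mono mult_left_mono days) (use c0 in auto)
  also have "\<dots> = (\<Sum>q\<in>P. \<Sum>k\<in>{1..H}. if hit q k then 2 * c q else 0)"
    by (intro sum.cong refl) (simp add: sum.If_cases Int_def)
  also have "\<dots> = (\<Sum>k\<in>{1..H}. \<Sum>q\<in>P. if hit q k then 2 * c q else 0)" by (rule sum.swap)
  also have "\<dots> \<le> (\<Sum>k\<in>{1..H}. max_tour_length I S)"
  proof (rule sum_mono)
    fix k assume "k \<in> {1..H}"
    then have k: "k \<ge> 1" by simp
    have "(\<Sum>q\<in>P. if hit q k then 2 * c q else 0) = (\<Sum>q\<in>{q \<in> P. hit q k}. 2 * c q)"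
      using fin by (simp add: sum.If_cases Int_def)
    also have "\<dots> \<le> walk_length I (tour S k)"
      using closed_walk_length[OF sp inst tour_closed_walk(1,2,3)[OF S k]] by (simp add: P_def hit_def c_def)
    also have "\<dots> \<le> max_tour_length I S" by (rule tour_le_max[OF S k])
    finally show "(\<Sum>q\<in>P. if hit q k then 2 * c q else 0) \<le> max_tour_length I S" .
  qed
  also have "\<dots> = real H * max_tour_length I S" by simp
  finally have "(\<Sum>q\<in>P. 2 * c q / \<tau> q) \<le> max_tour_length I S" using H by simp
  then show ?thesis by (simp add: P_def c_def \<tau>_def)
qed

text \<open>\<open>OPT\<close> is an infimum, so a comparison with every feasible solution suffices
  and no optimal one has to be exhibited.\<close>

lemma max_tour_le_OPT:
  assumes S: "feasible I S" and le: "\<And>k S'. k \<ge> 1 \<Longrightarrow> feasible I S' \<Longrightarrow> walk_length I (tour S k) \<le> a * max_tour_length I S'"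
    and a: "a > 0"
  shows "max_tour_length I S \<le> a * OPT I"
proof -
  have "max_tour_length I S / a \<le> OPT I" unfolding OPT_def
  proof (rule cInf_greatest)
    show "{max_tour_length I S |S. feasible I S} \<noteq> {}" using S by auto
  next
    fix x assume "x \<in> {max_tour_length I S |S. feasible I S}"
    then obtain S' where S': "x = max_tour_length I S'" "feasible I S'" by auto
    have "max_tour_length I S \<le> a * x" unfolding S' max_tour_length_def[of I S]
      by (rule Max.boundedI[OF finite_tour_lengths[OF S]]) (use le S' in auto)
    then show "max_tour_length I S / a \<le> x" using a by (simp add: field_simps)
  qed
  then show ?thesis using a by (simp add: field_simps)
qed

section \<open>A spanning tree from the edge list\<close>

text \<open>The new leaf becomes the first child, because \<open>sinsert\<close> puts its brackets
  right behind the opening bracket of the parent.\<close>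

fun insert_below :: "nat \<Rightarrow> nat \<Rightarrow> tree \<Rightarrow> tree" where
  "insert_below u v Tip = Tip"
| "insert_below u v (Br a c s) = (if a = u then Br a (Br v Tip c) s
     else Br a (insert_below u v c) (insert_below u v s))"

definition attach :: "nat \<Rightarrow> nat \<Rightarrow> tree \<Rightarrow> tree" where
  "attach u v t = (if v = 0 \<or> v \<in> set (names t) then t else if u = 0 then Br v Tip t else insert_below u v t)"

definition add_edge :: "nat \<times> nat \<Rightarrow> tree \<Rightarrow> tree" where
  "add_edge e t = attach (snd e) (fst e) (attach (fst e) (snd e) t)"

definition build :: "(nat \<times> nat) list \<Rightarrow> nat \<Rightarrow> tree" where
  "build es n = ((\<lambda>t. foldr add_edge es t) ^^ n) Tip"

lemma insert_below_absent: "u \<notin> set (names t) \<Longrightarrow> insert_below u v t = t"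
  by (induction t) auto

lemma names_insert_below:
  assumes "distinct (names t)" "v \<notin> set (names t)"
  shows "set (names (insert_below u v t)) = (if u \<in> set (names t) then insert v (set (names t)) else set (names t)) \<and>
     distinct (names (insert_below u v t))"
  using assms
proof (induction t)
  case (Br a c s)
  show ?case
  proof (cases "a = u")
    case False
    show ?thesis
    proof (cases "u \<in> set (names c)")
      case True
      with Br.prems have "insert_below u v s = s" by (intro insert_below_absent) auto
      then show ?thesis using Br False True by auto
    next
      case F: False
      then have "insert_below u v c = c" by (rule insert_below_absent)
      then show ?thesis using Br False F by auto
    qed
  qed (use Br in auto)
qed simp

lemma paths_insert_below:
  "q \<in> set (paths p (insert_below u v t)) \<Longrightarrow> q \<in> set (paths p t) \<or> hd q = v \<and> up q = u"
proof (induction t arbitrary: p)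
  case (Br a c s)
  then show ?case by (cases "a = u") (auto simp: up_def)
qed simp

definition partial_tree :: "rftt \<Rightarrow> tree \<Rightarrow> bool" where
  "partial_tree I t \<longleftrightarrow> distinct (names t) \<and> set (names t) \<subseteq> clients I \<and> pedge ` set (paths [] t) \<subseteq> edges I"

lemma attach_partial:
  assumes "partial_tree I t" "{u, v} \<in> edges I" "v \<in> verts I"
  shows "partial_tree I (attach u v t)" and "set (names t) \<subseteq> set (names (attach u v t))"
    and "u = 0 \<or> u \<in> set (names t) \<Longrightarrow> v = 0 \<or> v \<in> set (names (attach u v t))"
proof -
  have d: "distinct (names t)" using assms by (simp add: partial_tree_def)
  show "partial_tree I (attach u v t)"
  proof (cases "v = 0 \<or> v \<in> set (names t) \<or> u = 0")
    case True
    then show ?thesis using assms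
      by (auto simp: attach_def partial_tree_def pedge_def verts_def depot_def insert_commute)
  next
    case False
    then have a: "attach u v t = insert_below u v t" by (simp add: attach_def)
    have "pedge q \<in> edges I" if "q \<in> set (paths [] (insert_below u v t))" for q
      using paths_insert_below[OF that] assms by (auto simp: pedge_def partial_tree_def insert_commute)
    then show ?thesis using a False names_insert_below[OF d, of v u] assms
      by (auto simp: partial_tree_def verts_def depot_def split: if_splits)
  qed
  show "set (names t) \<subseteq> set (names (attach u v t))"
    using names_insert_below[OF d, of v u] by (auto simp: attach_def)
  show "v = 0 \<or> v \<in> set (names (attach u v t))" if "u = 0 \<or> u \<in> set (names t)"
    using names_insert_below[OF d, of v u] that by (auto simp: attach_def)
qed

text \<open>The last claim describes stagnation: an edge with exactly one placed end would have
  placed the other one.\<close>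

lemma add_edge_partial:
  assumes "partial_tree I t" "{fst e, snd e} \<in> edges I" "fst e \<in> verts I" "snd e \<in> verts I"
  shows "partial_tree I (add_edge e t)" and "set (names t) \<subseteq> set (names (add_edge e t))"
    and "set (names (add_edge e t)) = set (names t) \<Longrightarrow>
      (fst e \<in> insert 0 (set (names t)) \<longleftrightarrow> snd e \<in> insert 0 (set (names t)))"
proof -
  let ?t = "attach (fst e) (snd e) t"
  note 1 = attach_partial[OF assms(1,2,4)]
  note 2 = attach_partial[OF 1(1), of "snd e" "fst e"]
  show "partial_tree I (add_edge e t)" unfolding add_edge_def
    using 2(1) assms(2,3) by (simp add: insert_commute)
  have 3: "set (names ?t) \<subseteq> set (names (add_edge e t))" unfolding add_edge_def
    using 2(2) assms(2,3) by (simp add: insert_commute)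
  with 1(2) show "set (names t) \<subseteq> set (names (add_edge e t))" by simp
  assume eq: "set (names (add_edge e t)) = set (names t)"
  with 1(2) 3 have "set (names ?t) = set (names t)" by auto
  then show "fst e \<in> insert 0 (set (names t)) \<longleftrightarrow> snd e \<in> insert 0 (set (names t))"
    using 1(3) 2(3) eq assms(2,3) unfolding add_edge_def by (auto simp: insert_commute)
qed

text \<open>If a whole pass adds nothing, all its steps meet the same vertex set, so no edge of the
  list leaves this set.\<close>

lemma pass_partial:
  assumes "partial_tree I t" "\<And>e. e \<in> set es \<Longrightarrow> {fst e, snd e} \<in> edges I \<and> fst e \<in> verts I \<and> snd e \<in> verts I"
  shows "partial_tree I (foldr add_edge es t) \<and> set (names t) \<subseteq> set (names (foldr add_edge es t)) \<and>
    (set (names (foldr add_edge es t)) = set (names t) \<longrightarrow>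
      (\<forall>e\<in>set es. fst e \<in> insert 0 (set (names t)) \<longleftrightarrow> snd e \<in> insert 0 (set (names t))))"
  using assms(2)
proof (induction es)
  case (Cons e es)
  let ?t = "foldr add_edge es t"
  have IH: "partial_tree I ?t" "set (names t) \<subseteq> set (names ?t)" 
    "set (names ?t) = set (names t) \<Longrightarrow>
      (\<forall>e\<in>set es. fst e \<in> insert 0 (set (names t)) \<longleftrightarrow> snd e \<in> insert 0 (set (names t)))"
    using Cons by auto
  have e: "{fst e, snd e} \<in> edges I" "fst e \<in> verts I" "snd e \<in> verts I" using Cons.prems by auto
  note A = add_edge_partial[OF IH(1) e]
  show ?case
  proof (intro conjI impI)
    show "partial_tree I (foldr add_edge (e # es) t)" using A(1) by simp
    show "set (names t) \<subseteq> set (names (foldr add_edge (e # es) t))" using A(2) IH(2) by auto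
    assume "set (names (foldr add_edge (e # es) t)) = set (names t)"
    then have "set (names (add_edge e ?t)) = set (names t)" by simp
    with A(2) IH(2) have "set (names ?t) = set (names t)" "set (names (add_edge e ?t)) = set (names ?t)" by auto
    then show "\<forall>e\<in>set (e # es). fst e \<in> insert 0 (set (names t)) \<longleftrightarrow> snd e \<in> insert 0 (set (names t))"
      using A(3) IH(3) by auto
  qed
qed (use assms(1) in auto)

lemma walk_closed:
  assumes "successively R w" "w \<noteq> []" "hd w \<in> A" "\<And>u v. R u v \<Longrightarrow> u \<in> A \<Longrightarrow> v \<in> A"
  shows "last w \<in> A"
  using assms by (induction w rule: induct_list012) auto

text \<open>A pass without progress has reached a set that contains the depot and is closed under
  edges, which is everything by connectivity. Otherwise the pass adds a vertex, so one pass per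
  client is enough.\<close>

lemma build_spans:
  assumes inst: "rftt_instance I" and es: "(\<lambda>(u, v). {u, v}) ` set es = edges I"
  shows "partial_tree I (build es (num_clients I)) \<and> set (names (build es (num_clients I))) = clients I"
proof -
  have ve: "u \<in> verts I" "v \<in> verts I" if "{u, v} \<in> edges I" for u v
  proof -
    from inst that have "{u, v} \<in> {{u, v} |u v. u \<in> verts I \<and> v \<in> verts I \<and> u \<noteq> v}"
      unfolding rftt_instance_def by blast
    then show "u \<in> verts I" "v \<in> verts I" by (auto simp: doubleton_eq_iff)
  qed
  have e: "{fst e, snd e} \<in> edges I \<and> fst e \<in> verts I \<and> snd e \<in> verts I" if "e \<in> set es" for e
  proof -
    have "{fst e, snd e} \<in> (\<lambda>(u, v). {u, v}) ` set es" using that by (force simp: case_prod_beta)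
    then show ?thesis using es ve by auto
  qed
  define t where "t i = build es i" for i
  have tS: "t (Suc i) = foldr add_edge es (t i)" for i by (simp add: t_def build_def)
  have part: "partial_tree I (t i)" for i
  proof (induction i)
    case (Suc i) then show ?case using pass_partial[of I "t i" es] e by (simp add: tS)
  qed (simp add: t_def build_def partial_tree_def)
  have mono: "set (names (t i)) \<subseteq> set (names (t (Suc i)))" for i
    using pass_partial[OF part[of i], of es] e by (simp add: tS)
  have full: "set (names (t i)) = clients I" if eq: "set (names (t (Suc i))) = set (names (t i))" for i
  proof -
    let ?A = "insert 0 (set (names (t i)))"
    have cl: "\<forall>e\<in>set es. fst e \<in> ?A \<longleftrightarrow> snd e \<in> ?A"
      using pass_partial[OF part[of i], of es] e eq by (simp add: tS)
    have step: "v \<in> ?A" if uv: "{u, v} \<in> edges I" "u \<in> ?A" for u v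
    proof -
      from uv(1) have "{u, v} \<in> (\<lambda>(u, v). {u, v}) ` set es" unfolding es .
      then obtain e where e: "e \<in> set es" "{u, v} = {fst e, snd e}" by (auto simp: case_prod_beta)
      from e(2) have "u = fst e \<and> v = snd e \<or> u = snd e \<and> v = fst e" by (auto simp: doubleton_eq_iff)
      moreover have "fst e \<in> ?A \<longleftrightarrow> snd e \<in> ?A" using cl e(1) by (rule bspec)
      ultimately show ?thesis using uv(2) by metis
    qed
    have "v \<in> ?A" if v: "v \<in> verts I" for v
    proof -
      have "0 \<in> verts I" by (simp add: verts_def depot_def)
      then obtain w where w: "is_walk I w" "hd w = 0" "last w = v"
        using inst v unfolding rftt_instance_def is_connected_def by blast
      have "last w \<in> ?A"
        by (rule walk_closed[of "\<lambda>u v. {u, v} \<in> edges I"]) (use w step in \<open>auto simp: is_walk_def\<close>)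
      then show ?thesis using w by simp
    qed
    then have "clients I \<subseteq> set (names (t i))" using zero_not_client by (force simp: verts_def)
    then show ?thesis using part[of i] by (auto simp: partial_tree_def)
  qed
  have fin: "finite (clients I)" by (simp add: clients_def)
  have sub: "set (names (t i)) \<subseteq> clients I" for i using part[of i] by (simp add: partial_tree_def)
  have "set (names (t i)) = clients I \<or> i \<le> card (set (names (t i)))" for i
  proof (induction i)
    case (Suc i)
    show ?case
    proof (cases "set (names (t i)) = clients I \<or> set (names (t (Suc i))) = set (names (t i))")
      case True
      then show ?thesis using full mono[of i] sub[of "Suc i"] by blast
    next
      case False
      then have "card (set (names (t i))) < card (set (names (t (Suc i))))"
        using mono[of i] by (intro psubset_card_mono) auto
      with Suc False show ?thesis by auto
    qed
  qed simp
  then have "set (names (t (num_clients I))) = clients I \<or> num_clients I \<le> card (set (names (t (num_clients I))))" by blast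
  then have "set (names (t (num_clients I))) = clients I"
    using card_seteq[OF fin sub] by (auto simp: clients_def)
  then show ?thesis using part by (simp add: t_def)
qed

lemma simple_walk:
  assumes "w \<noteq> []" "successively R w"
  shows "\<exists>w'. w' \<noteq> [] \<and> successively R w' \<and> hd w' = hd w \<and> last w' = last w \<and> distinct w'"
  using assms
proof (induction w rule: length_induct)
  case (1 w)
  show ?case
  proof (cases "distinct w")
    case False
    then obtain xs ys zs y where w: "w = xs @ [y] @ ys @ [y] @ zs" using not_distinct_decomp by blast
    let ?w = "xs @ [y] @ zs"
    have "successively R ?w" using 1(3) unfolding w by (auto simp: successively_append_iff successively_Cons)
    moreover have "hd ?w = hd w" "last ?w = last w" unfolding w by (cases xs; auto)+
    moreover have "length ?w < length w" "?w \<noteq> []" unfolding w by auto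
    ultimately show ?thesis using 1(1) by metis
  qed (use 1 in blast)
qed

text \<open>An edge missing from the constructed tree would form a cycle with a simple walk along
  tree edges between its ends; this is where acyclicity enters.\<close>

lemma spanning_build:
  assumes inst: "rftt_instance I" and tree: "is_tree I" and es: "(\<lambda>(u, v). {u, v}) ` set es = edges I"
  shows "spanning I (build es (num_clients I))"
proof -
  define t where "t = build es (num_clients I)"
  let ?T = "pedge ` set (paths [] t)"
  have pt: "partial_tree I t" and nt: "set (names t) = clients I" using build_spans[OF inst es] by (auto simp: t_def)
  have d: "distinct (names t)" and sub: "?T \<subseteq> edges I" using pt by (auto simp: partial_tree_def)
  have inV: "u \<in> verts I" "v \<in> verts I" "u \<noteq> v" if "{u, v} \<in> edges I" for u v
  proof -
    from inst that have "{u, v} \<in> {{u, v} |u v. u \<in> verts I \<and> v \<in> verts I \<and> u \<noteq> v}"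
      unfolding rftt_instance_def by blast
    then show "u \<in> verts I" "v \<in> verts I" "u \<noteq> v" by (auto simp: doubleton_eq_iff)
  qed
  let ?R = "\<lambda>u v. {u, v} \<in> ?T"
  have to_root: "\<exists>w. w \<noteq> [] \<and> successively ?R w \<and> hd w = hd q \<and> last w = 0" if "q \<in> set (paths [] t)" for q
    using that
  proof (induction "length q" arbitrary: q rule: less_induct)
    case less
    have e: "?R (hd q) (up q)" using less.prems by (auto simp: pedge_def)
    from up_cases[OF less.prems] show ?case
    proof (elim disjE conjE)
      assume "up q = 0"
      with e show ?thesis by (intro exI[of _ "[hd q, 0]"]) auto
    next
      assume *: "tl q \<in> set (paths [] t)" "up q = hd (tl q)"
      have "length (tl q) < length q" using paths_nonempty[OF less.prems] by simp
      from less.hyps[OF this *(1)] obtain w where "w \<noteq> []" "successively ?R w" "hd w = up q" "last w = 0"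
        using *(2) by auto
      with e show ?thesis by (intro exI[of _ "hd q # w"]) (auto simp: successively_Cons)
    qed
  qed
  have root: "\<exists>w. w \<noteq> [] \<and> successively ?R w \<and> hd w = v \<and> last w = 0" if "v \<in> verts I" for v
  proof (cases "v = 0")
    case False
    then have "v \<in> hd ` set (paths [] t)" using that nt map_hd_paths[of "[]" t]
      by (metis insertE list.set_map verts_def depot_def)
    then show ?thesis using to_root by auto
  qed (intro exI[of _ "[0]"], simp)
  have "edges I \<subseteq> ?T"
  proof (rule ccontr)
    assume "\<not> edges I \<subseteq> ?T"
    then obtain e where e: "e \<in> edges I" "e \<notin> ?T" by blast
    from inst e(1) obtain u v where uv: "e = {u, v}" unfolding rftt_instance_def by blast
    note V = inV[OF e(1)[unfolded uv]]
    from root[OF V(1)] obtain w1 where w1: "w1 \<noteq> []" "successively ?R w1" "hd w1 = u" "last w1 = 0" by blast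
    from root[OF V(2)] obtain w2 where w2: "w2 \<noteq> []" "successively ?R w2" "hd w2 = v" "last w2 = 0" by blast
    have "successively ?R (rev w2)" using w2(2) by (simp add: insert_commute)
    obtain w2' where r: "rev w2 = 0 # w2'"
      using w2(1,4) hd_rev[of w2] by (metis list.collapse rev_is_Nil_conv)
    have "successively ?R (w1 @ w2')"
      using w1 \<open>successively ?R (rev w2)\<close> unfolding r by (auto simp: successively_append_iff successively_Cons)
    moreover have "last (w1 @ w2') = v"
    proof (cases "w2' = []")
      case True
      then have "v = 0" using r w2(3) by (metis last_rev last_ConsL)
      then show ?thesis using True w1(4) by simp
    next
      case False
      then show ?thesis using r w2(3) by (metis last_rev last_ConsR last_appendR)
    qed
    moreover have "hd (w1 @ w2') = u" using w1 by simp
    ultimately obtain w where w: "w \<noteq> []" "successively ?R w" "hd w = u" "last w = v" "distinct w"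
      using simple_walk[of "w1 @ w2'" ?R] w1(1) by auto
    have suc: "successively (\<lambda>u v. {u, v} \<in> edges I) w"
      by (rule successively_mono[OF w(2)]) (use sub in auto)
    \<comment> \<open>With one vertex the edge would be a loop, and with two it would itself be a
      tree edge.\<close>
    have "length w \<ge> 3"
    proof (rule ccontr)
      assume "\<not> length w \<ge> 3"
      moreover have "length w \<noteq> 0" using w(1) by simp
      ultimately have l: "length w = 1 \<or> length w = 2" by linarith
      then show False
      proof
        assume "length w = 1"
        then obtain x where "w = [x]" by (auto simp: length_Suc_conv)
        then show ?thesis using w V(3) by simp
      next
        assume "length w = 2"
        then obtain x y where "w = [x, y]" by (auto simp: length_Suc_conv numeral_2_eq_2)
        then show ?thesis using w e(2) uv by simp
      qed
    qed
    moreover have "set w \<subseteq> verts I"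
    proof
      fix x assume "x \<in> set w"
      then obtain i where i: "i < length w" "w ! i = x" by (auto simp: in_set_conv_nth)
      show "x \<in> verts I"
      proof (cases "Suc i < length w")
        case True
        then have "{w ! i, w ! Suc i} \<in> edges I" using suc by (simp add: successively_conv_nth)
        then show ?thesis using inV i by simp
      next
        case False
        then have "x = last w" using i w(1) by (metis Suc_lessI diff_Suc_1 last_conv_nth)
        then show ?thesis using w(4) V(2) by simp
      qed
    qed
    ultimately have "is_cycle I w"
      using w suc e(1) uv by (auto simp: is_cycle_def is_walk_def insert_commute)
    then show False using tree by (auto simp: is_tree_def)
  qed
  then show ?thesis using d nt sub by (auto simp: spanning_def t_def)
qed

section \<open>Correctness of the program\<close>

lemma enc_bit_Leaf [simp]: "enc_bit b = Leaf \<longleftrightarrow> \<not> b"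
  by (simp add: enc_bit_def)

lemma enc_bit_simps [simp]: "enc_bit False = Leaf" "enc_bit True = sT"
  by (simp_all add: enc_bit_def)

lemma enc_nat_0 [simp]: "enc_nat 0 = Leaf"
  by (simp add: enc_nat.simps)

lemma enc_nat_pos: "n > 0 \<Longrightarrow> enc_nat n = Pair (enc_bit (odd n)) (enc_nat (n div 2))"
  by (simp add: enc_nat.simps)

lemma enc_nat_Leaf [simp]: "enc_nat n = Leaf \<longleftrightarrow> n = 0"
  by (cases "n = 0") (auto simp: enc_nat_pos)

lemma hd_enc_nat [simp]: "hd_sexp (enc_nat n) = enc_bit (odd n)"
  by (cases "n = 0") (auto simp: enc_nat_pos)

lemma tl_enc_nat [simp]: "tl_sexp (enc_nat n) = enc_nat (n div 2)"
  by (cases "n = 0") (auto simp: enc_nat_pos)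

lemma scons_enc: "scons (enc_bit b) (enc_nat n) = enc_nat (of_bool b + 2 * n)"
  by (cases "n = 0"; cases b) (auto simp: scons_def enc_nat_pos[of "Suc _"] enc_nat_pos[of "2 * _"])

lemma sdbl_enc [simp]: "sdbl (enc_nat n) = enc_nat (2 * n)"
  using scons_enc[of False n] by simp

lemma Pair_enc: "b \<or> n > 0 \<Longrightarrow> Pair (enc_bit b) (enc_nat n) = enc_nat (of_bool b + 2 * n)"
  by (cases b) (auto simp: enc_nat_pos)

text \<open>Induction along binary digits. The side condition excludes a leading zero, the only
  digit whose attachment does not yield a numeral (\<open>Pair_enc\<close>).\<close>

lemma enc_nat_induct [case_names zero step]:
  assumes "P 0" "\<And>b n. b \<or> n > 0 \<Longrightarrow> P n \<Longrightarrow> P (of_bool b + 2 * n)"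
  shows "P (n :: nat)"
proof (induction n rule: less_induct)
  case (less n)
  show ?case
  proof (cases "n = 0")
    case False
    have "P (of_bool (odd n) + 2 * (n div 2))" by (rule assms(2)) (use False less in \<open>auto elim!: oddE\<close>)
    then show ?thesis by (metis add.commute mult.commute odd_two_times_div_two_succ even_two_times_div_two of_bool_eq(1,2) add_0_right plus_1_eq_Suc Suc_eq_plus1)
  qed (use assms(1) in simp)
qed

lemma snorm_enc [simp]: "snorm (enc_nat n) = enc_nat n"
  by (induction n rule: enc_nat_induct) (auto simp: Pair_enc[symmetric])

lemma sinc_enc [simp]: "sinc (enc_nat n) = enc_nat (Suc n)"
proof (induction n rule: enc_nat_induct)
  case (step b n)
  have "sinc (enc_nat (of_bool b + 2 * n)) = (if b then Pair Leaf (enc_nat (Suc n)) else Pair sT (enc_nat n))"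
    using step by (auto simp: Pair_enc[symmetric])
  also have "\<dots> = enc_nat (Suc (of_bool b + 2 * n))"
    using Pair_enc[of True n] Pair_enc[of False "Suc n"] by (cases b) auto
  finally show ?case .
qed (simp add: enc_nat_pos)

lemma sxor_enc: "sxor (enc_bit a) (enc_bit b) = enc_bit (a \<noteq> b)"
  and smaj_enc: "smaj (enc_bit a) (enc_bit b) (enc_bit c) = enc_bit (a \<and> b \<or> a \<and> c \<or> b \<and> c)"
  and sbor_enc: "sbor (enc_bit a) (enc_bit b) (enc_bit c) = enc_bit (if a then b \<and> c else b \<or> c)"
  by (cases a; cases b; cases c; simp add: sxor_def smaj_def sbor_def)+

lemma sadd_aux_enc: "sadd_aux (Pair (enc_bit c) (enc_nat b)) (enc_nat a) = enc_nat (a + b + of_bool c)"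
proof (induction a arbitrary: b c rule: enc_nat_induct)
  case zero show ?case by (cases c) (simp_all add: sadd_aux_def)
next
  case (step x a)
  let ?c = "x \<and> odd b \<or> x \<and> c \<or> odd b \<and> c"
  have "sadd_aux (Pair (enc_bit c) (enc_nat b)) (enc_nat (of_bool x + 2 * a)) =
    Pair (enc_bit ((x \<noteq> odd b) \<noteq> c)) (sadd_aux (Pair (enc_bit ?c) (enc_nat (b div 2))) (enc_nat a))"
    using step by (simp add: Pair_enc[symmetric] sadd_aux_def sxor_enc smaj_enc)
  also have "\<dots> = Pair (enc_bit ((x \<noteq> odd b) \<noteq> c)) (enc_nat (a + b div 2 + of_bool ?c))"
    by (simp only: step.IH)
  also have "\<dots> = enc_nat (of_bool ((x \<noteq> odd b) \<noteq> c) + 2 * (a + b div 2 + of_bool ?c))"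
    by (rule Pair_enc) (use step in auto)
  also have "of_bool ((x \<noteq> odd b) \<noteq> c) + 2 * (a + b div 2 + of_bool ?c) = of_bool x + 2 * a + b + of_bool c"
    by (cases x; cases c; cases "odd b") (auto elim!: oddE evenE)
  finally show ?case .
qed

lemma sadd_enc [simp]: "sadd (enc_nat a) (enc_nat b) = enc_nat (a + b)"
  using sadd_aux_enc[of False b a] by (simp add: sadd_def)

lemma ssub_aux_enc: "ssub_aux (Pair (enc_bit c) (enc_nat b)) (enc_nat a) =
   (if b + of_bool c \<le> a then Pair (enc_nat (a - (b + of_bool c))) Leaf else Leaf)"
proof (induction a arbitrary: b c rule: enc_nat_induct)
  case zero show ?case by (cases c) (simp_all add: ssub_aux_def)
next
  case (step x a)
  let ?c = "if x then odd b \<and> c else odd b \<or> c"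
  have "ssub_aux (Pair (enc_bit c) (enc_nat b)) (enc_nat (of_bool x + 2 * a)) =
    (let v = ssub_aux (Pair (enc_bit ?c) (enc_nat (b div 2))) (enc_nat a)
     in if v = Leaf then Leaf else Pair (scons (enc_bit ((x \<noteq> odd b) \<noteq> c)) (hd_sexp v)) Leaf)"
    using step by (simp add: Pair_enc[symmetric] ssub_aux_def sxor_enc sbor_enc Let_def)
  also have "\<dots> = (if b div 2 + of_bool ?c \<le> a
     then Pair (enc_nat (of_bool ((x \<noteq> odd b) \<noteq> c) + 2 * (a - (b div 2 + of_bool ?c)))) Leaf else Leaf)"
    unfolding step.IH by (simp only: scons_enc Let_def hd_sexp.simps if_distrib[of hd_sexp] split: if_split) simp
  also have "\<dots> = (if b + of_bool c \<le> of_bool x + 2 * a then Pair (enc_nat (of_bool x + 2 * a - (b + of_bool c))) Leaf else Leaf)"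
  proof -
    have "b div 2 + of_bool ?c \<le> a \<longleftrightarrow> b + of_bool c \<le> of_bool x + 2 * a"
      by (cases x; cases c; cases "odd b") (auto elim!: oddE evenE)
    moreover have "b div 2 + of_bool ?c \<le> a \<Longrightarrow>
      of_bool ((x \<noteq> odd b) \<noteq> c) + 2 * (a - (b div 2 + of_bool ?c)) = of_bool x + 2 * a - (b + of_bool c)"
      by (cases x; cases c; cases "odd b") (auto elim!: oddE evenE)
    ultimately show ?thesis by auto
  qed
  finally show ?case .
qed

lemma ssub_enc [simp]: "ssub (enc_nat a) (enc_nat b) = (if b \<le> a then Pair (enc_nat (a - b)) Leaf else Leaf)"
  using ssub_aux_enc[of False b a] by (simp add: ssub_def)

lemma seq_enc [simp]: "seq (enc_nat a) (enc_nat b) = enc_bit (a = b)"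
  by (auto simp: seq_def)

lemma smul_enc [simp]: "smul (enc_nat a) (enc_nat b) = enc_nat (a * b)"
proof (induction a rule: enc_nat_induct)
  case (step x a)
  have "smul (enc_nat (of_bool x + 2 * a)) (enc_nat b) =
     (if x then sadd (enc_nat b) (sdbl (smul (enc_nat a) (enc_nat b))) else sdbl (smul (enc_nat a) (enc_nat b)))"
    using step by (simp add: Pair_enc[symmetric] smul_def)
  then show ?case using step by (auto simp: algebra_simps)
qed (simp add: smul_def)

text \<open>\<open>slen\<close> of a numeral is its number of binary digits; this and the next lemma
  enclose \<open>n\<close> between consecutive powers of 2.\<close>

lemma less_power_slen: "n < 2 ^ slen (enc_nat n)"
  by (induction n rule: enc_nat_induct) (auto simp: Pair_enc[symmetric] split: if_splits)

lemma power_slen_le: "n > 0 \<Longrightarrow> 2 ^ (slen (enc_nat n) - 1) \<le> n"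
proof (induction n rule: enc_nat_induct)
  case (step b n)
  show ?case
  proof (cases "n = 0")
    case True then show ?thesis using step by (simp add: enc_nat_pos)
  next
    case False
    then have "slen (enc_nat n) > 0" by (simp add: enc_nat_pos)
    then have "(2 :: nat) ^ slen (enc_nat n) = 2 * 2 ^ (slen (enc_nat n) - 1)" by (simp flip: power_Suc)
    then show ?thesis using step False by (auto simp: Pair_enc[symmetric])
  qed
qed simp

lemma slen_enc_le: "n < 2 ^ L \<Longrightarrow> slen (enc_nat n) \<le> L"
proof (cases "n = 0")
  case False
  assume "n < 2 ^ L"
  with power_slen_le[of n] False have "(2::nat) ^ (slen (enc_nat n) - 1) < 2 ^ L" by linarith
  then show ?thesis by simp
qed simp

lemma size_enc_nat: "size (enc_nat n) \<le> 2 * slen (enc_nat n)"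
proof -
  have "size (snorm (enc_nat n)) \<le> 2 * slen (enc_nat n)" by (rule size_snorm)
  then show ?thesis by simp
qed

section \<open>Encoded unary numbers and lists\<close>

definition enc_un :: "nat \<Rightarrow> sexp" where "enc_un n = (Pair Leaf ^^ n) Leaf"

lemma enc_un_simps [simp]: "enc_un 0 = Leaf" "enc_un (Suc n) = Pair Leaf (enc_un n)"
  by (simp_all add: enc_un_def)

lemma enc_un_Leaf [simp]: "enc_un n = Leaf \<longleftrightarrow> n = 0" by (cases n) auto

lemma tl_enc_un [simp]: "tl_sexp (enc_un n) = enc_un (n - 1)" by (cases n) auto

lemma size_enc_un [simp]: "size (enc_un n) = n" by (induction n) auto

lemma sunary_eq: "sunary l = enc_un (slen l)"
  by (induction l) (auto simp: sunary_def)

lemma smin_enc [simp]: "smin (enc_un a) (enc_un b) = enc_un (min a b)"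
proof -
  have "smin_aux (enc_un b) (enc_un a) = enc_un (min a b)"
    by (induction a arbitrary: b; case_tac b) (auto simp: smin_aux_def)
  then show ?thesis by (simp add: smin_def)
qed

lemma sapp_enc_un [simp]: "sapp (enc_un a) (enc_un b) = enc_un (a + b)"
  by (induction a) auto

lemma sdrop_enc [simp]: "sdrop (enc_un a) (enc_un b) = enc_un (b - a)"
proof -
  have "sdrop_aux (enc_un b) (enc_un a) = enc_un (b - a)"
    by (induction a arbitrary: b) (auto simp: sdrop_aux_def)
  then show ?thesis by (simp add: sdrop_def)
qed

lemma sshift_enc [simp]: "sshift (enc_nat w) (enc_un n) = enc_nat (2 ^ n * w)"
  by (induction n) (auto simp: sshift_def mult.assoc)

lemma sapp_enc_list [simp]: "sapp (enc_list f xs) (enc_list f ys) = enc_list f (xs @ ys)"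
  by (induction xs) auto

lemma sapp_assoc: "sapp (sapp x y) z = sapp x (sapp y z)"
  by (induction x) auto

lemma enc_list_map: "enc_list f (map g xs) = enc_list (\<lambda>x. f (g x)) xs"
  by (induction xs) auto

lemma enc_list_cong: "(\<And>x. x \<in> set xs \<Longrightarrow> f x = g x) \<Longrightarrow> enc_list f xs = enc_list g xs"
  by (induction xs) auto

lemma enc_list_Leaf [simp]: "enc_list f xs = Leaf \<longleftrightarrow> xs = []"
  by (cases xs) auto

lemma tl_enc_list [simp]: "tl_sexp (enc_list f xs) = enc_list f (tl xs)"
  by (cases xs) auto

lemma hd_enc_list: "hd_sexp (enc_list enc_nat xs) = enc_nat (hd (xs @ [0]))"
  by (cases xs) auto

lemma size_elem_enc_list: "x \<in> set xs \<Longrightarrow> size (f x) < size (enc_list f xs)"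
  by (induction xs) auto

lemma size_enc_list_le: "(\<And>x. x \<in> set xs \<Longrightarrow> size (f x) \<le> K) \<Longrightarrow> size (enc_list f xs) \<le> length xs * Suc K"
proof (induction xs)
  case (Cons x xs)
  then have "size (f x) \<le> K" "size (enc_list f xs) \<le> length xs * Suc K" by auto
  then show ?case by simp
qed simp

lemma length_le_size_enc_list: "length xs \<le> size (enc_list f xs)"
  by (induction xs) auto

lemma smem_enc [simp]: "smem (enc_nat v) (enc_list enc_nat xs) = enc_bit (v \<in> set xs)"
  by (induction xs) (auto simp: smem_def)

lemma slookup_enc:
  assumes "1 \<le> v" "v \<le> n"
  shows "slookup (enc_nat v) (enc_list (\<lambda>j. enc_nat (f j)) [1..<Suc n]) = enc_nat (f v)"
proof -
  \<comment> \<open>The state is the number of the client at the head of the list, so the induction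
    needs an arbitrary start \<open>a\<close>.\<close>
  have "srec (\<lambda>c s. Leaf) (\<lambda>c s a r. sinc s) (\<lambda>c s a r w. if seq c s = Leaf then w else a) (enc_nat v) (enc_nat a)
      (enc_list (\<lambda>j. enc_nat (f j)) [a..<b]) = enc_nat (f v)" if "a \<le> v" "v < b" for a b
    using that
  proof (induction "b - a" arbitrary: a)
    case (Suc d)
    have u: "[a..<b] = a # [Suc a..<b]" using Suc.prems by (simp add: upt_conv_Cons)
    show ?case
    proof (cases "a = v")
      case True then show ?thesis unfolding u by simp
    next
      case False
      with Suc.prems have "Suc a \<le> v" by simp
      with Suc.hyps Suc.prems have IH: "srec (\<lambda>c s. Leaf) (\<lambda>c s a r. sinc s) (\<lambda>c s a r w. if seq c s = Leaf then w else a) (enc_nat v) (enc_nat (Suc a))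
      (enc_list (\<lambda>j. enc_nat (f j)) [Suc a..<b]) = enc_nat (f v)" by auto
      then show ?thesis unfolding u using False by simp
    qed
  qed simp
  from this[of 1 "Suc n"] assms show ?thesis by (simp add: slookup_def enc_nat_pos del: upt_Suc)
qed

lemma foldr_min:
  "foldr (\<lambda>x acc. if Q x then min (f x) acc else acc) xs m = Min (insert m (f ` {x \<in> set xs. Q x}) :: nat set)"
proof (induction xs)
  case (Cons x xs)
  have "{y \<in> set (x # xs). Q y} = (if Q x then insert x {y \<in> set xs. Q y} else {y \<in> set xs. Q y})" by auto
  then show ?case using Cons by (simp add: insert_commute[of m])
qed simp

section \<open>Tree, items and tour on encodings\<close>

definition bracket_code :: "(nat set \<Rightarrow> nat) \<Rightarrow> kind \<times> nat list \<Rightarrow> sexp" where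
  "bracket_code W x = Pair (if fst x = Open then sT else Leaf) (Pair (enc_nat (hd (snd x))) (enc_nat (W (pedge (snd x)))))"

lemma bracket_code_pair: "bracket_code W (k, q) =
    Pair (if k = Open then sT else Leaf) (Pair (enc_nat (hd q)) (enc_nat (W (pedge q))))"
  by (simp add: bracket_code_def)

text \<open>The tag of a visit marker is the only one whose head is not \<open>Leaf\<close>, so one
  test recognises markers; among the brackets, the closing ones are those with tag
  \<open>Leaf\<close>.\<close>

definition node_code :: "(nat set \<Rightarrow> nat) \<Rightarrow> kind \<times> nat list \<Rightarrow> sexp" where
  "node_code W x = Pair (case fst x of Open \<Rightarrow> sT | Visit \<Rightarrow> Pair sT Leaf | Close \<Rightarrow> Leaf)
     (Pair (if fst x = Visit then Leaf else enc_nat (W (pedge (snd x)))) (enc_list enc_nat (snd x)))"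

definition brackets :: "nat list \<Rightarrow> tree \<Rightarrow> (kind \<times> nat list) list" where
  "brackets p t = filter (\<lambda>x. fst x \<noteq> Visit) (euler p t)"

lemma brackets_simps [simp]:
  "brackets p Tip = []"
  "brackets p (Br v c s) = (Open, v # p) # brackets (v # p) c @ (Close, v # p) # brackets p s"
  by (simp_all add: brackets_def)

definition tree_code :: "(nat set \<Rightarrow> nat) \<Rightarrow> tree \<Rightarrow> sexp" where
  "tree_code W t = enc_list (bracket_code W) (brackets [] t)"

lemma splaced_enc: "splaced (enc_nat v) (tree_code W t) = enc_bit (v \<in> set (names t))"
proof -
  have "splaced (enc_nat v) (enc_list (bracket_code W) xs) = enc_bit (v \<in> (\<lambda>x. hd (snd x)) ` set xs)" for xs
    by (induction xs) (auto simp: splaced_def bracket_code_def)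
  moreover have "(\<lambda>x. hd (snd x)) ` set (brackets p t) = set (names t)" for p
    by (induction p t rule: paths.induct) auto
  ultimately show ?thesis by (simp add: tree_code_def)
qed

text \<open>The brackets of a subtree are followed by those of the rest, so the induction carries a
  continuation \<open>xs\<close>. The program stops at the first match while
  \<open>insert_below\<close> searches both subforests; they agree since names are distinct.\<close>

lemma sinsert_enc:
  assumes "distinct (names t)" "u \<in> set (names t) \<or> u = 0"
  shows "sinsert (enc_nat u) (Pair (enc_nat v) (enc_nat (W {u, v}))) (tree_code W t) =
     tree_code W (if u = 0 then Br v Tip t else insert_below u v t)"
proof -
  let ?c = "Pair (enc_nat u) (Pair (enc_nat v) (enc_nat (W {u, v})))"
  define S where "S = srec (\<lambda>c s. Leaf) (\<lambda>c s a r. s)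
     (\<lambda>c s a r w. if hd_sexp a = Leaf then Pair a w else if seq (hd_sexp c) (hd_sexp (tl_sexp a)) = Leaf then Pair a w
        else Pair a (Pair (Pair sT (tl_sexp c)) (Pair (Pair Leaf (tl_sexp c)) r))) ?c Leaf"
  have "S (enc_list (bracket_code W) (brackets p t @ xs)) = (if u \<in> set (names t)
      then enc_list (bracket_code W) (brackets p (insert_below u v t) @ xs)
      else sapp (enc_list (bracket_code W) (brackets p t)) (S (enc_list (bracket_code W) xs)))"
    if "distinct (names t)" for p t xs
    using that
  proof (induction p t arbitrary: xs rule: paths.induct)
    case (2 p a c s)
    show ?case
    proof (cases "a = u")
      case True
      then show ?thesis
        by (simp add: S_def bracket_code_pair pedge_def insert_commute)
    next
      case False
      have 1: "S (enc_list (bracket_code W) (brackets p (Br a c s) @ xs)) =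
        Pair (bracket_code W (Open, a # p)) (S (enc_list (bracket_code W) (brackets (a # p) c @ (Close, a # p) # brackets p s @ xs)))"
        using False by (simp add: S_def bracket_code_def)
      have 2: "S (enc_list (bracket_code W) ((Close, a # p) # brackets p s @ xs)) =
        Pair (bracket_code W (Close, a # p)) (S (enc_list (bracket_code W) (brackets p s @ xs)))"
        by (simp add: S_def bracket_code_def)
      have d: "distinct (names c)" "distinct (names s)" using "2.prems" by auto
      show ?thesis
      proof (cases "u \<in> set (names c)")
        case True
        with "2.prems" have "insert_below u v s = s" by (intro insert_below_absent) auto
        then show ?thesis using 1 "2.IH"(1)[OF d(1)] True False by simp
      next
        case F: False
        then have "insert_below u v c = c" by (rule insert_below_absent)
        moreover have "S (enc_list (bracket_code W) (brackets p (Br a c s) @ xs)) =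
          Pair (bracket_code W (Open, a # p)) (sapp (enc_list (bracket_code W) (brackets (a # p) c))
            (Pair (bracket_code W (Close, a # p)) (if u \<in> set (names s)
              then enc_list (bracket_code W) (brackets p (insert_below u v s) @ xs)
              else sapp (enc_list (bracket_code W) (brackets p s)) (S (enc_list (bracket_code W) xs)))))"
          unfolding 1 using 2 "2.IH"(1)[OF d(1)] "2.IH"(2)[OF d(2)] F by simp
        ultimately show ?thesis using F False
          by (simp add: sapp_assoc del: sapp_enc_list flip: sapp_enc_list)
      qed
    qed
  qed simp
  from this[OF assms(1), of "[]" "[]"] show ?thesis
    using assms(2) by (auto simp: sinsert_def S_def[symmetric] tree_code_def bracket_code_def pedge_def insert_commute up_def)
qed

lemma sinsert_absent:
  assumes "u \<notin> set (names t)" "u \<noteq> 0"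
  shows "sinsert (enc_nat u) vw (tree_code W t) = tree_code W t"
proof -
  have "srec (\<lambda>c s. Leaf) (\<lambda>c s a r. s)
     (\<lambda>c s a r w. if hd_sexp a = Leaf then Pair a w else if seq (hd_sexp c) (hd_sexp (tl_sexp a)) = Leaf then Pair a w
        else Pair a (Pair (Pair sT (tl_sexp c)) (Pair (Pair Leaf (tl_sexp c)) r))) (Pair (enc_nat u) vw) Leaf
      (enc_list (bracket_code W) xs) = enc_list (bracket_code W) xs" if "u \<notin> (\<lambda>x. hd (snd x)) ` set xs" for xs
    using that by (induction xs) (auto simp: bracket_code_def)
  moreover have "(\<lambda>x. hd (snd x)) ` set (brackets p t) = set (names t)" for p
    by (induction p t rule: paths.induct) auto
  ultimately show ?thesis using assms by (simp add: sinsert_def tree_code_def)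
qed

lemma sattach_enc:
  assumes "distinct (names t)"
  shows "sattach (enc_nat u) (enc_nat v) (enc_nat (W {u, v})) (tree_code W t) = tree_code W (attach u v t)"
  using sinsert_enc[OF assms, of u v W] sinsert_absent[of u t _ W] insert_below_absent[of u t v]
  by (cases "u \<in> set (names t)") (auto simp: sattach_def attach_def splaced_enc)

lemma distinct_attach: "distinct (names t) \<Longrightarrow> distinct (names (attach u v t))"
  using names_insert_below[of t v u] by (auto simp: attach_def)

lemma distinct_add_edge: "distinct (names t) \<Longrightarrow> distinct (names (add_edge e t))"
  by (simp add: add_edge_def distinct_attach)

definition edge_code :: "(nat set \<Rightarrow> nat) \<Rightarrow> nat \<times> nat \<Rightarrow> sexp" where
  "edge_code W e = Pair (Pair (enc_nat (fst e)) (enc_nat (snd e))) (enc_nat (W {fst e, snd e}))"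

lemma sedge_enc:
  assumes "distinct (names t)"
  shows "sedge (edge_code W e) (tree_code W t) = tree_code W (add_edge e t)"
  using sattach_enc[OF assms, of "fst e" "snd e" W]
    sattach_enc[OF distinct_attach[OF assms, of "fst e" "snd e"], of "snd e" "fst e" W]
  by (simp add: sedge_def edge_code_def add_edge_def insert_commute)

lemma sbuild_enc: "sbuild (enc_list (edge_code W) es) (enc_list f xs) = tree_code W (build es (length xs))"
proof -
  have pass: "spass (enc_list (edge_code W) es) (tree_code W t) = tree_code W (foldr add_edge es t) \<and>
      distinct (names (foldr add_edge es t))" if "distinct (names t)" for t es
  proof (induction es)
    case (Cons e es)
    have "spass (enc_list (edge_code W) (e # es)) (tree_code W t) =
        sedge (edge_code W e) (spass (enc_list (edge_code W) es) (tree_code W t))"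
      by (simp add: spass_def)
    then show ?case using Cons sedge_enc[of "foldr add_edge es t" W e] by (simp add: distinct_add_edge)
  qed (use that in \<open>simp add: spass_def\<close>)
  have "sbuild (enc_list (edge_code W) es) (enc_list f xs) = tree_code W (build es (length xs)) \<and>
    distinct (names (build es (length xs)))"
    by (induction xs) (use pass in \<open>simp_all add: sbuild_def build_def tree_code_def\<close>)
  then show ?thesis by blast
qed

text \<open>The state at the start of a forest is the path of its parent, and balanced brackets
  restore it; this again calls for a continuation \<open>xs\<close>.\<close>

lemma sann_enc: "sann (tree_code W t) = enc_list (node_code W) (euler [] t)"
proof -
  have "sann_aux (enc_list enc_nat p) (enc_list (bracket_code W) (brackets p t @ xs)) =
     sapp (enc_list (node_code W) (euler p t)) (sann_aux (enc_list enc_nat p) (enc_list (bracket_code W) xs))" for p t xs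
  proof (induction p t arbitrary: xs rule: paths.induct)
    case (2 p v c s)
    have a: "sann_aux (enc_list enc_nat p) (enc_list (bracket_code W) ((Open, v # p) # ys)) =
       Pair (node_code W (Open, v # p)) (Pair (node_code W (Visit, v # p))
         (sann_aux (enc_list enc_nat (v # p)) (enc_list (bracket_code W) ys)))" for ys
      by (simp add: sann_aux_def bracket_code_def node_code_def)
    have b: "sann_aux (enc_list enc_nat (v # p)) (enc_list (bracket_code W) ((Close, v # p) # ys)) =
       Pair (node_code W (Close, v # p)) (sann_aux (enc_list enc_nat p) (enc_list (bracket_code W) ys))" for ys
      by (simp add: sann_aux_def bracket_code_def node_code_def)
    have "enc_list (node_code W) (euler p (Br v c s)) = Pair (node_code W (Open, v # p)) (Pair (node_code W (Visit, v # p))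
       (sapp (enc_list (node_code W) (euler (v # p) c)) (Pair (node_code W (Close, v # p)) (enc_list (node_code W) (euler p s)))))"
      by (simp flip: sapp_enc_list)
    then show ?case using a b "2.IH" by (simp add: sapp_assoc)
  qed simp
  from this[of "[]" t "[]"] show ?thesis
    using sapp_enc_list[of "node_code W" "euler [] t" "[]"]
    by (simp add: sann_def tree_code_def sann_aux_def)
qed

text \<open>The floor of the binary logarithm, with the truncated value \<open>log2 0 = 0\<close>.\<close>

definition log2 :: "nat \<Rightarrow> nat" where "log2 n = slen (enc_nat n) - 1"

lemma log2_bounds: "n > 0 \<Longrightarrow> 2 ^ log2 n \<le> n" "n < 2 * 2 ^ log2 n"
proof -
  have "n < 2 ^ slen (enc_nat n)" by (rule less_power_slen)
  also have "\<dots> \<le> 2 ^ Suc (log2 n)" by (rule power_increasing) (auto simp: log2_def)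
  finally show "n < 2 * 2 ^ log2 n" by simp
qed (unfold log2_def, rule power_slen_le)

text \<open>That \<open>r\<close> lies below \<open>q\<close> is expressed by names, as the program
  tests it; \<open>in_path_iff\<close> translates this into \<open>suffix\<close>.\<close>

definition path_class :: "(nat \<Rightarrow> nat) \<Rightarrow> nat \<Rightarrow> tree \<Rightarrow> nat list \<Rightarrow> nat" where
  "path_class f m t q = Min (insert m ((\<lambda>r. log2 (f (hd r))) ` {r \<in> set (paths [] t). hd q \<in> set r}))"

lemma stotal_enc: "stotal (enc_list (\<lambda>j. enc_nat (f j)) xs) = enc_un (\<Sum>j\<leftarrow>xs. slen (enc_nat (f j)))"
  by (induction xs) (simp_all add: stotal_def sunary_eq)

lemma sclass_enc:
  assumes "1 \<le> v" "v \<le> n"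
  shows "sclass (enc_list (\<lambda>j. enc_nat (f j)) [1..<Suc n]) (enc_nat v) = enc_un (log2 (f v))"
  unfolding sclass_def slookup_enc[OF assms] sunary_eq by (simp add: log2_def)

lemma smin_class_enc:
  assumes "set (names t) \<subseteq> {1..n}"
  shows "smin_class (enc_list (\<lambda>j. enc_nat (f j)) [1..<Suc n]) (enc_nat (hd q)) (enc_un m)
     (enc_list (node_code W) (euler [] t)) = enc_un (path_class f m t q)"
proof -
  let ?taus = "enc_list (\<lambda>j. enc_nat (f j)) [1..<Suc n]"
  have "smin_class ?taus (enc_nat v) (enc_un m) (enc_list (node_code W) xs) =
      enc_un (foldr (\<lambda>x acc. if v \<in> set (snd x) then min (log2 (f (hd (snd x)))) acc else acc) xs m)"
    if "\<And>x. x \<in> set xs \<Longrightarrow> snd x \<noteq> [] \<and> hd (snd x) \<in> {1..n}" for xs v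
    using that
  proof (induction xs)
    case (Cons x xs)
    then have x: "snd x \<noteq> []" "1 \<le> hd (snd x)" "hd (snd x) \<le> n" by auto
    have "smin_class ?taus (enc_nat v) (enc_un m) (enc_list (node_code W) (x # xs)) =
      (if smem (enc_nat v) (enc_list enc_nat (snd x)) = Leaf then smin_class ?taus (enc_nat v) (enc_un m) (enc_list (node_code W) xs)
       else smin (sclass ?taus (hd_sexp (enc_list enc_nat (snd x)))) (smin_class ?taus (enc_nat v) (enc_un m) (enc_list (node_code W) xs)))"
      by (simp add: smin_class_def node_code_def del: smem_enc)
    moreover have "hd_sexp (enc_list enc_nat (snd x)) = enc_nat (hd (snd x))" using x(1) by (simp add: hd_enc_list)
    ultimately show ?case using Cons sclass_enc[OF x(2,3), of f] by (simp del: upt_Suc)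
  qed (simp add: smin_class_def)
  moreover have "snd x \<noteq> [] \<and> hd (snd x) \<in> {1..n}" if "x \<in> set (euler [] t)" for x
  proof -
    have "snd x \<in> set (paths [] t)" using that snd_euler[of "[]" t] by auto
    then have "snd x \<noteq> []" "hd (snd x) \<in> set (map hd (paths [] t))" using paths_nonempty[of "snd x"] by auto
    then have "snd x \<noteq> []" "hd (snd x) \<in> set (names t)" unfolding map_hd_paths by simp_all
    then show ?thesis using assms by blast
  qed
  ultimately have "smin_class ?taus (enc_nat (hd q)) (enc_un m) (enc_list (node_code W) (euler [] t)) =
     enc_un (foldr (\<lambda>x acc. if hd q \<in> set (snd x) then min (log2 (f (hd (snd x)))) acc else acc) (euler [] t) m)"
    by blast
  also have "\<dots> = enc_un (Min (insert m ((\<lambda>x. log2 (f (hd (snd x)))) ` {x \<in> set (euler [] t). hd q \<in> set (snd x)})))"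
    by (simp only: foldr_min)
  also have "(\<lambda>x. log2 (f (hd (snd x)))) ` {x \<in> set (euler [] t). hd q \<in> set (snd x)} =
     (\<lambda>r. log2 (f (hd r))) ` {r \<in> set (paths [] t). hd q \<in> set r}"
    unfolding snd_euler[symmetric] by auto
  finally show ?thesis by (simp add: path_class_def)
qed

text \<open>In place of the position the code stores what is found there: the path, if it is a visit
  marker.\<close>

definition item_code :: "(kind \<times> nat list) list \<Rightarrow> item \<Rightarrow> sexp" where
  "item_code B = (\<lambda>(n, c, w). Pair (enc_un c) (Pair (enc_nat w)
     (if fst (B ! n) = Visit then enc_list enc_nat (snd (B ! n)) else Leaf)))"

lemma sitems_enc:
  assumes "set (names t) \<subseteq> {1..n}"
  defines "B \<equiv> euler [] t"
  shows "sitems (enc_list (\<lambda>j. enc_nat (f j)) [1..<Suc n]) (enc_un m) (enc_list (node_code W) B) =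
     enc_list (item_code B) (items m (path_class f m t) (\<lambda>q. W (pedge q)) B)"
proof -
  let ?taus = "enc_list (\<lambda>j. enc_nat (f j)) [1..<Suc n]" and ?N = "enc_list (node_code W) B"
  have *: "srec (\<lambda>c s. Leaf) (\<lambda>c s a r. s) (\<lambda>c s a r v. Pair (sitem (hd_sexp c) (hd_sexp (tl_sexp c)) (tl_sexp (tl_sexp c)) a) v)
     (Pair T (Pair M N)) Leaf (enc_list g xs) = enc_list (\<lambda>x. sitem T M N (g x)) xs" for T M N xs and g :: "kind \<times> nat list \<Rightarrow> sexp"
    by (induction xs) simp_all
  have "sitems ?taus (enc_un m) ?N = enc_list (\<lambda>x. sitem ?taus (enc_un m) ?N (node_code W x)) B"
    unfolding sitems_def by (rule *)
  also have "\<dots> = enc_list (\<lambda>x. sitem ?taus (enc_un m) ?N (node_code W x)) (map (\<lambda>i. B ! i) [0..<length B])"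
    by (simp only: map_nth)
  also have "\<dots> = enc_list (\<lambda>i. sitem ?taus (enc_un m) ?N (node_code W (B ! i))) [0..<length B]"
    by (rule enc_list_map)
  also have "\<dots> = enc_list (\<lambda>i. item_code B (i, path_class f m t (snd (B ! i)), if fst (B ! i) = Visit then 0
     else 2 ^ (m - path_class f m t (snd (B ! i))) * W (pedge (snd (B ! i))))) [0..<length B]"
  proof (rule enc_list_cong)
    fix i assume i: "i \<in> set [0..<length B]"
    have "snd (B ! i) \<in> snd ` set B" using i by simp
    then have "snd (B ! i) \<in> set (paths [] t)" unfolding B_def by (simp only: snd_euler)
    then have ne: "snd (B ! i) \<noteq> []" by (rule paths_nonempty)
    have h: "hd_sexp (tl_sexp (tl_sexp (node_code W (B ! i)))) = enc_nat (hd (snd (B ! i)))"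
      using ne by (simp add: node_code_def hd_enc_list)
    have sm: "smin_class ?taus (enc_nat (hd q)) (enc_un m) ?N = enc_un (path_class f m t q)" for q
      unfolding B_def by (rule smin_class_enc[OF assms(1)])
    have z: "sshift Leaf (enc_un k) = Leaf" for k using sshift_enc[of 0 k] by simp
    show "sitem ?taus (enc_un m) ?N (node_code W (B ! i)) = item_code B (i, path_class f m t (snd (B ! i)), if fst (B ! i) = Visit then 0
     else 2 ^ (m - path_class f m t (snd (B ! i))) * W (pedge (snd (B ! i))))"
      unfolding sitem_def h sm
      by (cases "fst (B ! i)") (simp_all add: item_code_def node_code_def z)
  qed
  also have "\<dots> = enc_list (item_code B) (items m (path_class f m t) (\<lambda>q. W (pedge q)) B)"
    unfolding items_def by (rule enc_list_map[symmetric])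
  finally show ?thesis .
qed

text \<open>Listing all names of a served path adds the ancestors, so the result describes
  \<open>toured\<close>.\<close>

definition served_names :: "(kind \<times> nat list) list \<Rightarrow> item list \<Rightarrow> nat list" where
  "served_names B R = concat (map (\<lambda>(n, c, w). if c = 0 \<and> fst (B ! n) = Visit then snd (B ! n) else []) R)"

lemma sserved_enc: "sserved (enc_list (item_code B) R) = enc_list enc_nat (served_names B R)"
proof (induction R)
  case (Cons x R)
  have "sserved (enc_list (item_code B) (x # R)) = (if hd_sexp (item_code B x) = Leaf
     then sapp (tl_sexp (tl_sexp (item_code B x))) (sserved (enc_list (item_code B) R)) else sserved (enc_list (item_code B) R))"
    by (simp add: sserved_def)
  also have "\<dots> = enc_list enc_nat (served_names B (x # R))"
    unfolding Cons by (cases x) (simp add: item_code_def served_names_def)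
  finally show ?case .
qed (simp add: sserved_def served_names_def)

lemma smass_enc: "smass (enc_list (item_code B) R) = enc_nat (mass R)"
proof (induction R)
  case (Cons x R)
  have "smass (enc_list (item_code B) (x # R)) = (if hd_sexp (item_code B x) = Leaf
     then smass (enc_list (item_code B) R) else sadd (hd_sexp (tl_sexp (item_code B x))) (smass (enc_list (item_code B) R)))"
    by (simp add: smass_def)
  also have "\<dots> = enc_nat (mass (x # R))"
    unfolding Cons by (cases x) (simp add: item_code_def mass_def)
  finally show ?case .
qed (simp add: smass_def mass_def)

lemma srest_enc: "srest (enc_list (item_code B) R) = enc_list (item_code B) (rest R)"
proof (induction R)
  case (Cons x R)
  have "srest (enc_list (item_code B) (x # R)) = (if hd_sexp (item_code B x) = Leaf then srest (enc_list (item_code B) R)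
     else Pair (Pair (tl_sexp (hd_sexp (item_code B x))) (Pair (sdbl (hd_sexp (tl_sexp (item_code B x))))
       (tl_sexp (tl_sexp (item_code B x))))) (srest (enc_list (item_code B) R)))"
    by (simp add: srest_def)
  also have "\<dots> = enc_list (item_code B) (rest (x # R))"
    unfolding Cons by (cases x) (simp add: item_code_def rest_def)
  finally show ?case .
qed (simp add: srest_def rest_def)

lemma sleft_aux_enc: "sleft_aux (enc_nat s) (enc_list (item_code B) R) = enc_list (item_code B) (lpart s R)"
  by (induction s R rule: lpart.induct) (auto simp: sleft_aux_def item_code_def)

lemma sright_aux_enc: "sright_aux (enc_nat s) (enc_list (item_code B) R) = enc_list (item_code B) (rpart s R)"
  by (induction s R rule: rpart.induct) (auto simp: sright_aux_def item_code_def)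

lemma shalf_enc: "shalf (enc_bit b) (enc_list (item_code B) R) = enc_list (item_code B) (half b R)"
  by (simp add: shalf_def half_def smass_enc srest_enc sleft_aux_enc sright_aux_enc)

lemma sselect_aux_enc:
  "sselect_aux (Pair (enc_nat k) (enc_list (item_code B) R)) (enc_un f) =
     enc_list enc_nat (concat (map (\<lambda>i. served_names B (level k R i)) [0..<f]))"
proof (induction f arbitrary: k R)
  case (Suc f)
  have "sselect_aux (Pair (enc_nat k) (enc_list (item_code B) R)) (enc_un (Suc f)) =
    sapp (sserved (enc_list (item_code B) R))
      (sselect_aux (Pair (enc_nat (k div 2)) (shalf (enc_bit (odd k)) (enc_list (item_code B) R))) (enc_un f))"
    by (simp add: sselect_aux_def)
  also have "\<dots> = enc_list enc_nat (served_names B R @ concat (map (\<lambda>i. served_names B (level (k div 2) (half (odd k) R) i)) [0..<f]))"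
    by (simp only: shalf_enc sserved_enc Suc sapp_enc_list)
  also have "\<dots> = enc_list enc_nat (concat (map (\<lambda>i. served_names B (level k R i)) [0..<Suc f]))"
  proof -
    have "[0..<Suc f] = 0 # map Suc [0..<f]" by (simp add: upt_conv_Cons map_Suc_upt del: upt_Suc)
    then show ?thesis by (simp add: o_def del: upt_Suc)
  qed
  finally show ?case .
qed (simp add: sselect_aux_def)

lemma swalk_enc:
  assumes "\<And>x. x \<in> set B \<Longrightarrow> snd x \<noteq> []"
  shows "swalk (enc_list enc_nat xs) (enc_list (node_code W) B) = enc_list enc_nat (span_tour {q. hd q \<in> set xs} B)"
  using assms
proof (induction B)
  case (Cons x B)
  obtain k q where x: "x = (k, q)" by (cases x)
  have q: "q \<noteq> []" using Cons.prems[of x] by (simp add: x)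
  have IH: "swalk (enc_list enc_nat xs) (enc_list (node_code W) B) = enc_list enc_nat (span_tour {q. hd q \<in> set xs} B)"
    using Cons by simp
  have "swalk (enc_list enc_nat xs) (enc_list (node_code W) (x # B)) =
    (if hd_sexp (hd_sexp (node_code W x)) = Leaf then
          if smem (hd_sexp (tl_sexp (tl_sexp (node_code W x)))) (enc_list enc_nat xs) = Leaf
          then swalk (enc_list enc_nat xs) (enc_list (node_code W) B)
          else Pair (if hd_sexp (node_code W x) = Leaf then hd_sexp (tl_sexp (tl_sexp (tl_sexp (node_code W x))))
             else hd_sexp (tl_sexp (tl_sexp (node_code W x)))) (swalk (enc_list enc_nat xs) (enc_list (node_code W) B))
        else swalk (enc_list enc_nat xs) (enc_list (node_code W) B))"
    by (simp add: swalk_def)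
  also have "\<dots> = enc_list enc_nat (span_tour {q. hd q \<in> set xs} (x # B))"
    unfolding IH x using q by (cases k; cases q) (auto simp: node_code_def hd_enc_list span_tour_def)
  finally show ?case .
qed (simp add: swalk_def)

section \<open>Approximation ratio\<close>

text \<open>Splitting creates no new positions, lengthens no list, and raises neither the total mass
  nor a class. These quantities bound the code of every level by that of the first.\<close>

definition dominated :: "item list \<Rightarrow> item list \<Rightarrow> bool" where
  "dominated R R' \<longleftrightarrow> length R' \<le> length R \<and> total R' \<le> total R \<and>
     (\<forall>(n, c, w)\<in>set R'. \<exists>c' w'. (n, c', w') \<in> set R \<and> c \<le> c')"

lemma dominated_half: "dominated R R' \<Longrightarrow> dominated R (half b R')"
proof -
  assume d: "dominated R R'"
  have l: "length (lpart s xs) \<le> length xs" "length (rpart s xs) \<le> length xs" for s xs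
    by (cases rule: part_cases[of s xs]; simp)+
  have "length (half b R') \<le> length (rest R')" unfolding half_def using l by simp
  also have "\<dots> \<le> length R'" by (simp add: rest_def)
  finally have 1: "length (half b R') \<le> length R'" .
  have 2: "total (half b R') \<le> total R'" using total_eq[of R'] by (simp add: total_half)
  have part: "\<exists>w'. (n, c, w') \<in> set xs" if "(n, c, w) \<in> set (lpart s xs) \<or> (n, c, w) \<in> set (rpart s xs)" for n c w s xs
    using that by (cases rule: part_cases[of s xs]) auto
  have "\<exists>c' w'. (n, c', w') \<in> set R' \<and> c \<le> c'" if "(n, c, w) \<in> set (half b R')" for n c w
  proof -
    from that part[of n c w "mass R'" "rest R'"] obtain w' where "(n, c, w') \<in> set (rest R')"
      by (auto simp: half_def split: if_splits)
    then show ?thesis by (auto simp: rest_def)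
  qed
  then show ?thesis using d 1 2 unfolding dominated_def by (fastforce intro: order_trans)
qed

text \<open>The code size \<open>S\<close> bounds the number of items and the digits of each mass,
  and S * 2^S < 2^(2 * S).\<close>

lemma total_less: "total R < 2 ^ (2 * size (enc_list (item_code B) R))"
proof -
  let ?S = "size (enc_list (item_code B) R)"
  have w: "w \<le> 2 ^ ?S" if "(n, c, w) \<in> set R" for n c w
  proof -
    have "slen (enc_nat w) \<le> size (item_code B (n, c, w))"
      using slen_le_size[of "enc_nat w"] by (simp add: item_code_def)
    also have "\<dots> \<le> ?S" using size_elem_enc_list[OF that, of "item_code B"] by simp
    finally have "(2::nat) ^ slen (enc_nat w) \<le> 2 ^ ?S" by (rule power_increasing) simp
    with less_power_slen[of w] show ?thesis by linarith
  qed
  have "total R \<le> (\<Sum>x\<leftarrow>R. 2 ^ ?S)"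
    unfolding total_def by (rule sum_list_mono) (use w in auto)
  also have "\<dots> = length R * 2 ^ ?S" by (simp add: sum_list_triv)
  also have "\<dots> \<le> ?S * 2 ^ ?S" using length_le_size_enc_list by (rule mult_right_mono) simp
  also have "\<dots> < 2 ^ ?S * 2 ^ ?S" by simp
  finally show ?thesis by (simp add: mult_2 power_add)
qed

text \<open>A mass below 2^(2 * S) has a numeral of size at most 4 * S, and class and path take no
  more room than in the item of \<open>R\<close> at the same position, which has size below S. This
  gives 5 * S for each of at most S items.\<close>

lemma dominated_size:
  assumes "dominated R R'"
  shows "size (enc_list (item_code B) R') \<le> size (enc_list (item_code B) R) * (5 * size (enc_list (item_code B) R) + 1)"
proof -
  let ?S = "size (enc_list (item_code B) R)"
  have "size (item_code B x) \<le> 5 * ?S" if x: "x \<in> set R'" for x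
  proof -
    obtain n c w where [simp]: "x = (n, c, w)" by (cases x)
    from x assms obtain c' w' where *: "(n, c', w') \<in> set R" "c \<le> c'" by (fastforce simp: dominated_def)
    have "w \<le> total R'" using x unfolding total_def by (force intro: member_le_sum_list)
    also have "\<dots> \<le> total R" using assms by (simp add: dominated_def)
    also have "\<dots> < 2 ^ (2 * ?S)" by (rule total_less)
    finally have "size (enc_nat w) \<le> 4 * ?S" using slen_enc_le[of w "2 * ?S"] size_enc_nat[of w] by linarith
    moreover have "size (item_code B (n, c', w')) < ?S" using *(1) by (rule size_elem_enc_list)
    ultimately show ?thesis using *(2) by (simp add: item_code_def)
  qed
  then have "size (enc_list (item_code B) R') \<le> length R' * Suc (5 * ?S)" by (rule size_enc_list_le)
  also have "\<dots> \<le> ?S * Suc (5 * ?S)"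
    using assms length_le_size_enc_list[of R "item_code B"] by (intro mult_right_mono) (auto simp: dominated_def)
  finally show ?thesis by simp
qed

lemma size_sserved: "size (sserved R) \<le> size R"
proof (induction R)
  case (Pair a R)
  have "sserved (Pair a R) = (if hd_sexp a = Leaf then sapp (tl_sexp (tl_sexp a)) (sserved R) else sserved R)"
    by (simp add: sserved_def)
  then show ?case using Pair size_tl_le[of a] size_tl_le[of "tl_sexp a"] by (auto simp: size_sapp)
qed (simp add: sserved_def)

text \<open>All levels are dominated by the same list \<open>R\<close>, so one bound fits every
  state, and each round outputs at most this amount.\<close>

lemma sselect_bounded:
  assumes "dominated R R'" "size (enc_nat k) \<le> K" "f \<le> F" "size (enc_list (item_code B) R) \<le> S"
  shows "srec_bounded (1 + K + Suc F * (S * (5 * S + 1)))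
     (\<lambda>c s. Leaf) (\<lambda>c s a r. Pair (tl_sexp (hd_sexp s)) (shalf (hd_sexp (hd_sexp s)) (tl_sexp s)))
     (\<lambda>c s a r v. sapp (sserved (tl_sexp s)) v) Leaf (Pair (enc_nat k) (enc_list (item_code B) R')) (enc_un f) \<and>
   size (sselect_aux (Pair (enc_nat k) (enc_list (item_code B) R')) (enc_un f)) \<le> f * (S * (5 * S + 1))"
  using assms(1,2,3)
proof (induction f arbitrary: k R')
  case 0
  let ?S = "size (enc_list (item_code B) R)"
  have "?S * (5 * ?S + 1) \<le> S * (5 * S + 1)" using assms(4) by (intro mult_mono) auto
  with dominated_size[OF 0(1), of B] 0(2) show ?case by (simp add: sselect_aux_def)
next
  case (Suc f)
  let ?S = "size (enc_list (item_code B) R)" and ?G = "S * (5 * S + 1)"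
  have "?S * (5 * ?S + 1) \<le> ?G" using assms(4) by (intro mult_mono) auto
  with dominated_size[OF Suc.prems(1), of B] have G: "size (enc_list (item_code B) R') \<le> ?G" by linarith
  have "size (enc_nat (k div 2)) \<le> K" using size_tl_le[of "enc_nat k"] Suc.prems(2) by simp
  from Suc.IH[OF dominated_half[OF Suc.prems(1), of "odd k"] this] Suc.prems(3)
  have IH: "srec_bounded (1 + K + Suc F * ?G)
     (\<lambda>c s. Leaf) (\<lambda>c s a r. Pair (tl_sexp (hd_sexp s)) (shalf (hd_sexp (hd_sexp s)) (tl_sexp s)))
     (\<lambda>c s a r v. sapp (sserved (tl_sexp s)) v) Leaf (Pair (enc_nat (k div 2)) (enc_list (item_code B) (half (odd k) R'))) (enc_un f)"
   "size (sselect_aux (Pair (enc_nat (k div 2)) (enc_list (item_code B) (half (odd k) R'))) (enc_un f)) \<le> f * ?G"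
    by auto
  have eq: "sselect_aux (Pair (enc_nat k) (enc_list (item_code B) R')) (enc_un (Suc f)) =
    sapp (sserved (enc_list (item_code B) R'))
      (sselect_aux (Pair (enc_nat (k div 2)) (enc_list (item_code B) (half (odd k) R'))) (enc_un f))"
    by (simp add: sselect_aux_def shalf_enc)
  have sz: "size (sselect_aux (Pair (enc_nat k) (enc_list (item_code B) R')) (enc_un (Suc f))) \<le> Suc f * ?G"
    unfolding eq size_sapp using IH(2) G size_sserved[of "enc_list (item_code B) R'"] by simp
  moreover have "Suc f * ?G \<le> Suc F * ?G" using Suc.prems(3) by (intro mult_right_mono) auto
  moreover have "size (Pair (enc_nat k) (enc_list (item_code B) R')) \<le> 1 + K + Suc F * ?G"
    using G Suc.prems(2) by simp
  ultimately have st: "size (Pair (enc_nat k) (enc_list (item_code B) R')) \<le> 1 + K + Suc F * ?G"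
    and szF: "size (sselect_aux (Pair (enc_nat k) (enc_list (item_code B) R')) (enc_un (Suc f))) \<le> 1 + K + Suc F * ?G"
    by linarith+
  have "srec_bounded (1 + K + Suc F * ?G)
     (\<lambda>c s. Leaf) (\<lambda>c s a r. Pair (tl_sexp (hd_sexp s)) (shalf (hd_sexp (hd_sexp s)) (tl_sexp s)))
     (\<lambda>c s a r v. sapp (sserved (tl_sexp s)) v) Leaf (Pair (enc_nat k) (enc_list (item_code B) R')) (enc_un (Suc f))"
    unfolding enc_un_simps srec_bounded.simps
    by (intro conjI st szF[unfolded sselect_aux_def enc_un_simps])
      (use IH(1) in \<open>simp add: shalf_enc del: mult_Suc mult_Suc_right\<close>)
  with sz show ?case by blast
qed

text \<open>The size bound rests on the numerical meaning of the masses; therefore \<open>D\<close>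
  is confined to inputs whose state encodes a list of items.\<close>

lemma ptime_sselect_aux:
  assumes S: "ptime D S" and L: "ptime D L"
    and enc: "\<And>x. x \<in> D \<Longrightarrow> \<exists>k B R f. S x = Pair (enc_nat k) (enc_list (item_code B) R) \<and> L x = enc_un f"
  shows "ptime D (\<lambda>x. sselect_aux (S x) (L x))"
proof -
  from S obtain TS where TS: "polyf TS" "\<And>x. x \<in> D \<Longrightarrow> size (S x) \<le> TS (size x)" by (rule ptimeE) auto
  from L obtain TL where TL: "polyf TL" "\<And>x. x \<in> D \<Longrightarrow> size (L x) \<le> TL (size x)" by (rule ptimeE) auto
  show ?thesis unfolding sselect_aux_def
  proof (rule ptime_srec_on[where p = "\<lambda>n. 1 + TS n + Suc (TL n) * (TS n * (5 * TS n + 1))"], goal_cases)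
    case (8 x)
    from enc[OF 8] obtain k B R f where *: "S x = Pair (enc_nat k) (enc_list (item_code B) R)" "L x = enc_un f" by blast
    have "dominated R R" by (auto simp: dominated_def)
    moreover have "f \<le> TL (size x)" using TL(2)[OF 8] * by simp
    moreover have "size (enc_nat k) \<le> TS (size x)" "size (enc_list (item_code B) R) \<le> TS (size x)"
      using TS(2)[OF 8] * by auto
    ultimately show ?case unfolding * using sselect_bounded by blast
  qed (intro ptime_intros S L polyf_intros TS TL)+
qed

section \<open>Scaling rational weights, and the program for a day\<close>

definition num :: "rat \<Rightarrow> nat" where "num r = nat (fst (quotient_of r))"
definition den :: "rat \<Rightarrow> nat" where "den r = nat (snd (quotient_of r))"

lemma enc_rat_eq: "enc_rat r = Pair (enc_nat (num r)) (enc_nat (den r))"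
  by (simp add: enc_rat_def num_def den_def case_prod_beta)

lemma den_pos: "den r > 0"
  using quotient_of_denom_pos'[of r] by (simp add: den_def)

lemma num_eq: "r \<ge> 0 \<Longrightarrow> real (num r) = of_rat r * real (den r)"
proof -
  assume r: "r \<ge> 0"
  obtain a b where ab: "quotient_of r = (a, b)" by (cases "quotient_of r")
  have b: "b > 0" using quotient_of_denom_pos[OF ab] .
  have eq: "r = of_int a / of_int b" using quotient_of_div[OF ab] .
  have "a \<ge> 0" using r b unfolding eq by (simp add: zero_le_divide_iff)
  then have "real (num r) = of_int a" "real (den r) = of_int b" using b ab by (auto simp: num_def den_def)
  moreover have "(of_rat r :: real) = of_int a / of_int b" unfolding eq by (simp add: of_rat_divide)
  ultimately show ?thesis using b by simp
qed

definition raw_edge :: "rftt \<Rightarrow> nat \<times> nat \<Rightarrow> sexp" where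
  "raw_edge I = (\<lambda>(u, v). Pair (Pair (enc_nat u) (enc_nat v)) (enc_rat (weight I {u, v})))"

definition common_den :: "rftt \<Rightarrow> (nat \<times> nat) list \<Rightarrow> nat" where
  "common_den I es = (\<Prod>(u, v)\<leftarrow>es. den (weight I {u, v}))"

text \<open>The floor is a mere conversion to \<open>nat\<close>: on listed edges the product is an
  integer.\<close>

definition scaled_weight :: "rftt \<Rightarrow> (nat \<times> nat) list \<Rightarrow> nat set \<Rightarrow> nat" where
  "scaled_weight I es e = nat \<lfloor>of_rat (weight I e) * real (common_den I es)\<rfloor>"

lemma common_den_pos: "common_den I es > 0"
  by (induction es) (auto simp: common_den_def den_pos)

text \<open>Exchanging the edge's own denominator for its numerator scales the weight without any
  division.\<close>

lemma sscaled_enc: "sscaled (raw_edge I (u, v)) (enc_list (raw_edge I) es) =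
   enc_nat (\<Prod>f\<leftarrow>es. if f = (u, v) then num (weight I {u, v}) else den (weight I {fst f, snd f}))"
proof (induction es)
  case Nil show ?case by (simp add: sscaled_def enc_nat_pos)
next
  case (Cons f es)
  obtain a b where f: "f = (a, b)" by (cases f)
  have "sscaled (raw_edge I (u, v)) (enc_list (raw_edge I) (f # es)) =
     smul (enc_nat (if f = (u, v) then num (weight I {u, v}) else den (weight I {a, b}))) (sscaled (raw_edge I (u, v)) (enc_list (raw_edge I) es))"
    by (auto simp: sscaled_def raw_edge_def enc_rat_eq f)
  then show ?case unfolding Cons by (simp add: f)
qed

text \<open>The edge occurs exactly once in the list, so exactly one factor of
  \<open>common_den\<close> is exchanged.\<close>

lemma scaled_weight:
  assumes "rftt_instance I" "distinct es" "(u, v) \<in> set es" "{u, v} \<in> edges I"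
  shows "real (scaled_weight I es {u, v}) = of_rat (weight I {u, v}) * real (common_den I es)"
    and "(\<Prod>f\<leftarrow>es. if f = (u, v) then num (weight I {u, v}) else den (weight I {fst f, snd f})) = scaled_weight I es {u, v}"
proof -
  let ?d = "\<lambda>f. den (weight I {fst f, snd f})"
  let ?p = "\<Prod>f\<leftarrow>es. if f = (u, v) then num (weight I {u, v}) else den (weight I {fst f, snd f})"
  have w: "weight I {u, v} \<ge> 0" using assms by (auto simp: rftt_instance_def)
  from split_list[OF assms(3)] obtain xs ys where es: "es = xs @ (u, v) # ys" by blast
  then have "(u, v) \<notin> set xs" "(u, v) \<notin> set ys" using assms(2) by auto
  then have m: "map (\<lambda>f. if f = (u, v) then num (weight I {u, v}) else ?d f) xs = map ?d xs"
    "map (\<lambda>f. if f = (u, v) then num (weight I {u, v}) else ?d f) ys = map ?d ys"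
    by (auto intro!: map_cong)
  have "?p = prod_list (map ?d xs) * (num (weight I {u, v}) * prod_list (map ?d ys))"
    unfolding es map_append list.map m by simp
  moreover have "common_den I es = prod_list (map ?d xs) * (den (weight I {u, v}) * prod_list (map ?d ys))"
    by (simp add: common_den_def es case_prod_beta')
  ultimately have p: "real ?p = of_rat (weight I {u, v}) * real (common_den I es)"
    using num_eq[OF w] by simp
  then have "scaled_weight I es {u, v} = nat \<lfloor>real ?p\<rfloor>" by (simp add: scaled_weight_def)
  also have "\<dots> = ?p" by simp
  finally show "?p = scaled_weight I es {u, v}" ..
  with p show "real (scaled_weight I es {u, v}) = of_rat (weight I {u, v}) * real (common_den I es)" by simp
qed

lemma sscale_all_enc:
  assumes "rftt_instance I" "distinct es" "\<And>u v. (u, v) \<in> set es \<Longrightarrow> {u, v} \<in> edges I"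
  shows "sscale_all (enc_list (raw_edge I) es) = enc_list (edge_code (scaled_weight I es)) es"
proof -
  have "srec (\<lambda>c s. Leaf) (\<lambda>c s a r. s) (\<lambda>c s a r v. Pair (Pair (hd_sexp a) (sscaled a c)) v) C Leaf (enc_list f xs)
     = enc_list (\<lambda>x. Pair (hd_sexp (f x)) (sscaled (f x) C)) xs" for C xs and f :: "nat \<times> nat \<Rightarrow> sexp"
    by (induction xs) auto
  then have "sscale_all (enc_list (raw_edge I) es) =
    enc_list (\<lambda>x. Pair (hd_sexp (raw_edge I x)) (sscaled (raw_edge I x) (enc_list (raw_edge I) es))) es"
    by (simp add: sscale_all_def)
  also have "\<dots> = enc_list (edge_code (scaled_weight I es)) es"
  proof (rule enc_list_cong)
    fix x assume x: "x \<in> set es"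
    obtain u v where uv: "x = (u, v)" by (cases x)
    show "Pair (hd_sexp (raw_edge I x)) (sscaled (raw_edge I x) (enc_list (raw_edge I) es)) = edge_code (scaled_weight I es) x"
      unfolding uv sscaled_enc scaled_weight(2)[OF assms(1,2) x[unfolded uv] assms(3)[OF x[unfolded uv]]]
      by (simp add: raw_edge_def edge_code_def)
  qed
  finally show ?thesis .
qed

text \<open>The program for a single day, on input \<open>Pair (Pair x d) k\<close>; the description \<open>d\<close> is not used.\<close>

definition day_nodes :: "sexp \<Rightarrow> sexp" where
  "day_nodes z = sann (sbuild (sscale_all (hd_sexp (hd_sexp (hd_sexp z)))) (tl_sexp (hd_sexp (hd_sexp z))))"

definition day_counter :: "sexp \<Rightarrow> sexp" where
  "day_counter z = stotal (tl_sexp (hd_sexp (hd_sexp z)))"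

definition day_items :: "sexp \<Rightarrow> sexp" where
  "day_items z = sitems (tl_sexp (hd_sexp (hd_sexp z))) (day_counter z) (day_nodes z)"

text \<open>Classes range from 0 to the counter, so one more round than the counter is
  needed.\<close>

definition day_clients :: "sexp \<Rightarrow> sexp" where
  "day_clients z = sselect_aux (Pair (tl_sexp z) (day_items z)) (Pair Leaf (day_counter z))"

text \<open>The leading \<open>Leaf\<close> of the tour is the depot.\<close>

definition day_output :: "sexp \<Rightarrow> sexp" where
  "day_output z = Pair (Pair Leaf (swalk (day_clients z) (day_nodes z))) (day_clients z)"

definition day_inputs :: "sexp set" where
  "day_inputs = {z. \<exists>k B R m. tl_sexp z = enc_nat k \<and> day_items z = enc_list (item_code B) R \<and> day_counter z = enc_un m}"

lemma ptime_day_output: "ptime day_inputs day_output"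
proof -
  have 1: "ptime D day_nodes" for D unfolding day_nodes_def by (intro ptime_intros)
  have 2: "ptime D day_counter" for D unfolding day_counter_def by (intro ptime_intros)
  have 3: "ptime D day_items" for D unfolding day_items_def by (intro ptime_intros 1 2)
  have 4: "ptime day_inputs day_clients" unfolding day_clients_def
  proof (rule ptime_sselect_aux)
    fix z assume "z \<in> day_inputs"
    then obtain k B R m where "tl_sexp z = enc_nat k" "day_items z = enc_list (item_code B) R" "day_counter z = enc_un m"
      unfolding day_inputs_def by blast
    then show "\<exists>k B R f. Pair (tl_sexp z) (day_items z) = Pair (enc_nat k) (enc_list (item_code B) R) \<and>
       Pair Leaf (day_counter z) = enc_un f"
      by (intro exI[of _ k] exI[of _ B] exI[of _ R] exI[of _ "Suc m"]) simp
  qed (intro ptime_intros 2 3)+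
  show ?thesis unfolding day_output_def by (intro ptime_intros 1 4)
qed

section \<open>Feasibility and ratio of the schedule\<close>

text \<open>The part of \<open>r\<close> from the name \<open>hd q\<close> on is itself a path of
  the tree, and distinct names make it equal to \<open>q\<close>.\<close>

lemma in_path_iff:
  assumes "distinct (names t)" "q \<in> set (paths [] t)" "r \<in> set (paths [] t)"
  shows "hd q \<in> set r \<longleftrightarrow> suffix q r"
proof
  assume "suffix q r"
  then show "hd q \<in> set r" using paths_nonempty[OF assms(2)] by (auto simp: suffix_def)
next
  assume "hd q \<in> set r"
  then obtain xs ys where r: "r = xs @ hd q # ys" by (meson split_list)
  then have s: "suffix (hd q # ys) r" by (auto simp: suffix_def)
  then have "hd q # ys \<in> set (paths [] t)" using suffix_path[OF assms(3)] by blast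
  then have "hd q # ys = q" using hd_path_inj[OF assms(1) _ assms(2)] by simp
  with s show "suffix q r" by simp
qed

text \<open>As \<open>m\<close> is at least every logarithm, the minimum is attained at a vertex
  below \<open>q\<close>. Monotonicity holds because the subtree of a descendant is smaller.\<close>

lemma path_class:
  assumes t: "distinct (names t)" and m: "\<And>v. v \<in> set (names t) \<Longrightarrow> log2 (f v) \<le> m"
  shows "path_class f m t q \<le> m"
    and "q \<in> set (paths [] t) \<Longrightarrow> r \<in> set (paths [] t) \<Longrightarrow> suffix q r \<Longrightarrow> path_class f m t q \<le> log2 (f (hd r))"
    and "q \<in> set (paths [] t) \<Longrightarrow>
      \<exists>r\<in>set (paths [] t). suffix q r \<and> path_class f m t q = log2 (f (hd r))"
    and "q \<in> set (paths [] t) \<Longrightarrow> r \<in> set (paths [] t) \<Longrightarrow> suffix q r \<Longrightarrow> path_class f m t q \<le> path_class f m t r"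
proof -
  have fin: "finite (insert m ((\<lambda>r. log2 (f (hd r))) ` {r \<in> set (paths [] t). hd q \<in> set r}))" for q by simp
  show le: "path_class f m t q \<le> m" for q unfolding path_class_def by (rule Min_le[OF fin]) simp
  show le2: "path_class f m t q \<le> log2 (f (hd r))"
    if "q \<in> set (paths [] t)" "r \<in> set (paths [] t)" "suffix q r" for q r
    unfolding path_class_def by (rule Min_le[OF fin]) (use that in_path_iff[OF t] in auto)
  show ex: "\<exists>r\<in>set (paths [] t). suffix q r \<and> path_class f m t q = log2 (f (hd r))" if q: "q \<in> set (paths [] t)" for q
  proof -
    have "path_class f m t q \<in> insert m ((\<lambda>r. log2 (f (hd r))) ` {r \<in> set (paths [] t). hd q \<in> set r})"
      unfolding path_class_def by (rule Min_in[OF fin]) simp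
    then consider "path_class f m t q = m" | r where "r \<in> set (paths [] t)" "hd q \<in> set r" "path_class f m t q = log2 (f (hd r))" by auto
    then show ?thesis
    proof cases
      case 1
      have "hd q \<in> set (map hd (paths [] t))" using q by simp
      then have "log2 (f (hd q)) \<le> m" unfolding map_hd_paths by (rule m)
      then have "path_class f m t q = log2 (f (hd q))" using 1 le2[OF q q] by simp
      then show ?thesis using q by blast
    next
      case 2 then show ?thesis using in_path_iff[OF t q 2(1)] by blast
    qed
  qed
  show "path_class f m t q \<le> path_class f m t r"
    if "q \<in> set (paths [] t)" "r \<in> set (paths [] t)" "suffix q r" for q r
    using ex[OF that(2)] le2[OF that(1)] that(3) suffix_order.trans by metis
qed

text \<open>The names on a served path are the heads of its nonempty suffixes, and these are the
  paths of the ancestors.\<close>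

lemma set_served_names:
  assumes "distinct (names t)"
  defines "B \<equiv> euler [] t"
  shows "set (concat (map (\<lambda>i. served_names B (level k (items m cl W B) i)) [0..<Suc m])) = hd ` toured k m cl W t"
proof -
  let ?R = "items m cl W B"
  define F where "F n = (if fst (B ! n) = Visit then 0 else 2 ^ (m - cl (snd (B ! n))) * W (snd (B ! n)))" for n
  have "?R = map (\<lambda>n. (n, cl (snd (B ! n)), F n)) [0..<length B]" by (simp add: items_def F_def)
  then have inv: "level_inv (length B) (\<lambda>n. cl (snd (B ! n))) F i (level k ?R i)" for i
    using level_inv_level[OF level_inv_init] by metis
  have sp: "r \<in> set (paths [] t)" if "r \<in> served k m ?R B" for r
  proof -
    from that obtain n where "n < length B" "B ! n = (Visit, r)" by (auto simp: served_def)
    then have "r \<in> snd ` set B" using imageI[OF nth_mem, of n B snd] by simp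
    then show ?thesis by (simp add: B_def snd_euler)
  qed
  have "set (concat (map (\<lambda>i. served_names B (level k ?R i)) [0..<Suc m])) = \<Union> (set ` served k m ?R B)"
  proof (intro equalityI subsetI)
    fix v assume "v \<in> set (concat (map (\<lambda>i. served_names B (level k ?R i)) [0..<Suc m]))"
    then obtain i n w where *: "i \<le> m" "(n, 0, w) \<in> set (level k ?R i)" "fst (B ! n) = Visit" "v \<in> set (snd (B ! n))"
      by (auto simp: served_names_def less_Suc_eq_le split: if_splits simp del: upt_Suc)
    moreover have "n < length B" using level_invD(1)[OF inv *(2)] by simp
    moreover have "B ! n = (Visit, snd (B ! n))" using *(3) by (metis prod.collapse)
    ultimately have "snd (B ! n) \<in> served k m ?R B" unfolding served_def by blast
    with * show "v \<in> \<Union> (set ` served k m ?R B)" by blast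
  next
    fix v assume "v \<in> \<Union> (set ` served k m ?R B)"
    then obtain r i n w where "v \<in> set r" "i \<le> m" "(n, 0, w) \<in> set (level k ?R i)" "B ! n = (Visit, r)"
      by (auto simp: served_def)
    then show "v \<in> set (concat (map (\<lambda>i. served_names B (level k ?R i)) [0..<Suc m]))"
      by (force simp: served_names_def less_Suc_eq_le simp del: upt_Suc)
  qed
  also have "\<dots> = hd ` toured k m cl W t"
  proof (intro equalityI subsetI)
    fix v assume "v \<in> \<Union> (set ` served k m ?R B)"
    then obtain r where r: "r \<in> served k m ?R B" "v \<in> set r" by blast
    then obtain xs ys where e: "r = xs @ v # ys" by (meson split_list)
    then have s: "suffix (v # ys) r" by (auto simp: suffix_def)
    then have "v # ys \<in> toured k m cl W t"
      using suffix_path[OF sp[OF r(1)] s] r(1) unfolding toured_def B_def by blast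
    then show "v \<in> hd ` toured k m cl W t" by force
  next
    fix v assume "v \<in> hd ` toured k m cl W t"
    then obtain q r where "v = hd q" "q \<in> set (paths [] t)" "r \<in> served k m ?R B" "suffix q r"
      unfolding toured_def B_def by blast
    then show "v \<in> \<Union> (set ` served k m ?R B)"
      using in_path_iff[OF assms(1)] sp by blast
  qed
  finally show ?thesis .
qed

lemma span_tour_cong: "(\<And>q. q \<in> snd ` set B \<Longrightarrow> q \<in> X \<longleftrightarrow> q \<in> Y) \<Longrightarrow> span_tour X B = span_tour Y B"
  unfolding span_tour_def by (intro arg_cong[of _ _ concat] map_cong refl) force

lemma residue_in_window: "(r :: nat) < d \<Longrightarrow> d \<le> e \<Longrightarrow> \<exists>k\<in>{s + 1..s + e}. k mod d = r"
proof -
  assume rd: "r < d" and de: "d \<le> e"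
  \<comment> \<open>The first day from \<open>s + 1\<close> on with residue \<open>r\<close>; adding
    \<open>d\<close> avoids a truncated difference of residues.\<close>
  define k where "k = s + 1 + (r + (d - (s + 1) mod d)) mod d"
  have "k mod d = ((s + 1) mod d + (r + (d - (s + 1) mod d))) mod d"
    unfolding k_def by (metis mod_add_left_eq mod_add_right_eq)
  also have "(s + 1) mod d + (r + (d - (s + 1) mod d)) = r + d"
    using mod_less_divisor[of d "s + 1"] rd by linarith
  also have "(r + d) mod d = r" using rd by simp
  finally have "k mod d = r" .
  moreover have "(r + (d - (s + 1) mod d)) mod d < d" using rd by simp
  then have "s + 1 \<le> k" "k \<le> s + e" unfolding k_def using de by linarith+
  ultimately show ?thesis by auto
qed

theorem theorem4:
  "\<exists>(A :: prog) (D :: prog) (q :: nat poly).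
     \<forall>(I :: rftt) (x :: sexp). rftt_instance I \<and> is_tree I \<and> encodes I x \<longrightarrow>
       (\<exists>d t S.
          runs A x d t \<and> t \<le> poly q (size x) \<and>
          size d \<le> poly q (size x) \<and>
          describes D q x d S \<and>
          feasible I S \<and>
          max_tour_length I S \<le> 6 * OPT I)"
proof -
  obtain code L T where T: "polyf T" and run: "\<And>P n z. linked P n (code n) \<Longrightarrow> z \<in> day_inputs \<Longrightarrow>
      \<exists>t\<le>T (size z). evals P [z] (P ! n) (day_output z) t"
    and len: "\<And>P n. linked P n (code n) \<Longrightarrow> n < length P"
    using ptime_day_output by (rule ptimeE) blast
  have "polyf (\<lambda>n. Suc (T n))" by (intro polyf_intros T)
  \<comment> \<open>One polynomial serves both programs; the successor makes it at least 1, the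
    running time of \<open>[ELeaf]\<close>.\<close>
  then obtain q where q: "\<And>n. poly q n = Suc (T n)" unfolding polyf_def by metis
  have lk: "linked (code 0) 0 (code 0)" by (simp add: linked_def)
  show ?thesis
  proof (rule exI[of _ "[ELeaf]"], rule exI[of _ "code 0"], rule exI[of _ q], intro allI impI, elim conjE)
    fix I x assume inst: "rftt_instance I" and tree: "is_tree I" and "encodes I x"
    then obtain es where dist: "distinct (map (\<lambda>(u, v). {u, v}) es)" and es: "(\<lambda>(u, v). {u, v}) ` set es = edges I"
      and x: "x = Pair (enc_list (raw_edge I) es) (enc_list (\<lambda>j. enc_nat (turnover I j)) [1..<Suc (num_clients I)])"
      unfolding encodes_def raw_edge_def by blast
    define n where "n = num_clients I"
    define t where "t = build es n"
    define m where "m = (\<Sum>j\<leftarrow>[1..<Suc n]. slen (enc_nat (turnover I j)))"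
    define w where "w = scaled_weight I es"
    define W where "W = (\<lambda>q. w (pedge q))"
    define B where "B = euler [] t"
    define cl where "cl = path_class (turnover I) m t"
    define R where "R = items m cl W B"
    define X where "X k = toured k m cl W t" for k
    define Xs where "Xs k = concat (map (\<lambda>i. served_names B (level k R i)) [0..<Suc m])" for k
    define S where "S k = (0 # span_tour (X k) B, hd ` X k)" for k
    define P where "P = set (paths [] t)"
    define c where "c q = (of_rat (weight I (pedge q)) :: real)" for q
    have sp: "spanning I t" unfolding t_def n_def by (rule spanning_build[OF inst tree es])
    then have dn: "distinct (names t)" and nt: "set (names t) = clients I" and eP: "edges I = pedge ` P"
      by (auto simp: spanning_def P_def)
    have finP: "finite P" by (simp add: P_def)
    have des: "distinct es" using dist by (rule distinct_map[THEN iffD1, THEN conjunct1])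
    have ein: "{u, v} \<in> edges I" if "(u, v) \<in> set es" for u v using that unfolding es[symmetric] by force
    have XP: "X k \<subseteq> P" for k by (auto simp: X_def toured_def P_def)
    have clients: "clients I = {1..n}" by (simp add: clients_def n_def)
    have hdP: "hd q \<in> clients I" if "q \<in> P" for q using hd_path_client[OF sp] that by (simp add: P_def)
    have log_le: "log2 (turnover I v) \<le> m" if "v \<in> set (names t)" for v
    proof -
      have "v \<in> set [1..<Suc n]" using that nt clients by auto
      then have "slen (enc_nat (turnover I v)) \<le> m" unfolding m_def by (intro member_le_sum_list) auto
      then show ?thesis by (simp add: log2_def)
    qed
    have cl: "cl q \<le> m"
      "q \<in> P \<Longrightarrow> r \<in> P \<Longrightarrow> suffix q r \<Longrightarrow> cl q \<le> log2 (turnover I (hd r))"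
      "q \<in> P \<Longrightarrow> \<exists>r\<in>P. suffix q r \<and> cl q = log2 (turnover I (hd r))"
      "q \<in> P \<Longrightarrow> r \<in> P \<Longrightarrow> suffix q r \<Longrightarrow> cl q \<le> cl r" for q r
      unfolding cl_def P_def using path_class[of t "turnover I" m, OF dn] log_le by simp_all

    have out: "day_output (Pair (Pair x Leaf) (enc_nat k)) = Pair (enc_list enc_nat (fst (S k))) (enc_list enc_nat (Xs k))"
      and inp: "Pair (Pair x Leaf) (enc_nat k) \<in> day_inputs" and Xs: "set (Xs k) = snd (S k)" for k
    proof -
      let ?z = "Pair (Pair x Leaf) (enc_nat k)"
      have nodes: "day_nodes ?z = enc_list (node_code w) B"
        unfolding day_nodes_def x
        by (simp add: sscale_all_enc[OF inst des ein] sbuild_enc sann_enc w_def B_def t_def n_def del: upt_Suc)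
      have counter: "day_counter ?z = enc_un m"
        unfolding day_counter_def x by (simp only: hd_sexp.simps tl_sexp.simps stotal_enc m_def n_def)
      have its: "day_items ?z = enc_list (item_code B) R"
        unfolding day_items_def nodes counter unfolding x hd_sexp.simps tl_sexp.simps R_def cl_def W_def B_def n_def
        by (rule sitems_enc) (use nt clients in \<open>simp add: n_def\<close>)
      show "?z \<in> day_inputs" unfolding day_inputs_def using its counter by auto
      have cls: "day_clients ?z = enc_list enc_nat (Xs k)"
        unfolding day_clients_def its counter Xs_def using sselect_aux_enc[of k B R "Suc m"] by simp
      show Xs: "set (Xs k) = snd (S k)"
        unfolding Xs_def R_def B_def S_def X_def snd_conv by (rule set_served_names[OF dn])
      \<comment> \<open>The program recognises vertices by name, the analysis by path.\<close>
      have "span_tour {q. hd q \<in> set (Xs k)} B = span_tour (X k) B"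
      proof (rule span_tour_cong)
        fix q assume "q \<in> snd ` set B"
        then have "q \<in> P" by (simp add: B_def snd_euler P_def)
        then show "q \<in> {q. hd q \<in> set (Xs k)} \<longleftrightarrow> q \<in> X k"
          unfolding Xs using hd_path_inj[OF dn] XP[of k] by (auto simp: S_def P_def)
      qed
      moreover have "snd y \<noteq> []" if "y \<in> set B" for y
        using imageI[OF that, of snd] paths_nonempty unfolding B_def snd_euler by blast
      ultimately show "day_output ?z = Pair (enc_list enc_nat (fst (S k))) (enc_list enc_nat (Xs k))"
        unfolding day_output_def cls nodes using swalk_enc[of B "Xs k" w] by (simp add: S_def)
    qed

    have desc: "describes (code 0) q x Leaf S" unfolding describes_def
    proof (intro allI impI)
      fix k :: nat assume "1 \<le> k"
      let ?z = "Pair (Pair x Leaf) (enc_nat k)"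
      from run[OF lk inp] obtain t' where "t' \<le> T (size ?z)" "evals (code 0) [?z] (code 0 ! 0) (day_output ?z) t'" by blast
      moreover have "code 0 \<noteq> []" using len[OF lk] by auto
      ultimately have "runs (code 0) ?z (Pair (enc_list enc_nat (tour S k)) (enc_list enc_nat (Xs k))) t'"
        "t' \<le> poly q (size ?z)" unfolding runs_def out q by auto
      then show "\<exists>js t. set js = visited S k \<and> runs (code 0) ?z
         (Pair (enc_list enc_nat (tour S k)) (enc_list enc_nat js)) t \<and> t \<le> poly q (size ?z)"
        using Xs by blast
    qed

    have closed: "q \<in> X k" if "q \<in> set (paths [] t)" "r \<in> set (paths [] t)" "r \<in> X k" "suffix q r" for q r k
      using that unfolding X_def toured_def by (auto intro: suffix_order.trans)
    have edge: "pedge q \<in> edges I" if "q \<in> set (paths [] t)" for q using that eP by (simp add: P_def)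
    have tp: "last (0 # span_tour (X k) B) = 0 \<and> successively (\<lambda>u v. {u, v} \<in> edges I) (0 # span_tour (X k) B) \<and>
      walk_length I (0 # span_tour (X k) B) = (\<Sum>q\<leftarrow>paths [] t. if q \<in> X k then 2 * c q else 0) \<and>
      set (span_tour (X k) B) \<subseteq> insert 0 (set (names t)) \<and> hd ` (X k \<inter> P) \<subseteq> set (span_tour (X k) B)" for k
      unfolding B_def c_def P_def
      by (rule span_tour_props[of "[]" t I "X k", unfolded append_Nil list.sel(1)]) (use edge closed in blast)+
    have walk: "is_walk I (tour S k)" "hd (tour S k) = depot" "last (tour S k) = depot"
      "visited S k \<subseteq> clients I \<inter> set (tour S k)" for k
    proof -
      have "set (tour S k) \<subseteq> verts I" using tp[of k] nt by (auto simp: S_def verts_def depot_def)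
      then show "is_walk I (tour S k)" using tp[of k] by (simp add: is_walk_def S_def)
      show "hd (tour S k) = depot" "last (tour S k) = depot" using tp[of k] by (simp_all add: S_def depot_def)
      have "hd ` X k \<subseteq> set (span_tour (X k) B)" using tp[of k] XP[of k] by (auto simp: P_def Int_absorb2)
      then show "visited S k \<subseteq> clients I \<inter> set (tour S k)" using hdP XP[of k] by (auto simp: S_def)
    qed
    have len: "walk_length I (tour S k) = (\<Sum>q\<in>X k. 2 * c q)" for k
    proof -
      have "walk_length I (tour S k) = (\<Sum>q\<leftarrow>paths [] t. if q \<in> X k then 2 * c q else 0)"
        using tp[of k] by (simp add: S_def c_def)
      also have "\<dots> = (\<Sum>q\<in>P. if q \<in> X k then 2 * c q else 0)"
        unfolding P_def using distinct_paths[OF dn] by (rule sum_list_distinct_conv_sum_set)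
      also have "\<dots> = (\<Sum>q\<in>X k. 2 * c q)"
        using finP XP[of k] by (simp add: sum.If_cases Int_absorb1)
      finally show ?thesis .
    qed
    have feas: "feasible I S" unfolding feasible_def is_solution_def
    proof (intro conjI allI impI ballI)
      show "periodic S" unfolding periodic_def
        by (rule exI[of _ "2 ^ m"]) (simp add: S_def X_def toured_periodic)
      show "is_walk I (tour S k)" "hd (tour S k) = depot" "last (tour S k) = depot"
        "visited S k \<subseteq> clients I \<inter> set (tour S k)" for k by (fact walk)+
      fix s j assume j: "j \<in> clients I"
      then have "j \<in> set (map hd (paths [] t))" unfolding map_hd_paths nt .
      then obtain p where p: "p \<in> P" "hd p = j" by (auto simp: P_def)
      have "turnover I j \<ge> 1" using inst j by (simp add: rftt_instance_def)
      moreover have "cl p \<le> log2 (turnover I j)" using cl(2)[OF p(1) p(1)] p(2) by simp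
      moreover from this have "(2 :: nat) ^ cl p \<le> 2 ^ log2 (turnover I j)" by (rule power_increasing) simp
      \<comment> \<open>Rounding goes down, so a full period 2^(cl p) fits into every window of the
        client.\<close>
      ultimately have le: "2 ^ cl p \<le> turnover I j"
        using log2_bounds(1)[of "turnover I j"] by linarith
      from visited_regularly[of p t cl m W] p(1) cl(1)
      obtain r where r: "r < 2 ^ cl p" "\<And>k. k mod 2 ^ cl p = r \<Longrightarrow> p \<in> X k" unfolding X_def P_def by blast
      from residue_in_window[OF r(1) le] obtain k where "k \<in> {s + 1..s + turnover I j}" "k mod 2 ^ cl p = r" by blast
      with r(2) p(2) show "j \<in> (\<Union>k\<in>{s + 1..s + turnover I j}. visited S k)" by (force simp: S_def)
    qed

    have Q: "real (common_den I es) > 0" using common_den_pos by simp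
    have Wc: "real (W q) = c q * real (common_den I es)" if "q \<in> P" for q
    proof -
      have "pedge q \<in> (\<lambda>(u, v). {u, v}) ` set es" unfolding es eP using that by blast
      then obtain u v where uv: "(u, v) \<in> set es" "pedge q = {u, v}" by auto
      then show ?thesis using scaled_weight(1)[OF inst des uv(1) ein[OF uv(1)]] by (simp add: W_def w_def c_def)
    qed
    have c0: "c q \<ge> 0" if "q \<in> P" for q using inst eP that by (auto simp: c_def rftt_instance_def)
    have "walk_length I (tour S k) \<le> 6 * max_tour_length I S'" if S': "feasible I S'" for k S'
    proof -
      let ?M = "max_tour_length I S'"
      have "\<exists>z. (z = [] \<or> z \<in> P) \<and> 2 ^ m * (\<Sum>q\<in>X k. W q) \<le>
        (\<Sum>q\<leftarrow>paths [] t. 2 * 2 ^ (m - cl q) * W q) + 2 ^ m * (\<Sum>q\<in>{q \<in> P. suffix q z}. W q)"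
        unfolding X_def P_def by (rule toured_cost[OF dn cl(1)]) (use cl(4) in \<open>simp add: P_def\<close>)
      then obtain z where z: "z = [] \<or> z \<in> P"
        "2 ^ m * (\<Sum>q\<in>X k. W q) \<le> (\<Sum>q\<leftarrow>paths [] t. 2 * 2 ^ (m - cl q) * W q) +
           2 ^ m * (\<Sum>q\<in>{q \<in> P. suffix q z}. W q)" by blast
      have "(\<Sum>q\<leftarrow>paths [] t. 2 * 2 ^ (m - cl q) * W q) = (\<Sum>q\<in>P. 2 * 2 ^ (m - cl q) * W q)"
        unfolding P_def using distinct_paths[OF dn] by (rule sum_list_distinct_conv_sum_set)
      with z(2) have "real (2 ^ m * (\<Sum>q\<in>X k. W q)) \<le>
        real ((\<Sum>q\<in>P. 2 * 2 ^ (m - cl q) * W q) + 2 ^ m * (\<Sum>q\<in>{q \<in> P. suffix q z}. W q))" by linarith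
      also have "real (2 ^ m * (\<Sum>q\<in>X k. W q)) = (2 ^ m * real (common_den I es)) * (\<Sum>q\<in>X k. c q)"
      proof -
        have "(\<Sum>q\<in>X k. real (W q)) = (\<Sum>q\<in>X k. c q) * real (common_den I es)"
          using XP[of k] Wc by (simp add: sum_distrib_right subset_iff)
        then show ?thesis by simp
      qed
      also have "real ((\<Sum>q\<in>P. 2 * 2 ^ (m - cl q) * W q) + 2 ^ m * (\<Sum>q\<in>{q \<in> P. suffix q z}. W q)) =
        (2 ^ m * real (common_den I es)) * ((\<Sum>q\<in>P. 2 * c q / 2 ^ cl q) + (\<Sum>q\<in>{q \<in> P. suffix q z}. c q))"
      proof -
        have "(2 :: real) ^ (m - cl q) = 2 ^ m / 2 ^ cl q" for q using cl(1) by (simp add: power_diff)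
        then have "(\<Sum>q\<in>P. real (2 * 2 ^ (m - cl q) * W q)) = (\<Sum>q\<in>P. (2 ^ m * real (common_den I es)) * (2 * c q / 2 ^ cl q))"
          using Wc by (intro sum.cong) simp_all
        moreover have "(\<Sum>q\<in>{q \<in> P. suffix q z}. 2 ^ m * real (W q)) =
            (\<Sum>q\<in>{q \<in> P. suffix q z}. 2 ^ m * (real (common_den I es) * c q))"
          using Wc by (intro sum.cong) simp_all
        ultimately show ?thesis by (simp add: distrib_left sum_distrib_left mult.assoc)
      qed
      \<comment> \<open>The scaling factor 2^m and the common denominator cancel.\<close>
      finally have cost: "(\<Sum>q\<in>X k. c q) \<le> (\<Sum>q\<in>P. 2 * c q / 2 ^ cl q) + (\<Sum>q\<in>{q \<in> P. suffix q z}. c q)"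
        using Q by (simp add: mult_le_cancel_left_pos)
      \<comment> \<open>\<open>g q\<close> is a vertex below \<open>q\<close> that determines the
        class of \<open>q\<close>; its turnover time is less than 2 * 2^(cl q), which is the factor
        2 lost by rounding.\<close>
      obtain g where g: "\<And>q. q \<in> P \<Longrightarrow> g q \<in> P \<and> suffix q (g q) \<and> cl q = log2 (turnover I (hd (g q)))"
        using cl(3) by metis
      have "2 * c q / 2 ^ cl q \<le> 2 * (2 * c q / turnover I (hd (g q)))" if q: "q \<in> P" for q
      proof -
        have "turnover I (hd (g q)) \<ge> 1" using inst hdP g[OF q] by (simp add: rftt_instance_def)
        then have "0 < real (turnover I (hd (g q)))" by simp
        moreover have "real (turnover I (hd (g q))) \<le> real (2 * 2 ^ cl q)"
          using log2_bounds(2)[of "turnover I (hd (g q))"] g[OF q] by (intro of_nat_mono) simp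
        ultimately have "1 / 2 ^ cl q \<le> 2 / real (turnover I (hd (g q)))" by (simp add: field_simps)
        from mult_left_mono[OF this, of "2 * c q"] c0[OF q] show ?thesis by (simp add: field_simps)
      qed
      then have "(\<Sum>q\<in>P. 2 * c q / 2 ^ cl q) \<le> (\<Sum>q\<in>P. 2 * (2 * c q / turnover I (hd (g q))))" by (rule sum_mono)
      also have "\<dots> = 2 * (\<Sum>q\<in>P. 2 * c q / turnover I (hd (g q)))" by (simp only: sum_distrib_left)
      also have "(\<Sum>q\<in>P. 2 * c q / turnover I (hd (g q))) \<le> ?M"
        using average_le_max_tour[OF sp inst S', of g] g unfolding P_def c_def by simp
      finally have avg: "(\<Sum>q\<in>P. 2 * c q / 2 ^ cl q) \<le> 2 * ?M" by simp
      have depth: "2 * (\<Sum>q\<in>{q \<in> P. suffix q z}. c q) \<le> ?M"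
        using depth_le_max_tour[OF sp inst S', of z] z(1) unfolding P_def c_def by (simp add: sum_distrib_left)
      \<comment> \<open>The estimates add up to 2 * (2 * ?M) + ?M = 5 * ?M; nonnegativity relaxes
        this to the stated factor 6.\<close>
      have M0: "0 \<le> ?M"
      proof -
        have "0 \<le> (\<Sum>q\<in>{q \<in> P. suffix q z}. c q)" using c0 by (intro sum_nonneg) simp
        with depth show ?thesis by simp
      qed
      have "walk_length I (tour S k) = 2 * (\<Sum>q\<in>X k. c q)" unfolding len by (simp add: sum_distrib_left)
      then show ?thesis using cost avg depth M0 by linarith
    qed
    then have opt: "max_tour_length I S \<le> 6 * OPT I" using max_tour_le_OPT[OF feas, of 6] by simp
    have "runs [ELeaf] x Leaf 1" by (simp add: runs_def evals_evals_list.LeafE del: One_nat_def)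
    moreover have "1 \<le> poly q (size x)" "size Leaf \<le> poly q (size x)" by (simp_all add: q)
    ultimately show "\<exists>d t S. runs [ELeaf] x d t \<and> t \<le> poly q (size x) \<and> size d \<le> poly q (size x) \<and>
        describes (code 0) q x d S \<and> feasible I S \<and> max_tour_length I S \<le> 6 * OPT I"
      using desc feas opt by blast
  qed
qed

end
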